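(* Let $r,d\ge 1$. Every $2$-generated verbally closed subgroup $H$ of the free solvable group $S_{r,d}$ is a retract of $S_{r,d}$.
   Context: For a group $G$, the derived series is $G^{(0)}=G$, $G^{(i+1)}=[G^{(i)},G^{(i)}]$. $S_{r,d}=F_r/F_r^{(d)}$, where $F_r$ is the free group of rank $r$. A subgroup $H\le G$ is verbally closed in $G$ if for every group word $w(x_1,\dots,x_n)$ (without constants) and every $h\in H$, if the equation $w(x_1,\dots,x_n)=h$ has a solution in $G$, then it has a solution in $H$. A subgroup $H\le G$ is a retract of $G$ if there is an endomorphism $\rho:G\to G$ with $\rho(G)\subseteq H$ that is the identity on $H$. *)

theory Defs
  imports "HOL-Algebra.Algebra"
begin

text \<open>A letter (i, False) stands for the generator x_i, (i, True) for its inverse.\<close>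
type_synonym letter = "nat \<times> bool"

fun push :: "letter \<Rightarrow> letter list \<Rightarrow> letter list" where
  "push x [] = [x]"
| "push x (y # ys) = (if fst x = fst y \<and> snd x \<noteq> snd y then ys else x # y # ys)"

definition reduce :: "letter list \<Rightarrow> letter list" where
  "reduce w = foldr push w []"

definition inv_word :: "letter list \<Rightarrow> letter list" where
  "inv_word w = rev (map (\<lambda>(i, b). (i, \<not> b)) w)"

definition free_group :: "nat \<Rightarrow> (letter list) monoid" where
  "free_group r = \<lparr>carrier = {w. reduce w = w \<and> (\<forall>x \<in> set w. fst x < r)},
                    monoid.mult = (\<lambda>u v. reduce (u @ v)), one = []\<rparr>"

definition free_solvable :: "nat \<Rightarrow> nat \<Rightarrow> letter list set monoid" where
  "free_solvable r d =
     free_group r Mod (((derived (free_group r)) ^^ d) (carrier (free_group r)))"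

definition word_eval :: "('a, 'b) monoid_scheme \<Rightarrow> (nat \<Rightarrow> 'a) \<Rightarrow> letter list \<Rightarrow> 'a" where
  "word_eval G a w =
     foldr (\<lambda>(i, b) acc. (if b then inv\<^bsub>G\<^esub> (a i) else a i) \<otimes>\<^bsub>G\<^esub> acc) w \<one>\<^bsub>G\<^esub>"

definition verbally_closed :: "('a, 'b) monoid_scheme \<Rightarrow> 'a set \<Rightarrow> bool" where
  "verbally_closed G H \<longleftrightarrow> subgroup H G \<and>
     (\<forall>w h. h \<in> H \<longrightarrow>
        (\<exists>a. (\<forall>i. a i \<in> carrier G) \<and> word_eval G a w = h) \<longrightarrow>
        (\<exists>a. (\<forall>i. a i \<in> H) \<and> word_eval G a w = h))"

definition is_retract :: "('a, 'b) monoid_scheme \<Rightarrow> 'a set \<Rightarrow> bool" where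
  "is_retract G H \<longleftrightarrow> subgroup H G \<and>
     (\<exists>\<rho>. \<rho> \<in> hom G G \<and> \<rho> ` carrier G \<subseteq> H \<and> (\<forall>x \<in> H. \<rho> x = x))"

end

theory Submission
  imports Defs "HOL-Library.Function_Algebras"
begin

text \<open>
  Let \<open>F\<close> be free of rank \<open>r\<close> with derived series \<open>K k\<close>, and lift \<open>H\<close> to \<open>L = \<langle>A, B\<rangle> \<le> F\<close>. Applying verbal
  closedness to a word representing \<open>v \<in> L\<close> yields an endomorphism \<open>\<psi>\<close> of \<open>F\<close> with image in \<open>L\<close> that fixes
  \<open>v\<close> modulo \<open>K d\<close>. If \<open>A, B\<close> are independent modulo \<open>F'\<close> and \<open>d \<ge> 2\<close>, then \<open>v\<close> can be chosen as
  a test element: \<open>\<psi> v = v\<close> forces \<open>\<psi>\<close> to induce an automorphism of \<open>H\<close>, and its inverse composed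
  with \<open>\<psi>\<close> is the retraction.

  By Fox calculus the layer \<open>N = K (d - 1) / K d\<close> embeds into the finitely supported integer
  functions on the edges of the Cayley graph of \<open>S = F / K (d - 1)\<close>. Let \<open>z \<in> N\<close> be an iterated commutator of \<open>A\<close> and its \<open>B\<close>-conjugates, \<open>u\<close>
  the analogous element of \<open>S\<close> with \<open>A\<close> and \<open>B\<close> exchanged, and
  \<open>v = (A ^ p - 2) (B ^ q - 2) (u - 1) z\<close>, with \<open>p, q\<close> large. If \<open>\<psi> A\<close> or \<open>\<psi> B\<close> lies in \<open>F'\<close>, then
  \<open>\<psi> v = 1\<close>; otherwise comparing supports level by level peels off the factors and gives \<open>\<psi> A = A\<close> and
  \<open>\<psi> B = B\<close> in \<open>S\<close> and \<open>\<psi> z = z\<close>. Inverting \<open>B - 1\<close> by a geometric series turns the defect of \<open>\<psi>\<close> into a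
  cocycle vanishing at \<open>B\<close>, and it vanishes if its value at \<open>z\<close> does; hence \<open>\<psi>\<close> is the
  identity on the part of \<open>N\<close> in \<open>H\<close>.

  If \<open>A, B\<close> are dependent modulo \<open>F'\<close>, then every layer \<open>U\<close> of \<open>H\<close> below the first satisfies
  \<open>U = (C - 1) U\<close> for a generator \<open>C\<close> of the abelianization, so \<open>U = 0\<close> and \<open>H\<close> is cyclic.
\<close>

section \<open>Free groups as reduced words\<close>

text \<open>A single equation fixes a single element, whereas a retraction has to fix all of
  \<open>H\<close>; so \<open>v\<close> must pin down \<open>\<psi>\<close> on both generators, and
  each of its factors excludes one failure. If \<open>\<psi> B\<close> lies in \<open>F'\<close>,
  then \<open>\<psi> u\<close> drops into \<open>K (d - 1)\<close>, acts trivially on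
  \<open>N\<close>, and \<open>u - 1\<close> dies; if \<open>\<psi> A\<close> lies in
  \<open>F'\<close>, then \<open>\<psi> z\<close> itself drops into \<open>K d\<close>. The 2 breaks
  a symmetry: \<open>(x - 1) f = (x^-1 - 1) (- x f)\<close>, so \<open>x - 1\<close> would not tell
  \<open>x\<close> from its inverse. The exponents \<open>p\<close> and \<open>q\<close> exceed the
  width of a finite support, and they are removed again because roots are unique modulo every
  \<open>K k\<close>.

  Cancelling a factor \<open>g - 1\<close> in the group ring rests on one fact: the quotients
  \<open>F / K k\<close> are torsion-free, so an element outside \<open>K k\<close> leaves no
  nonempty finite set of edges invariant. Infinite chains enter only to solve
  \<open>(B - 1) m = n\<close>; they are kept finite below every level, so that a lowest level
  exists.\<close>

definition inverse_letters :: "letter \<Rightarrow> letter \<Rightarrow> bool" where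
  "inverse_letters x y \<longleftrightarrow> fst x = fst y \<and> snd x \<noteq> snd y"

lemma push_Cons: "push x (y # ys) = (if inverse_letters x y then ys else x # y # ys)"
  by (simp add: inverse_letters_def)

declare push.simps(2) [simp del] push_Cons [simp]

definition reduced :: "letter list \<Rightarrow> bool" where
  "reduced w \<longleftrightarrow> reduce w = w"

lemma reduce_simps [simp]: "reduce [] = []" "reduce (x # w) = push x (reduce w)"
  by (simp_all add: reduce_def)

lemma reduced_Nil [simp]: "reduced []"
  by (simp add: reduced_def)

lemma length_push: "length (push x w) \<le> Suc (length w)"
  by (cases w) auto

lemma length_reduce: "length (reduce w) \<le> length w"
  by (induction w) (auto intro: order_trans[OF length_push])

text \<open>Were \<open>x\<close> to cancel against the head of \<open>reduce w\<close>, then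
  \<open>reduce w\<close> would be longer than \<open>w\<close>; but reduction never lengthens a
  word.\<close>

lemma reduced_ConsD: assumes "reduced (x # w)" shows "reduced w" "push x w = x # w"
proof -
  have *: "push x (reduce w) = x # w"
    using assms by (simp add: reduced_def)
  have "reduce w = w"
  proof (cases "reduce w")
    case Nil
    then show ?thesis using * by simp
  next
    case (Cons y ys)
    show ?thesis
    proof (cases "inverse_letters x y")
      case True
      then have "ys = x # w"
        using * Cons by simp
      then have "length (reduce w) > length w"
        using Cons by simp
      then show ?thesis
        using length_reduce[of w] by simp
    next
      case False
      then show ?thesis
        using * Cons by simp
    qed
  qed
  then show "reduced w" "push x w = x # w"
    using * by (simp_all add: reduced_def)
qed

lemma reduced_push: assumes "reduced w" shows "reduced (push x w)"
proof (cases w)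
  case Nil
  then show ?thesis by (simp add: reduced_def)
next
  case (Cons y ys)
  then show ?thesis
    using assms reduced_ConsD[of y ys]
    by (cases "inverse_letters x y") (simp_all add: reduced_def)
qed

lemma reduced_reduce [simp]: "reduced (reduce w)"
  by (induction w) (simp_all add: reduced_push)

lemma reduce_reduce [simp]: "reduce (reduce w) = reduce w"
  using reduced_reduce by (simp add: reduced_def)

lemma push_cancel: assumes "reduced w" "inverse_letters x y" shows "push x (push y w) = w"
proof (cases w)
  case Nil
  then show ?thesis using assms by (simp add: inverse_letters_def)
next
  case (Cons z zs)
  show ?thesis
  proof (cases "inverse_letters y z")
    case True
    then have "z = x"
      using assms(2) by (auto simp: inverse_letters_def prod_eq_iff)
    then show ?thesis
      using True Cons assms reduced_ConsD[of z zs] by simp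
  next
    case False
    then show ?thesis
      using Cons assms by simp
  qed
qed

text \<open>All well-definedness proofs on reduced words have this form: a recursion over letters in
  which inverse letters undo each other does not see reduction. It is applied to \<open>push\<close>
  itself, to word evaluation, exponent sums and Fox derivatives. The bound \<open>r\<close> confines
  the cancellation law to the letters of the free group in question.\<close>

lemma reduce_invariant:
  assumes Cons: "\<And>x w. f (x # w) = \<phi> x (f w)"
    and cancel: "\<And>x y w. inverse_letters x y \<Longrightarrow> fst x < r \<Longrightarrow> \<forall>z \<in> set w. fst z < r \<Longrightarrow>
      \<phi> x (\<phi> y (f w)) = f w"
    and "\<forall>x \<in> set w. fst x < r"
  shows "f (reduce w) = f w" "\<forall>x \<in> set (reduce w). fst x < r"
proof -
  have push: "f (push x w) = f (x # w) \<and> (\<forall>z \<in> set (push x w). fst z < r)"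
    if "\<forall>z \<in> set (x # w). fst z < r" for x w
  proof (cases w)
    case (Cons y ys)
    then show ?thesis
      using that cancel[of x y ys] assms(1) by simp
  qed (use that in simp)
  have "f (reduce w) = f w \<and> (\<forall>x \<in> set (reduce w). fst x < r)"
    using assms(3)
  proof (induction w)
    case (Cons x w)
    then have IH: "f (reduce w) = f w" "\<forall>z \<in> set (x # reduce w). fst z < r"
      by simp_all
    show ?case
      using push[OF IH(2)] assms(1)[of x "reduce w"] assms(1)[of x w] IH(1) by simp
  qed simp
  then show "f (reduce w) = f w" "\<forall>x \<in> set (reduce w). fst x < r"
    by auto
qed

lemma set_reduce: "\<forall>x \<in> set w. fst x < r \<Longrightarrow> \<forall>x \<in> set (reduce w). fst x < r"
  using reduce_invariant(2)[of "\<lambda>_. ()" "\<lambda>_ _. ()" r w] by simp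

text \<open>Letters act on reduced words by \<open>push\<close>, and inverse letters act by inverse
  maps (\<open>push_cancel\<close>). That the action of \<open>w\<close> depends on
  \<open>reduce w\<close> only is what makes the multiplication associative.\<close>

lemma foldr_push_reduce:
  assumes "reduced t" shows "foldr push (reduce w) t = foldr push w t"
proof -
  define r where "r = Suc (Max (insert 0 (fst ` set w)))"
  have "\<forall>x \<in> set w. fst x < r"
    by (auto simp: r_def less_Suc_eq_le)
  have red: "reduced (foldr push w t)" for w
    by (induction w) (simp_all add: assms reduced_push)
  show ?thesis
    by (rule reduce_invariant(1)[where \<phi> = push]) (use push_cancel red \<open>\<forall>x \<in> set w. _\<close> in auto)
qed

lemma foldr_push: "foldr push u (reduce v) = reduce (u @ v)"
  by (simp add: reduce_def)

lemma reduce_append_left: "reduce (reduce u @ v) = reduce (u @ v)"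
  by (metis foldr_push foldr_push_reduce reduced_reduce)

lemma reduce_append_right: "reduce (u @ reduce v) = reduce (u @ v)"
  by (metis foldr_push reduce_reduce)

lemma reduce_inv_word: "reduce (inv_word w @ w) = []"
proof (induction w)
  case Nil
  then show ?case by (simp add: inv_word_def)
next
  case (Cons x w)
  obtain i b where x: "x = (i, b)" by fastforce
  have "reduce ((i, \<not> b) # x # w) = reduce w"
    using push_cancel[of "reduce w" "(i, \<not> b)" x] by (simp add: x inverse_letters_def)
  then have "reduce (inv_word (x # w) @ x # w) = reduce (inv_word w @ reduce w)"
    by (simp add: inv_word_def x flip: foldr_push)
  then show ?case
    using Cons.IH by (simp add: reduce_append_right)
qed

lemma carrier_free_group:
  "w \<in> carrier (free_group r) \<longleftrightarrow> reduced w \<and> (\<forall>x \<in> set w. fst x < r)"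
  by (simp add: free_group_def reduced_def)

lemma mult_free_group: "u \<otimes>\<^bsub>free_group r\<^esub> v = reduce (u @ v)"
  by (simp add: free_group_def)

lemma one_free_group: "\<one>\<^bsub>free_group r\<^esub> = []"
  by (simp add: free_group_def)

lemma group_free_group: "group (free_group r)"
proof (rule groupI)
  show "x \<otimes>\<^bsub>free_group r\<^esub> y \<in> carrier (free_group r)"
    if "x \<in> carrier (free_group r)" "y \<in> carrier (free_group r)" for x y
  proof -
    have "\<forall>z \<in> set (x @ y). fst z < r"
      using that by (auto simp: carrier_free_group)
    then show ?thesis
      using set_reduce[of "x @ y" r] by (simp add: carrier_free_group mult_free_group)
  qed
  show "x \<otimes>\<^bsub>free_group r\<^esub> y \<otimes>\<^bsub>free_group r\<^esub> z = x \<otimes>\<^bsub>free_group r\<^esub> (y \<otimes>\<^bsub>free_group r\<^esub> z)" for x y z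
    by (simp add: mult_free_group reduce_append_left reduce_append_right)
  show "\<exists>y \<in> carrier (free_group r). y \<otimes>\<^bsub>free_group r\<^esub> x = \<one>\<^bsub>free_group r\<^esub>"
    if "x \<in> carrier (free_group r)" for x
  proof (rule bexI)
    show "reduce (inv_word x) \<otimes>\<^bsub>free_group r\<^esub> x = \<one>\<^bsub>free_group r\<^esub>"
      by (simp add: mult_free_group one_free_group reduce_append_left reduce_inv_word)
    have "\<forall>z \<in> set (inv_word x). fst z < r"
      using that by (auto simp: carrier_free_group inv_word_def)
    then show "reduce (inv_word x) \<in> carrier (free_group r)"
      using set_reduce by (simp add: carrier_free_group)
  qed
qed (simp_all add: carrier_free_group one_free_group mult_free_group reduced_def)

section \<open>Evaluation of words and the universal property of the free group\<close>

definition letter_val :: "('a, 'b) monoid_scheme \<Rightarrow> (nat \<Rightarrow> 'a) \<Rightarrow> letter \<Rightarrow> 'a" where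
  "letter_val G a x = (if snd x then inv\<^bsub>G\<^esub> a (fst x) else a (fst x))"

context group
begin

lemma word_eval_simps [simp]:
  "word_eval G a [] = \<one>" "word_eval G a (x # w) = letter_val G a x \<otimes> word_eval G a w"
  by (simp_all add: word_eval_def letter_val_def split: prod.split)

lemma letter_val_closed: "a (fst x) \<in> carrier G \<Longrightarrow> letter_val G a x \<in> carrier G"
  by (simp add: letter_val_def)

lemma word_eval_closed:
  "\<forall>x \<in> set w. a (fst x) \<in> carrier G \<Longrightarrow> word_eval G a w \<in> carrier G"
  by (induction w) (simp_all add: letter_val_closed)

lemma word_eval_append:
  "\<forall>x \<in> set (u @ v). a (fst x) \<in> carrier G \<Longrightarrow>
    word_eval G a (u @ v) = word_eval G a u \<otimes> word_eval G a v"
  by (induction u) (simp_all add: letter_val_closed word_eval_closed m_assoc)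

lemma word_eval_reduce:
  fixes w :: "letter list"
  assumes a: "\<And>i. i < r \<Longrightarrow> a i \<in> carrier G" and w: "\<forall>x \<in> set w. fst x < r"
  shows "word_eval G a (reduce w) = word_eval G a w"
proof (rule reduce_invariant(1)[where \<phi> = "\<lambda>x g. letter_val G a x \<otimes> g", OF _ _ w])
  fix x y and w :: "letter list"
  assume "inverse_letters x y" "fst x < r" "\<forall>z \<in> set w. fst z < r"
  moreover from this have "letter_val G a x \<otimes> letter_val G a y = \<one>"
    using a by (auto simp: letter_val_def inverse_letters_def)
  moreover from calculation have "letter_val G a x \<in> carrier G" "letter_val G a y \<in> carrier G"
    using a by (auto simp: letter_val_def inverse_letters_def)
  ultimately show "letter_val G a x \<otimes> (letter_val G a y \<otimes> word_eval G a w) = word_eval G a w"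
    using a word_eval_closed[of w a] by (metis l_one m_assoc)
qed simp

lemma word_eval_hom:
  assumes "\<And>i. i < r \<Longrightarrow> a i \<in> carrier G"
  shows "word_eval G a \<in> hom (free_group r) G"
proof (rule homI)
  fix u v
  assume uv: "u \<in> carrier (free_group r)" "v \<in> carrier (free_group r)"
  then show "word_eval G a u \<in> carrier G"
    using assms by (intro word_eval_closed) (auto simp: carrier_free_group)
  have *: "\<forall>x \<in> set (u @ v). fst x < r"
    using uv by (auto simp: carrier_free_group)
  then have "word_eval G a (u @ v) = word_eval G a u \<otimes> word_eval G a v"
    using assms by (intro word_eval_append) auto
  then show "word_eval G a (u \<otimes>\<^bsub>free_group r\<^esub> v) = word_eval G a u \<otimes> word_eval G a v"
    using word_eval_reduce[of r a, OF assms *] by (simp add: mult_free_group)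
qed

lemma word_eval_in_subgroup:
  assumes "subgroup H G" "\<And>i. i < r \<Longrightarrow> a i \<in> H" "\<forall>x \<in> set w. fst x < r"
  shows "word_eval G a w \<in> H"
  using assms(3)
proof (induction w)
  case Nil
  then show ?case using assms(1) by (simp add: subgroup.one_closed)
next
  case (Cons x w)
  then show ?case
    using assms(1,2) by (auto simp: letter_val_def intro!: subgroup.m_closed subgroup.m_inv_closed)
qed

end

lemma word_eval_comp:
  assumes "group G" "group L" "h \<in> hom G L" "\<forall>x \<in> set w. a (fst x) \<in> carrier G"
  shows "h (word_eval G a w) = word_eval L (\<lambda>i. h (a i)) w"
proof -
  interpret G: group G by fact
  interpret L: group L by fact
  interpret group_hom G L h
    by unfold_locales fact
  show ?thesis
    using assms(4)
  proof (induction w)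
    case (Cons x w)
    then show ?case
      by (simp add: letter_val_def G.word_eval_closed)
  qed simp
qed

definition free_gen :: "nat \<Rightarrow> letter list" where
  "free_gen i = [(i, False)]"

lemma free_gen_carrier: "i < r \<Longrightarrow> free_gen i \<in> carrier (free_group r)"
  by (simp add: free_gen_def carrier_free_group reduced_def)

lemma inv_free_gen: "i < r \<Longrightarrow> inv\<^bsub>free_group r\<^esub> (free_gen i) = [(i, True)]"
  by (rule group.inv_equality[OF group_free_group])
    (simp_all add: free_gen_def carrier_free_group mult_free_group one_free_group reduced_def inverse_letters_def)

text \<open>Turns list induction over reduced words into induction over group elements: the first
  letter becomes a group factor.\<close>

lemma Cons_free_group:
  assumes "x # w \<in> carrier (free_group r)"
  shows "w \<in> carrier (free_group r)" "fst x < r"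
    "x # w = letter_val (free_group r) free_gen x \<otimes>\<^bsub>free_group r\<^esub> w"
proof -
  show *: "w \<in> carrier (free_group r)" "fst x < r"
    using assms reduced_ConsD(1)[of x w] by (simp_all add: carrier_free_group)
  have "letter_val (free_group r) free_gen x = [x]"
    using * by (cases x) (simp add: letter_val_def free_gen_def inv_free_gen[unfolded free_gen_def])
  then show "x # w = letter_val (free_group r) free_gen x \<otimes>\<^bsub>free_group r\<^esub> w"
    using assms by (simp add: mult_free_group carrier_free_group reduced_def)
qed

lemma word_eval_free_gen:
  assumes "w \<in> carrier (free_group r)" shows "word_eval (free_group r) free_gen w = w"
  using assms
proof (induction w)
  case Nil
  then show ?case by (simp add: group.word_eval_simps[OF group_free_group] one_free_group)
next
  case (Cons x w)
  then show ?case
    using Cons_free_group(1)[OF Cons.prems] Cons_free_group(3)[OF Cons.prems, symmetric]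
    by (simp add: group.word_eval_simps[OF group_free_group])
qed

section \<open>Chains on the edges of a Cayley graph\<close>

locale coset_module = normal K G for K and G (structure)
begin

text \<open>\<open>(x <# K, i)\<close> is the edge of the Cayley graph of \<open>G / K\<close> that
  leaves the vertex \<open>x <# K\<close> in direction \<open>i\<close>. The group acts from the
  left, so vertices are left cosets. Directions are not bounded, as \<open>G\<close> does not come
  with generators here.\<close>

definition edges :: "('a set \<times> nat) set" where
  "edges = {(x <# K, i) | x i. x \<in> carrier G}"

definition translate :: "'a \<Rightarrow> 'a set \<times> nat \<Rightarrow> 'a set \<times> nat" where
  "translate g e = (g <# fst e, snd e)"

text \<open>The action \<open>(g f) e = f (g^-1 e)\<close>. Off \<open>edges\<close>, where
  \<open>translate\<close> need not be invertible, the value is set to 0; this is why laws such as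
  \<open>shift_one\<close> ask for support in \<open>edges\<close>.\<close>

definition shift :: "'a \<Rightarrow> ('a set \<times> nat \<Rightarrow> int) \<Rightarrow> 'a set \<times> nat \<Rightarrow> int" where
  "shift g f = (\<lambda>e. if e \<in> edges then f (translate (inv g) e) else 0)"

definition supp :: "('a set \<times> nat \<Rightarrow> int) \<Rightarrow> ('a set \<times> nat) set" where
  "supp f = {e. f e \<noteq> 0}"

definition fin_chains :: "('a set \<times> nat \<Rightarrow> int) set" where
  "fin_chains = {f. supp f \<subseteq> edges \<and> finite (supp f)}"

lemma K_subset: "K \<subseteq> carrier G"
  using subset .

lemma edgesE:
  assumes "e \<in> edges" obtains x i where "x \<in> carrier G" "e = (x <# K, i)"
  using assms by (auto simp: edges_def)

lemma edgesI [simp]: "x \<in> carrier G \<Longrightarrow> (x <# K, i) \<in> edges"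
  by (auto simp: edges_def)

lemma l_coset_one_K: "\<one> <# K = K"
  using lcos_mult_one K_subset by blast

lemma edges_base [simp]: "(K, i) \<in> edges"
  using edgesI[of \<one> i] l_coset_one_K by simp

lemma translate_coset [simp]:
  "g \<in> carrier G \<Longrightarrow> x \<in> carrier G \<Longrightarrow> translate g (x <# K, i) = ((g \<otimes> x) <# K, i)"
  using lcos_m_assoc K_subset by (simp add: translate_def)

lemma translate_edges [simp]: "g \<in> carrier G \<Longrightarrow> e \<in> edges \<Longrightarrow> translate g e \<in> edges"
  by (auto elim!: edgesE)

lemma translate_mult:
  "g \<in> carrier G \<Longrightarrow> h \<in> carrier G \<Longrightarrow> e \<in> edges \<Longrightarrow>
    translate g (translate h e) = translate (g \<otimes> h) e"
  by (auto elim!: edgesE simp: m_assoc)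

lemma translate_one: "e \<in> edges \<Longrightarrow> translate \<one> e = e"
  by (auto elim!: edgesE)

lemma translate_inv [simp]:
  assumes "g \<in> carrier G" "e \<in> edges"
  shows "translate (inv g) (translate g e) = e" "translate g (translate (inv g) e) = e"
  using assms by (simp_all add: translate_mult translate_one)

lemma l_coset_eq_iff:
  assumes "x \<in> carrier G" "y \<in> carrier G"
  shows "x <# K = y <# K \<longleftrightarrow> inv x \<otimes> y \<in> K"
proof
  assume "x <# K = y <# K"
  moreover have "y \<in> y <# K"
    using assms one_closed by (auto simp: l_coset_def intro!: bexI[of _ \<one>])
  ultimately obtain k where "k \<in> K" "y = x \<otimes> k"
    by (auto simp: l_coset_def)
  then show "inv x \<otimes> y \<in> K"
    using assms by (simp add: mem_carrier flip: m_assoc)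
next
  assume *: "inv x \<otimes> y \<in> K"
  have "y = x \<otimes> (inv x \<otimes> y)"
    using assms by (simp flip: m_assoc)
  then have "y \<in> x <# K"
    using * by (auto simp: l_coset_def)
  then show "x <# K = y <# K"
    using l_repr_independence[of y x K] assms subgroup_axioms by auto
qed

text \<open>As \<open>K\<close> is normal, \<open>k x K = x K\<close>: the action on edges is one of
  \<open>G / K\<close>.\<close>

lemma translate_K:
  assumes "k \<in> K" "e \<in> edges" shows "translate k e = e"
proof -
  obtain x i where x: "x \<in> carrier G" "e = (x <# K, i)"
    using assms(2) by (rule edgesE)
  have "inv x \<otimes> k \<otimes> x \<in> K"
    using inv_op_closed1[OF x(1) assms(1)] .
  then have "x <# K = (k \<otimes> x) <# K"
    using x assms(1) by (subst l_coset_eq_iff) (auto simp: mem_carrier m_assoc)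
  then show ?thesis
    using x assms(1) mem_carrier by (metis translate_coset)
qed

lemma shift_apply: "e \<in> edges \<Longrightarrow> shift g f e = f (translate (inv g) e)"
  by (simp add: shift_def)

lemma supp_shift_subset: "supp (shift g f) \<subseteq> edges"
  by (auto simp: shift_def supp_def)

lemma shift_eqI:
  assumes "supp f \<subseteq> edges" "\<And>e. e \<in> edges \<Longrightarrow> shift g h e = f e" shows "shift g h = f"
  using assms by (intro ext) (auto simp: shift_def supp_def)

lemma shift_mult:
  "g \<in> carrier G \<Longrightarrow> h \<in> carrier G \<Longrightarrow> shift g (shift h f) = shift (g \<otimes> h) f"
  by (rule shift_eqI) (simp_all add: supp_shift_subset shift_apply translate_mult inv_mult_group)

lemma shift_K: "k \<in> K \<Longrightarrow> supp f \<subseteq> edges \<Longrightarrow> shift k f = f"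
  by (rule shift_eqI) (simp_all add: shift_apply translate_K m_inv_closed)

lemma shift_one: "supp f \<subseteq> edges \<Longrightarrow> shift \<one> f = f"
  by (rule shift_K) simp_all

lemma shift_add: "shift g (f + h) = shift g f + shift g h"
  by (auto simp: shift_def)

lemma shift_diff: "shift g (f - h) = shift g f - shift g h"
  by (auto simp: shift_def)

lemma shift_uminus: "shift g (- f) = - shift g f"
  by (auto simp: shift_def)

lemma shift_zero [simp]: "shift g 0 = 0"
  by (auto simp: shift_def)

lemma shift_cong_K:
  assumes "g \<in> carrier G" "h \<in> carrier G" "inv h \<otimes> g \<in> K" "supp f \<subseteq> edges"
  shows "shift g f = shift h f"
proof -
  have "shift g f = shift h (shift (inv h \<otimes> g) f)"
    using assms by (simp add: shift_mult flip: m_assoc)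
  then show ?thesis
    using assms by (simp add: shift_K)
qed

lemma supp_shift:
  assumes "g \<in> carrier G" "supp f \<subseteq> edges" shows "supp (shift g f) = translate g ` supp f"
proof -
  have "e \<in> translate g ` supp f" if "e \<in> supp (shift g f)" for e
  proof
    have "e \<in> edges"
      using that supp_shift_subset by blast
    then show "e = translate g (translate (inv g) e)" "translate (inv g) e \<in> supp f"
      using that assms by (auto simp: supp_def shift_apply)
  qed
  moreover have "translate g e \<in> supp (shift g f)" if "e \<in> supp f" for e
  proof -
    have "e \<in> edges"
      using that assms by blast
    then show ?thesis
      using that assms(1) by (simp add: supp_def shift_apply)
  qed
  ultimately show ?thesis
    by blast
qed

lemma supp_add: "supp (f + h) \<subseteq> supp f \<union> supp h"
  by (auto simp: supp_def)

lemma supp_diff: "supp (f - h) \<subseteq> supp f \<union> supp h"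
  by (auto simp: supp_def)

lemma supp_uminus [simp]: "supp (- f) = supp f"
  by (auto simp: supp_def)

lemma supp_zero [simp]: "supp 0 = {}"
  by (auto simp: supp_def)

lemma supp_empty_iff: "supp f = {} \<longleftrightarrow> f = 0"
  by (auto simp: supp_def)

lemma fin_chains_edges: "f \<in> fin_chains \<Longrightarrow> supp f \<subseteq> edges"
  by (simp add: fin_chains_def)

lemma fin_chains_closed [simp]:
  "0 \<in> fin_chains"
  "f \<in> fin_chains \<Longrightarrow> h \<in> fin_chains \<Longrightarrow> f + h \<in> fin_chains"
  "f \<in> fin_chains \<Longrightarrow> h \<in> fin_chains \<Longrightarrow> f - h \<in> fin_chains"
  "f \<in> fin_chains \<Longrightarrow> - f \<in> fin_chains"
  "g \<in> carrier G \<Longrightarrow> f \<in> fin_chains \<Longrightarrow> shift g f \<in> fin_chains"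
  using supp_add[of f h] supp_diff[of f h] supp_shift[of g f] supp_shift_subset[of g f]
  by (auto simp: fin_chains_def intro: finite_subset)

text \<open>Crossed homomorphisms on \<open>H\<close>. Support in \<open>edges\<close> is required
  but not its finiteness, because cocycles get corrected by coboundaries of infinite chains.\<close>

definition cocycle :: "'a set \<Rightarrow> ('a \<Rightarrow> 'a set \<times> nat \<Rightarrow> int) \<Rightarrow> bool" where
  "cocycle H D \<longleftrightarrow> (\<forall>g \<in> H. supp (D g) \<subseteq> edges) \<and> (\<forall>g \<in> H. \<forall>h \<in> H. D (g \<otimes> h) = D g + shift g (D h))"

lemma cocycle_mult: "cocycle H D \<Longrightarrow> g \<in> H \<Longrightarrow> h \<in> H \<Longrightarrow> D (g \<otimes> h) = D g + shift g (D h)"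
  by (simp add: cocycle_def)

lemma cocycle_edges: "cocycle H D \<Longrightarrow> g \<in> H \<Longrightarrow> supp (D g) \<subseteq> edges"
  by (simp add: cocycle_def)

lemma cocycle_one:
  assumes "cocycle H D" "subgroup H G" shows "D \<one> = 0"
proof -
  have "D \<one> = D \<one> + D \<one>"
    using cocycle_mult[OF assms(1), of \<one> \<one>] assms cocycle_edges[OF assms(1), of \<one>]
    by (simp add: subgroup.one_closed shift_one)
  then show ?thesis by simp
qed

lemma cocycle_inv:
  assumes "cocycle H D" "subgroup H G" "g \<in> H" shows "D (inv g) = - shift (inv g) (D g)"
proof -
  have "D (inv g \<otimes> g) = D (inv g) + shift (inv g) (D g)"
    using assms by (intro cocycle_mult) (auto simp: subgroup.m_inv_closed)
  moreover have "D (inv g \<otimes> g) = 0"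
    using assms cocycle_one subgroup.mem_carrier by fastforce
  ultimately show ?thesis
    by (simp add: eq_neg_iff_add_eq_0)
qed

text \<open>\<open>g k g^-1\<close> acts trivially on chains, so the contributions of
  \<open>g\<close> and of \<open>inv g\<close> cancel.\<close>

lemma cocycle_conj_K:
  assumes "cocycle H D" "subgroup H G" "g \<in> H" "k \<in> H" "k \<in> K"
  shows "D (g \<otimes> k \<otimes> inv g) = shift g (D k)"
proof -
  have g: "g \<in> carrier G" "inv g \<in> H" "g \<otimes> k \<in> H"
    using assms by (auto simp: subgroup.m_inv_closed subgroup.m_closed subgroup.mem_carrier)
  have "g \<otimes> k \<otimes> inv g \<in> K"
    using assms g inv_op_closed2 by blast
  then have "shift (g \<otimes> k \<otimes> inv g) (D g) = D g"
    using cocycle_edges[OF assms(1,3)] by (rule shift_K)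
  moreover have "D (g \<otimes> k \<otimes> inv g) = D g + shift g (D k) + shift (g \<otimes> k) (D (inv g))"
    using assms g by (simp only: cocycle_mult[OF assms(1)])
  moreover have "shift (g \<otimes> k) (D (inv g)) = - shift (g \<otimes> k \<otimes> inv g) (D g)"
    using assms g by (simp only: cocycle_inv[OF assms(1-3)] shift_uminus shift_mult mem_carrier m_closed inv_closed)
  ultimately show ?thesis
    by (simp add: fun_eq_iff)
qed

lemma cocycle_eq_zero_on_generate:
  assumes "cocycle (generate G S) D" "S \<subseteq> carrier G" "\<And>s. s \<in> S \<Longrightarrow> D s = 0" "g \<in> generate G S"
  shows "D g = 0"
  using assms(4)
proof (induction rule: generate.induct)
  case one
  then show ?case
    using cocycle_one[OF assms(1) generate_is_subgroup[OF assms(2)]] .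
next
  case (incl h)
  then show ?case using assms by simp
next
  case (inv h)
  have "D (inv h) = - shift (inv h) (D h)"
    using inv by (intro cocycle_inv[OF assms(1) generate_is_subgroup[OF assms(2)]] generate.incl)
  then show ?case
    using assms(3)[OF inv] by simp
next
  case (eng h1 h2)
  then show ?case
    using cocycle_mult[OF assms(1), of h1 h2] by (simp only: shift_zero add_0)
qed

end

section \<open>Torsion-free quotients and finite invariant sets of edges\<close>

locale torsion_free_coset_module = coset_module +
  assumes torsion_free: "g \<in> carrier G \<Longrightarrow> n > 0 \<Longrightarrow> g [^] (n::nat) \<in> K \<Longrightarrow> g \<in> K"
begin

text \<open>The powers of \<open>g\<close> keep \<open>e\<close> inside a finite set, so two of them
  agree on \<open>e\<close>, and some \<open>g^k\<close> with \<open>k > 0\<close> stabilizes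
  \<open>e\<close>. By normality the stabilizer of an edge is \<open>K\<close>, and torsion-freeness
  passes from \<open>g^k\<close> to \<open>g\<close>.\<close>

lemma finite_invariant_imp_K:
  assumes g: "g \<in> carrier G" and S: "finite S" "S \<subseteq> edges" "e \<in> S" "\<And>e. e \<in> S \<Longrightarrow> translate g e \<in> S"
  shows "g \<in> K"
proof -
  have orbit: "translate (g [^] n) e \<in> S" for n :: nat
  proof (induction n)
    case 0
    then show ?case using S by (auto simp: translate_one)
  next
    case (Suc n)
    have "translate (g [^] Suc n) e = translate g (translate (g [^] n) e)"
      using g S(2,3) translate_mult[of g "g [^] n" e] nat_pow_Suc2[OF g, of n] by auto
    then show ?case using S(4)[OF Suc] by simp
  qed
  have "\<not> inj (\<lambda>n. translate (g [^] (n::nat)) e)"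
  proof
    assume "inj (\<lambda>n. translate (g [^] (n::nat)) e)"
    then have "infinite (range (\<lambda>n. translate (g [^] (n::nat)) e))"
      by (rule range_inj_infinite)
    then show False
      using orbit S(1) by (meson finite_subset image_subsetI)
  qed
  then obtain n' m' :: nat where "n' \<noteq> m'" "translate (g [^] n') e = translate (g [^] m') e"
    by (auto simp: inj_def)
  then obtain n m :: nat where nm: "n < m" "translate (g [^] n) e = translate (g [^] m) e"
    by (cases "n' < m'") (auto simp: not_less dest: le_neq_implies_less)
  obtain x i where x: "x \<in> carrier G" "e = (x <# K, i)"
    using S(2,3) by (blast elim: edgesE)
  have m: "g [^] m = g [^] n \<otimes> g [^] (m - n)"
    using nm(1) g by (simp add: nat_pow_mult)
  have "inv (g [^] n \<otimes> x) \<otimes> (g [^] m \<otimes> x) \<in> K"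
    using nm(2) x g l_coset_eq_iff[of "g [^] n \<otimes> x" "g [^] m \<otimes> x"] by simp
  also have "inv (g [^] n \<otimes> x) \<otimes> (g [^] m \<otimes> x) = inv x \<otimes> (inv (g [^] n) \<otimes> g [^] n) \<otimes> g [^] (m - n) \<otimes> x"
    using g x(1) by (simp only: m inv_mult_group m_assoc m_closed nat_pow_closed inv_closed)
  also have "\<dots> = inv x \<otimes> g [^] (m - n) \<otimes> x"
    using g x(1) by simp
  finally have "x \<otimes> (inv x \<otimes> g [^] (m - n) \<otimes> x) \<otimes> inv x \<in> K"
    by (rule inv_op_closed2[OF x(1)])
  also have "x \<otimes> (inv x \<otimes> g [^] (m - n) \<otimes> x) \<otimes> inv x = (x \<otimes> inv x) \<otimes> g [^] (m - n) \<otimes> (x \<otimes> inv x)"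
    using g x(1) by (simp only: m_assoc m_closed nat_pow_closed inv_closed)
  finally have "g [^] (m - n) \<in> K"
    using g x(1) by simp
  then show ?thesis
    using torsion_free[OF g, of "m - n"] nm(1) by simp
qed

text \<open>Serves to cancel factors \<open>g - 1\<close> with \<open>g\<close> outside
  \<open>K\<close>: the finite support of a fixed chain would be invariant under
  \<open>g\<close>.\<close>

lemma shift_fixed_imp_K:
  assumes "g \<in> carrier G" "f \<in> fin_chains" "f \<noteq> 0" "shift g f = f" shows "g \<in> K"
proof -
  obtain e where "e \<in> supp f"
    using assms(3) supp_empty_iff by blast
  moreover have "translate g e \<in> supp f" if "e \<in> supp f" for e
    using that supp_shift[OF assms(1), of f] assms by (auto simp: fin_chains_def)
  ultimately show ?thesis
    using finite_invariant_imp_K[OF assms(1), of "supp f" e] assms by (auto simp: fin_chains_def)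
qed

end

section \<open>Iterated commutators\<close>

context group
begin

definition comm :: "'a \<Rightarrow> 'a \<Rightarrow> 'a" where
  "comm x y = x \<otimes> y \<otimes> inv x \<otimes> inv y"

text \<open>Both arguments of \<open>comm\<close> lie in the same term of the derived series, so
  each step descends by one term. Both come from the one element \<open>iter_comm a b n\<close>, so
  a cocycle vanishing at \<open>b\<close> is multiplied in each step by an element of the group ring
  (\<open>cocycle_comm_conj\<close>).\<close>

primrec iter_comm :: "'a \<Rightarrow> 'a \<Rightarrow> nat \<Rightarrow> 'a" where
  "iter_comm a b 0 = a"
| "iter_comm a b (Suc n) = comm (iter_comm a b n) (b \<otimes> iter_comm a b n \<otimes> inv b)"

lemma comm_in_subgroup: "subgroup H G \<Longrightarrow> x \<in> H \<Longrightarrow> y \<in> H \<Longrightarrow> comm x y \<in> H"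
  by (simp add: comm_def subgroup.m_closed subgroup.m_inv_closed)

lemma conj_in_subgroup: "subgroup H G \<Longrightarrow> x \<in> H \<Longrightarrow> y \<in> H \<Longrightarrow> x \<otimes> y \<otimes> inv x \<in> H"
  by (simp add: subgroup.m_closed subgroup.m_inv_closed)

lemma iter_comm_in_subgroup:
  "subgroup H G \<Longrightarrow> a \<in> H \<Longrightarrow> b \<in> H \<Longrightarrow> iter_comm a b n \<in> H"
  by (induction n) (simp_all add: comm_in_subgroup conj_in_subgroup)

lemma iter_comm_closed [simp]:
  "a \<in> carrier G \<Longrightarrow> b \<in> carrier G \<Longrightarrow> iter_comm a b n \<in> carrier G"
  using iter_comm_in_subgroup[OF subgroup_self] .

lemma comm_in_derived: "x \<in> H \<Longrightarrow> y \<in> H \<Longrightarrow> comm x y \<in> derived G H"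
  by (auto simp: comm_def derived_def intro!: generate.incl)

end

section \<open>Levels, and chains bounded from below\<close>

context coset_module
begin

definition level :: "('a \<Rightarrow> int) \<Rightarrow> bool" where
  "level l \<longleftrightarrow> (\<forall>x \<in> carrier G. \<forall>y \<in> carrier G. l (x \<otimes> y) = l x + l y) \<and> (\<forall>k \<in> K. l k = 0)"

text \<open>The height of the initial vertex of an edge. The choice does no harm, since a level is
  constant on cosets of \<open>K\<close> (\<open>lev_coset\<close>).\<close>

definition lev :: "('a \<Rightarrow> int) \<Rightarrow> 'a set \<times> nat \<Rightarrow> int" where
  "lev l e = l (SOME x. x \<in> fst e)"

lemma level_mult: "level l \<Longrightarrow> x \<in> carrier G \<Longrightarrow> y \<in> carrier G \<Longrightarrow> l (x \<otimes> y) = l x + l y"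
  by (simp add: level_def)

lemma level_one: "level l \<Longrightarrow> l \<one> = 0"
  by (simp add: level_def)

lemma level_inv: "level l \<Longrightarrow> x \<in> carrier G \<Longrightarrow> l (inv x) = - l x"
  using level_mult[of l x "inv x"] level_one[of l] by simp

lemma level_pow: "level l \<Longrightarrow> x \<in> carrier G \<Longrightarrow> l (x [^] (n::nat)) = int n * l x"
  by (induction n) (simp_all add: level_one level_mult algebra_simps)

lemma level_conj: "level l \<Longrightarrow> x \<in> carrier G \<Longrightarrow> y \<in> carrier G \<Longrightarrow> l (x \<otimes> y \<otimes> inv x) = l y"
  by (simp add: level_mult level_inv)

lemma level_comm: "level l \<Longrightarrow> x \<in> carrier G \<Longrightarrow> y \<in> carrier G \<Longrightarrow> l (comm x y) = 0"
  by (simp add: comm_def level_mult level_inv)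

lemma level_iter_comm:
  "level l \<Longrightarrow> a \<in> carrier G \<Longrightarrow> b \<in> carrier G \<Longrightarrow> l a = 0 \<Longrightarrow> l (iter_comm a b n) = 0"
  by (cases n) (simp_all add: level_comm)

lemma lev_coset:
  assumes "level l" "x \<in> carrier G" shows "lev l (x <# K, i) = l x"
proof -
  have "x \<in> x <# K"
    using assms(2) one_closed by (auto simp: l_coset_def intro!: bexI[of _ \<one>])
  then have "(SOME y. y \<in> x <# K) \<in> x <# K"
    by (rule someI)
  then obtain k where k: "k \<in> K" "(SOME y. y \<in> x <# K) = x \<otimes> k"
    by (auto simp: l_coset_def)
  then have "l (x \<otimes> k) = l x"
    using assms by (simp add: level_def mem_carrier)
  then show ?thesis
    using k(2) by (simp add: lev_def)
qed

lemma lev_translate: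
  assumes "level l" "g \<in> carrier G" "e \<in> edges" shows "lev l (translate g e) = l g + lev l e"
  using assms by (auto elim!: edgesE simp: lev_coset level_mult)

text \<open>The Novikov completion of the finite chains in direction \<open>l\<close>: infinite
  supports are allowed if they escape upwards. Here \<open>b - 1\<close> with \<open>l b = 1\<close>
  can be inverted, and nonzero chains still have a lowest level.\<close>

definition bounded_chains :: "('a \<Rightarrow> int) \<Rightarrow> ('a set \<times> nat \<Rightarrow> int) set" where
  "bounded_chains l = {f. supp f \<subseteq> edges \<and> (\<forall>n. finite {e \<in> supp f. lev l e \<le> n})}"

lemma fin_chains_bounded: "f \<in> fin_chains \<Longrightarrow> f \<in> bounded_chains l"
  by (simp add: fin_chains_def bounded_chains_def)

lemma bounded_chains_edges: "f \<in> bounded_chains l \<Longrightarrow> supp f \<subseteq> edges"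
  by (simp add: bounded_chains_def)

lemma bounded_chains_diff:
  assumes "f \<in> bounded_chains l" "h \<in> bounded_chains l" shows "f - h \<in> bounded_chains l"
proof -
  have "finite {e \<in> supp (f - h). lev l e \<le> n}" for n
  proof (rule finite_subset)
    show "{e \<in> supp (f - h). lev l e \<le> n} \<subseteq> {e \<in> supp f. lev l e \<le> n} \<union> {e \<in> supp h. lev l e \<le> n}"
      using supp_diff[of f h] by blast
    show "finite ({e \<in> supp f. lev l e \<le> n} \<union> {e \<in> supp h. lev l e \<le> n})"
      using assms by (simp add: bounded_chains_def)
  qed
  then show ?thesis
    using assms supp_diff[of f h] by (auto simp: bounded_chains_def)
qed

lemma bounded_chains_uminus: "f \<in> bounded_chains l \<Longrightarrow> - f \<in> bounded_chains l"
  by (simp add: bounded_chains_def)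

lemma bounded_chains_add:
  "f \<in> bounded_chains l \<Longrightarrow> h \<in> bounded_chains l \<Longrightarrow> f + h \<in> bounded_chains l"
  using bounded_chains_diff[of f l "- h"] bounded_chains_uminus[of h l] by simp

lemma bounded_chains_shift:
  assumes "level l" "g \<in> carrier G" "f \<in> bounded_chains l" shows "shift g f \<in> bounded_chains l"
proof -
  have "{e \<in> supp (shift g f). lev l e \<le> n} \<subseteq> translate g ` {e \<in> supp f. lev l e \<le> n - l g}" for n
    using assms supp_shift[OF assms(2) bounded_chains_edges[OF assms(3)]] lev_translate[OF assms(1,2)]
      bounded_chains_edges[OF assms(3)]
    by (fastforce simp: subset_iff)
  moreover have "finite (translate g ` {e \<in> supp f. lev l e \<le> n})" for n
    using assms(3) by (simp add: bounded_chains_def)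
  ultimately have "finite {e \<in> supp (shift g f). lev l e \<le> n}" for n
    by (rule finite_subset)
  then show ?thesis
    using supp_shift_subset by (simp add: bounded_chains_def)
qed

lemma bounded_chains_lowest:
  assumes "f \<in> bounded_chains l" "f \<noteq> 0"
  obtains e where "e \<in> supp f" "\<And>e'. e' \<in> supp f \<Longrightarrow> lev l e \<le> lev l e'"
proof -
  obtain e0 where e0: "e0 \<in> supp f"
    using assms(2) supp_empty_iff by blast
  define S where "S = {e \<in> supp f. lev l e \<le> lev l e0}"
  have S: "finite S" "S \<noteq> {}"
    using assms(1) e0 unfolding S_def bounded_chains_def by (simp, blast)
  obtain e where e: "e \<in> S" "\<And>e'. e' \<in> S \<Longrightarrow> lev l e \<le> lev l e'"
    using ex_is_arg_min_if_finite[OF S, of "lev l"] by (auto simp: is_arg_min_linorder)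
  show ?thesis
  proof
    show "e \<in> supp f"
      using e by (simp add: S_def)
    show "lev l e \<le> lev l e'" if "e' \<in> supp f" for e'
      using e that by (cases "lev l e' \<le> lev l e0") (auto simp: S_def)
  qed
qed

text \<open>A geometric series inverts \<open>b - 1\<close> on chains bounded from below.\<close>

lemma solve_coboundary:
  assumes l: "level l" and b: "b \<in> carrier G" "l b = 1" and n: "n \<in> fin_chains"
  obtains m where "m \<in> bounded_chains l" "shift b m - m = n"
proof -
  have fin: "finite (supp n)" and n_edges: "supp n \<subseteq> edges"
    using n by (auto simp: fin_chains_def)
  define L where "L = Min (insert 0 (lev l ` supp n))"
  have L: "L \<le> lev l e" if "n e \<noteq> 0" for e
    using that fin by (auto simp: L_def supp_def)
  \<comment> \<open>\<open>translate (inv (b [^] k)) e\<close> has level \<open>lev l e - k\<close>,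
    so only the terms with \<open>k < N e\<close> can be nonzero.\<close>
  define N where "N e = nat (lev l e - L + 1)" for e
  \<comment> \<open>This is \<open>m = - (1 + b + b^2 + ...) n\<close>; the sign comes from
    inverting \<open>b - 1\<close> instead of \<open>1 - b\<close>.\<close>
  define m where "m e = (if e \<in> edges then - (\<Sum>k<N e. n (translate (inv (b [^] k)) e)) else 0)" for e
  have m_edges: "supp m \<subseteq> edges"
    by (auto simp: m_def supp_def split: if_splits)
  have "finite {e \<in> supp m. lev l e \<le> t}" for t
  proof (rule finite_subset)
    show "{e \<in> supp m. lev l e \<le> t} \<subseteq> (\<Union>k<nat (t - L + 1). translate (b [^] k) ` supp n)"
    proof
      fix e
      assume e: "e \<in> {e \<in> supp m. lev l e \<le> t}"
      then have edge: "e \<in> edges"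
        using m_edges by blast
      have "(\<Sum>k<N e. n (translate (inv (b [^] k)) e)) \<noteq> 0"
        using e edge by (simp add: supp_def m_def)
      then obtain k where k: "k < N e" "n (translate (inv (b [^] k)) e) \<noteq> 0"
        by (meson lessThan_iff sum.neutral)
      then have "e \<in> translate (b [^] k) ` supp n"
        using edge b(1) by (intro image_eqI[of _ _ "translate (inv (b [^] k)) e"]) (auto simp: supp_def)
      moreover have "k < nat (t - L + 1)"
        using k(1) e by (auto simp: N_def)
      ultimately show "e \<in> (\<Union>k<nat (t - L + 1). translate (b [^] k) ` supp n)"
        by blast
    qed
  qed (simp add: fin)
  then have "m \<in> bounded_chains l"
    using m_edges by (simp add: bounded_chains_def)
  moreover have "shift b m - m = n"
  proof
    fix e
    show "(shift b m - m) e = n e"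
    proof (cases "e \<in> edges")
      case False
      then show ?thesis
        using n_edges by (auto simp: shift_def m_def supp_def)
    next
      case True
      have lev: "lev l (translate (inv b) e) = lev l e - 1"
        using lev_translate[OF l inv_closed[OF b(1)] True] level_inv[OF l b(1)] b(2) by simp
      have step: "translate (inv (b [^] k)) (translate (inv b) e) = translate (inv (b [^] Suc k)) e" for k :: nat
        using True b(1) translate_mult[of "inv (b [^] k)" "inv b" e] nat_pow_Suc2[OF b(1), of k]
        by (simp add: inv_mult_group del: nat_pow_Suc)
      have "shift b m e = - (\<Sum>k<N (translate (inv b) e). n (translate (inv (b [^] Suc k)) e))"
        using True b(1) by (simp add: shift_apply m_def step del: nat_pow_Suc)
      moreover have "m e = - (\<Sum>k<N e. n (translate (inv (b [^] k)) e))"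
        using True by (simp add: m_def)
      moreover have "n e = 0" if "N e = 0"
        using L[of e] that by (force simp: N_def)
      moreover have "N e = Suc (N (translate (inv b) e))" if "N e \<noteq> 0"
        using that lev by (simp add: N_def)
      moreover have "N (translate (inv b) e) = 0" if "N e = 0"
        using that lev by (simp add: N_def)
      ultimately show ?thesis
        by (cases "N e = 0") (simp_all add: sum.lessThan_Suc_shift True translate_one del: nat_pow_Suc sum.lessThan_Suc)
    qed
  qed
  ultimately show ?thesis
    by (rule that)
qed

lemma cocycle_minus_coboundary:
  assumes D: "cocycle H D" and H: "H \<subseteq> carrier G" and m: "supp m \<subseteq> edges"
  shows "cocycle H (\<lambda>h. D h - (shift h m - m))"
proof -
  have "D (g \<otimes> h) - (shift (g \<otimes> h) m - m) =
      D g - (shift g m - m) + shift g (D h - (shift h m - m))" if "g \<in> H" "h \<in> H" for g h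
  proof -
    have "shift (g \<otimes> h) m = shift g (shift h m)"
      using that H by (simp add: shift_mult subset_iff)
    then show ?thesis
      using cocycle_mult[OF D that] by (simp add: shift_diff)
  qed
  moreover have "supp (D g - (shift g m - m)) \<subseteq> edges" if "g \<in> H" for g
    using cocycle_edges[OF D that] m supp_shift_subset[of g m]
      supp_diff[of "D g" "shift g m - m"] supp_diff[of "shift g m" m] by blast
  ultimately show ?thesis
    by (simp add: cocycle_def)
qed

text \<open>As \<open>D b = 0\<close>, the value at \<open>c'\<close> is \<open>b (D c)\<close>, and
  the four factors of the commutator add up to \<open>1 + c b - c c' c^-1 - [c, c'] b\<close>
  applied to \<open>D c\<close>. If \<open>c\<close> has level 0 and \<open>b\<close> has level 1,
  the two terms ending in \<open>b\<close> are pushed up by one level.\<close>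

lemma cocycle_comm_conj:
  assumes D: "cocycle H D" and H: "subgroup H G" and c: "c \<in> H" and b: "b \<in> H" "D b = 0"
  defines "c' \<equiv> b \<otimes> c \<otimes> inv b"
  shows "D (comm c c') = D c + shift (c \<otimes> b) (D c) - shift (c \<otimes> c' \<otimes> inv c) (D c) - shift (comm c c' \<otimes> b) (D c)"
proof -
  have mem: "inv b \<in> H" "inv c \<in> H" "b \<otimes> c \<in> H" "c' \<in> H" "inv c' \<in> H" "c \<otimes> c' \<in> H" "c \<otimes> c' \<otimes> inv c \<in> H"
    using c b H by (simp_all add: c'_def subgroup.m_closed subgroup.m_inv_closed)
  note car = this[THEN subgroup.mem_carrier[OF H]] c[THEN subgroup.mem_carrier[OF H]] b(1)[THEN subgroup.mem_carrier[OF H]]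
  have "D (inv b) = 0"
    using cocycle_inv[OF D H b(1)] b(2) by simp
  then have c': "D c' = shift b (D c)"
    using cocycle_mult[OF D mem(3,1)] cocycle_mult[OF D b(1) c] b(2) by (simp add: c'_def)
  have "D (comm c c') = D c + shift c (D c') + shift (c \<otimes> c') (D (inv c)) + shift (c \<otimes> c' \<otimes> inv c) (D (inv c'))"
    using mem c by (simp only: comm_def cocycle_mult[OF D])
  moreover have "shift c (D c') = shift (c \<otimes> b) (D c)"
    using car by (simp add: c' shift_mult)
  moreover have "shift (c \<otimes> c') (D (inv c)) = - shift (c \<otimes> c' \<otimes> inv c) (D c)"
    using car by (simp add: cocycle_inv[OF D H c] shift_uminus shift_mult)
  moreover have "shift (c \<otimes> c' \<otimes> inv c) (D (inv c')) = - shift (comm c c' \<otimes> b) (D c)"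
    using car by (simp add: cocycle_inv[OF D H mem(4)] shift_uminus shift_mult c' comm_def m_assoc)
  ultimately show ?thesis
    by (simp add: fun_eq_iff)
qed

end

section \<open>Nonvanishing of cocycles on iterated commutators\<close>

context torsion_free_coset_module
begin

text \<open>On the lowest level only \<open>f - g f\<close> survives, and \<open>g\<close> has no finite orbits.\<close>

lemma lowest_level_nonzero:
  assumes l: "level l" and f: "f \<in> bounded_chains l" "f \<noteq> 0"
    and g: "g \<in> carrier G" "g \<notin> K" "l g = 0"
    and g1: "g1 \<in> carrier G" "l g1 = 1" and g2: "g2 \<in> carrier G" "l g2 = 1"
  shows "f + shift g1 f - shift g f - shift g2 f \<noteq> 0"
proof
  assume zero: "f + shift g1 f - shift g f - shift g2 f = 0"
  obtain e0 where e0: "e0 \<in> supp f" "\<And>e'. e' \<in> supp f \<Longrightarrow> lev l e0 \<le> lev l e'"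
    using bounded_chains_lowest[OF f] by blast
  have edges: "supp f \<subseteq> edges"
    using f(1) by (rule bounded_chains_edges)
  define S where "S = {e \<in> supp f. lev l e \<le> lev l e0}"
  have "translate (inv g) e \<in> S" if e: "e \<in> S" for e
  proof -
    have e_edge: "e \<in> edges" and lev_e: "lev l e = lev l e0"
      using e edges e0(2)[of e] by (auto simp: S_def)
    have "f (translate (inv x) e) = 0" if "x \<in> carrier G" "l x = 1" for x
    proof -
      have "lev l (translate (inv x) e) < lev l e0"
        using lev_translate[OF l inv_closed[OF that(1)] e_edge] level_inv[OF l that(1)] that(2) lev_e by simp
      then show ?thesis
        using e0(2)[of "translate (inv x) e"] by (auto simp: supp_def)
    qed
    then have "f e = f (translate (inv g) e)"
      using fun_cong[OF zero, of e] e_edge g1 g2 by (simp add: shift_apply)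
    moreover have "lev l (translate (inv g) e) = lev l e"
      using lev_translate[OF l inv_closed[OF g(1)] e_edge] level_inv[OF l g(1)] g(3) by simp
    ultimately show ?thesis
      using e by (simp add: S_def supp_def)
  qed
  moreover have "finite S" "S \<subseteq> edges" "e0 \<in> S"
    using f(1) edges e0(1) by (auto simp: S_def bounded_chains_def)
  ultimately have "inv g \<in> K"
    using finite_invariant_imp_K[of "inv g" S e0] g(1) by blast
  then show False
    using g m_inv_closed[of "inv g"] by simp
qed

text \<open>Each step applies the element of \<open>cocycle_comm_conj\<close> to \<open>D c\<close>.
  Its part of level 0 is \<open>1 - g\<close> with \<open>g\<close> a conjugate of \<open>c\<close>,
  hence outside \<open>K\<close> as long as \<open>c\<close> is, and
  \<open>lowest_level_nonzero\<close> applies.\<close>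

lemma iter_comm_cocycle_nonzero:
  assumes D: "cocycle H D" and H: "subgroup H G" and l: "level l"
    and a: "a \<in> H" "l a = 0" "D a \<in> bounded_chains l" "D a \<noteq> 0"
    and b: "b \<in> H" "l b = 1" "D b = 0"
    and notin: "\<And>j. j < n \<Longrightarrow> iter_comm a b j \<notin> K"
  shows "D (iter_comm a b n) \<in> bounded_chains l \<and> D (iter_comm a b n) \<noteq> 0"
  using notin
proof (induction n)
  case 0
  then show ?case using a by (simp only: iter_comm.simps) blast
next
  case (Suc n)
  define c where "c = iter_comm a b n"
  define c' where "c' = b \<otimes> c \<otimes> inv b"
  have IH: "D c \<in> bounded_chains l" "D c \<noteq> 0"
    using Suc.IH Suc.prems less_SucI unfolding c_def by blast+
  have cH: "c \<in> H" and cK: "c \<notin> K"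
    using iter_comm_in_subgroup[OF H a(1) b(1)] Suc.prems[OF lessI] by (simp_all add: c_def)
  have car: "a \<in> carrier G" "b \<in> carrier G" "c \<in> carrier G" "c' \<in> carrier G"
    using a(1) b(1) cH subgroup.mem_carrier[OF H] by (auto simp: c'_def)
  have lc: "l c = 0"
    using level_iter_comm[OF l car(1,2) a(2)] by (simp add: c_def)
  have lc': "l c' = 0"
    using level_conj[OF l car(2,3)] lc by (simp add: c'_def)
  define g where "g = c \<otimes> c' \<otimes> inv c"
  have g: "g \<in> carrier G" "l g = 0"
    using car level_conj[OF l car(3,4)] lc' by (simp_all add: g_def)
  have "g \<notin> K"
  proof
    assume "g \<in> K"
    then have "inv c \<otimes> g \<otimes> c \<in> K"
      using car inv_op_closed1 by blast
    also have "inv c \<otimes> g \<otimes> c = (inv c \<otimes> c) \<otimes> c' \<otimes> (inv c \<otimes> c)"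
      using car by (simp only: g_def m_assoc m_closed inv_closed)
    finally have "c' \<in> K"
      using car by simp
    then have "inv b \<otimes> c' \<otimes> b \<in> K"
      using car inv_op_closed1 by blast
    also have "inv b \<otimes> c' \<otimes> b = (inv b \<otimes> b) \<otimes> c \<otimes> (inv b \<otimes> b)"
      using car by (simp only: c'_def m_assoc m_closed inv_closed)
    finally show False
      using car cK by simp
  qed
  have l1: "l (c \<otimes> b) = 1" "l (comm c c' \<otimes> b) = 1"
    using car lc b(2) level_comm[OF l car(3,4)] by (simp_all add: level_mult[OF l] comm_def)
  have comm_car: "comm c c' \<otimes> b \<in> carrier G"
    using car by (simp add: comm_def)
  have eq: "D (iter_comm a b (Suc n)) = D c + shift (c \<otimes> b) (D c) - shift g (D c) - shift (comm c c' \<otimes> b) (D c)"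
    using cocycle_comm_conj[OF D H cH b(1,3)] by (simp add: c_def c'_def g_def)
  have "D (iter_comm a b (Suc n)) \<noteq> 0"
    unfolding eq
    by (rule lowest_level_nonzero[OF l IH g(1) \<open>g \<notin> K\<close> g(2) _ l1(1) comm_car l1(2)]) (simp add: car)
  moreover have "D (iter_comm a b (Suc n)) \<in> bounded_chains l"
    unfolding eq using IH(1) car g(1) comm_car
    by (intro bounded_chains_diff bounded_chains_add bounded_chains_shift[OF l]) simp_all
  ultimately show ?case
    by blast
qed

text \<open>Above the highest level of the support of \<open>shift c m - m\<close> the chain
  \<open>m\<close> is invariant under \<open>c\<close>. There \<open>c\<close>, being of level 0,
  would permute the finitely many edges of \<open>m\<close> on a single level, which is impossible
  outside \<open>K\<close>. So \<open>m\<close> is bounded from above as well.\<close>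

lemma coboundary_fin_chain:
  assumes l: "level l" and m: "m \<in> bounded_chains l"
    and c: "c \<in> carrier G" "l c = 0" "c \<notin> K" "shift c m - m \<in> fin_chains"
  shows "m \<in> fin_chains"
proof -
  define f where "f = shift c m - m"
  define T where "T = Max (insert 0 (lev l ` supp f))"
  have fin: "finite (supp f)"
    using c(4) by (simp add: f_def fin_chains_def)
  have edges: "supp m \<subseteq> edges"
    using m by (rule bounded_chains_edges)
  have "lev l e0 \<le> T" if e0: "e0 \<in> supp m" for e0
  proof (rule ccontr)
    assume "\<not> lev l e0 \<le> T"
    define S where "S = {e \<in> supp m. lev l e = lev l e0}"
    have "translate (inv c) e \<in> S" if "e \<in> S" for e
    proof -
      have e: "e \<in> edges" "lev l e = lev l e0" "m e \<noteq> 0"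
        using that edges by (auto simp: S_def supp_def)
      have "e \<notin> supp f"
      proof
        assume "e \<in> supp f"
        then have "lev l e \<le> T"
          using fin by (simp add: T_def)
        then show False
          using e \<open>\<not> lev l e0 \<le> T\<close> by simp
      qed
      then have "m (translate (inv c) e) = m e"
        using e(1) by (simp add: f_def supp_def shift_apply)
      moreover have "lev l (translate (inv c) e) = lev l e"
        using lev_translate[OF l inv_closed[OF c(1)] e(1)] level_inv[OF l c(1)] c(2) by simp
      ultimately show ?thesis
        using e by (simp add: S_def supp_def)
    qed
    moreover have "finite S"
      using m by (auto simp: S_def bounded_chains_def intro: rev_finite_subset[of "{e \<in> supp m. lev l e \<le> lev l e0}"])
    moreover have "S \<subseteq> edges" "e0 \<in> S"
      using edges e0 by (auto simp: S_def)
    ultimately have "inv c \<in> K"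
      using finite_invariant_imp_K[of "inv c" S e0] c(1) by blast
    then show False
      using c m_inv_closed[of "inv c"] by simp
  qed
  then have "supp m \<subseteq> {e \<in> supp m. lev l e \<le> T}"
    by blast
  then show ?thesis
    using m edges by (auto simp: fin_chains_def bounded_chains_def intro: finite_subset)
qed

end

section \<open>Widths of supports\<close>

context coset_module
begin

lemma level_uminus: "level l \<Longrightarrow> level (\<lambda>x. - l x)"
  by (simp add: level_def)

lemma lev_uminus: "lev (\<lambda>x. - l x) e = - lev l e"
  by (simp add: lev_def)

text \<open>At the lowest edge of \<open>w\<close> only \<open>c w\<close> contributes, and at the
  \<open>y\<close>-translate of its highest edge only \<open>y w\<close>. So the support of
  \<open>y w - c w\<close> is wider than that of \<open>w\<close> by at least \<open>l y\<close>.
  The factor \<open>c = 1\<close> is used for descent, \<open>c = 2\<close> for comparing two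
  factorizations.\<close>

lemma spread:
  assumes l: "level l" and w: "w \<in> fin_chains" and y: "y \<in> carrier G" "l y > 0" and c: "(c::int) \<noteq> 0"
    and g: "\<And>e. e \<in> edges \<Longrightarrow> g e = w (translate (inv y) e) - c * w e"
    and e: "e \<in> supp w"
  shows "\<exists>e1 \<in> supp g. lev l e1 \<le> lev l e" "\<exists>e2 \<in> supp g. lev l e + l y \<le> lev l e2"
proof -
  have fin: "finite (supp w)" "supp w \<noteq> {}" and edges: "supp w \<subseteq> edges"
    using w e by (auto simp: fin_chains_def)
  have lev_inv: "lev l (translate (inv y) e) = lev l e - l y" if "e \<in> edges" for e
    using lev_translate[OF l inv_closed[OF y(1)] that] level_inv[OF l y(1)] by simp
  obtain lo where lo: "lo \<in> supp w" "\<And>e'. e' \<in> supp w \<Longrightarrow> lev l lo \<le> lev l e'"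
    using ex_is_arg_min_if_finite[OF fin, of "lev l"] by (auto simp: is_arg_min_linorder)
  obtain hi where hi: "hi \<in> supp w" "\<And>e'. e' \<in> supp w \<Longrightarrow> lev l e' \<le> lev l hi"
    using ex_is_arg_min_if_finite[OF fin, of "\<lambda>e. - lev l e"] by (auto simp: is_arg_min_linorder)
  have lo_edge: "lo \<in> edges"
    using lo(1) edges by blast
  have "translate (inv y) lo \<notin> supp w"
  proof
    assume "translate (inv y) lo \<in> supp w"
    then show False
      using lo(2) lev_inv[OF lo_edge] y(2) by fastforce
  qed
  then have "lo \<in> supp g"
    using g[OF lo_edge] lo(1) c by (simp add: supp_def)
  then show "\<exists>e1 \<in> supp g. lev l e1 \<le> lev l e"
    using lo(2)[OF e] by blast
  have hi_edge: "hi \<in> edges"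
    using hi(1) edges by blast
  have lev_hi: "lev l (translate y hi) = l y + lev l hi"
    using lev_translate[OF l y(1) hi_edge] .
  have "translate y hi \<notin> supp w"
  proof
    assume "translate y hi \<in> supp w"
    then show False
      using hi(2) lev_hi y(2) by fastforce
  qed
  then have "translate y hi \<in> supp g"
    using g[of "translate y hi"] hi(1) hi_edge y(1) by (simp add: supp_def)
  moreover have "lev l e + l y \<le> lev l (translate y hi)"
    using hi(2)[OF e] lev_hi by simp
  ultimately show "\<exists>e2 \<in> supp g. lev l e + l y \<le> lev l e2"
    by blast
qed

lemma fin_chains_window:
  assumes "f \<in> fin_chains" obtains m n where "\<And>e. e \<in> supp f \<Longrightarrow> m \<le> lev l e \<and> lev l e < m + int n"
proof -
  have fin: "finite (lev l ` supp f)"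
    using assms by (simp add: fin_chains_def)
  define m where "m = Min (insert 0 (lev l ` supp f))"
  define M where "M = Max (insert 0 (lev l ` supp f))"
  have "m \<le> lev l e \<and> lev l e < m + int (nat (M - m + 1))" if "e \<in> supp f" for e
  proof -
    have "m \<le> lev l e" "lev l e \<le> M"
      using fin that by (auto simp: m_def M_def)
    then show ?thesis by simp
  qed
  then show ?thesis
    by (rule that)
qed

text \<open>Writing \<open>f = (c - 1) g\<close> shortens the support in the \<open>c\<close>-direction.\<close>

lemma divisible_imp_zero:
  assumes l: "level l" and c: "c \<in> carrier G" "l c = 1"
    and U: "U \<subseteq> fin_chains" "\<And>f. f \<in> U \<Longrightarrow> \<exists>g \<in> U. f = shift c g - g" and f: "f \<in> U"
  shows "f = 0"
proof -
  have *: "f = 0" if "f \<in> U" "\<forall>e \<in> supp f. m \<le> lev l e \<and> lev l e < m + int n" for f m n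
    using that
  proof (induction n arbitrary: f)
    case 0
    then have "supp f = {}"
      by force
    then show ?case
      using supp_empty_iff by blast
  next
    case (Suc n)
    obtain g where g: "g \<in> U" "f = shift c g - g"
      using U(2) Suc.prems(1) by blast
    have "m \<le> lev l e \<and> lev l e < m + int n" if e: "e \<in> supp g" for e
    proof -
      have *: "f e = g (translate (inv c) e) - 1 * g e" if "e \<in> edges" for e
        using that by (simp add: g(2) shift_apply)
      have "g \<in> fin_chains" "l c > 0" "(1::int) \<noteq> 0"
        using U(1) g(1) c(2) by auto
      note s = spread[OF l this(1) c(1) this(2,3) * e]
      then obtain e1 e2 where "e1 \<in> supp f" "lev l e1 \<le> lev l e" "e2 \<in> supp f" "lev l e + 1 \<le> lev l e2"
        using c(2) by auto
      then show ?thesis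
        using bspec[OF Suc.prems(2), of e1] bspec[OF Suc.prems(2), of e2] by simp
    qed
    then have "g = 0"
      using Suc.IH[OF g(1)] by blast
    then show ?case
      using g(2) by simp
  qed
  obtain m n where "\<And>e. e \<in> supp f \<Longrightarrow> m \<le> lev l e \<and> lev l e < m + int n"
    using fin_chains_window[of f l] f U(1) by blast
  then show ?thesis
    using *[OF f] by blast
qed

end

context torsion_free_coset_module
begin

text \<open>If \<open>x\<close> moves the support of \<open>f\<close> off itself, then \<open>(x - 2) f = (y - 2) w\<close> consists of
  two separated bands. Comparing levels forces \<open>y\<close> to move by the same amount as \<open>x\<close> up to sign,
  and the factor 2 rules out the negative sign.\<close>

lemma shift_minus_two_unique:
  assumes l1: "level l1" and l2: "level l2"
    and f: "f \<in> fin_chains" "f \<noteq> 0" and w: "w \<in> fin_chains"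
    and x: "x \<in> carrier G" "l1 x = Q" "l2 x = 0"
    and y: "y \<in> carrier G" "l1 y = Q * p" "l2 y = Q * q" "p \<noteq> 0 \<or> q \<noteq> 0"
    and Q: "Q > 0"
    and bound1: "\<And>e. e \<in> supp f \<Longrightarrow> m1 \<le> lev l1 e \<and> lev l1 e < m1 + Q"
    and bound2: "\<And>e. e \<in> supp f \<Longrightarrow> m2 \<le> lev l2 e \<and> lev l2 e < m2 + Q"
    and eq: "shift x f - (f + f) = shift y w - (w + w)"
  shows "w = f" "inv x \<otimes> y \<in> K"
proof -
  define g where "g = shift x f - (f + f)"
  have g1: "g e = f (translate (inv x) e) - 2 * f e" if "e \<in> edges" for e
    using that by (simp add: g_def shift_apply)
  have g2: "g e = w (translate (inv y) e) - 2 * w e" if "e \<in> edges" for e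
  proof -
    have "g e = (shift y w - (w + w)) e"
      by (simp only: g_def eq)
    then show ?thesis
      using that by (simp add: shift_apply)
  qed
  have f_edges: "supp f \<subseteq> edges" and w_edges: "supp w \<subseteq> edges"
    using f(1) w by (simp_all add: fin_chains_def)
  have lev_x: "lev l1 (translate (inv x) e) = lev l1 e - Q" "lev l2 (translate (inv x) e) = lev l2 e"
    and lev_y: "lev l1 (translate (inv y) e) = lev l1 e - Q * p"
    if "e \<in> edges" for e
    using that x y lev_translate[OF l1] lev_translate[OF l2] level_inv[OF l1] level_inv[OF l2] by simp_all
  have f0: "f e = 0" if "lev l1 e < m1 \<or> m1 + Q \<le> lev l1 e" for e
    using bound1[of e] that by (force simp: supp_def)
  \<comment> \<open>\<open>x\<close> moves by \<open>Q\<close> along \<open>l1\<close> and not at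
    all along \<open>l2\<close>, so the support of \<open>g\<close> may have width
    \<open>2 * Q\<close> along \<open>l1\<close> but only \<open>Q\<close> along
    \<open>l2\<close>.\<close>
  have g_bound: "m1 \<le> lev l1 e \<and> lev l1 e < m1 + 2 * Q \<and> m2 \<le> lev l2 e \<and> lev l2 e < m2 + Q"
    if "e \<in> supp g" for e
  proof -
    have e: "e \<in> edges"
      using that f_edges supp_shift_subset[of x f] supp_diff[of "shift x f" "f + f"] supp_add[of f f]
      by (auto simp: g_def)
    then have "e \<in> supp f \<or> translate (inv x) e \<in> supp f"
      using that g1[OF e] by (auto simp: supp_def)
    then show ?thesis
    proof
      assume "e \<in> supp f"
      then show ?thesis
        using bound1[of e] bound2[of e] Q by simp
    next
      assume "translate (inv x) e \<in> supp f"
      then show ?thesis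
        using bound1[of "translate (inv x) e"] bound2[of "translate (inv x) e"] lev_x[OF e] Q by simp
    qed
  qed
  have fin: "finite (supp f)" "supp f \<noteq> {}"
    using f supp_empty_iff by (auto simp: fin_chains_def)
  \<comment> \<open>Maximality of the absolute value at \<open>e0\<close> is what makes the factor 2
    count: no value of \<open>f\<close> can be a larger multiple of \<open>f e0\<close>.\<close>
  obtain e0 where e0: "e0 \<in> supp f" "\<And>e. e \<in> supp f \<Longrightarrow> \<bar>f e\<bar> \<le> \<bar>f e0\<bar>"
    using ex_is_arg_min_if_finite[OF fin, of "\<lambda>e. - \<bar>f e\<bar>"] by (auto simp: is_arg_min_linorder)
  have e0_max: "\<bar>f e\<bar> \<le> \<bar>f e0\<bar>" for e
    using e0(2)[of e] by (cases "f e = 0") (auto simp: supp_def)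
  have e0_nz: "f e0 \<noteq> 0" and e0_edge: "e0 \<in> edges"
    using e0(1) f_edges by (auto simp: supp_def)
  have "supp w \<noteq> {}"
  proof
    assume "supp w = {}"
    then have "w e = 0" for e
      by (cases e) (auto simp: supp_def)
    then have "g e0 = 0"
      using g2[OF e0_edge] by simp
    then show False
      using g1[OF e0_edge] e0_max[of "translate (inv x) e0"] e0_nz by simp
  qed
  then obtain ew where ew: "ew \<in> supp w"
    by blast
  have up: "(\<exists>e1 \<in> supp g. lev l e1 \<le> lev l e) \<and> (\<exists>e2 \<in> supp g. lev l e + l y \<le> lev l e2)"
    if "level l" "l y > 0" "e \<in> supp w" for l e
  proof -
    have "(2::int) \<noteq> 0"
      by simp
    from spread[OF that(1) w y(1) that(2) this _ that(3)] g2 show ?thesis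
      by blast
  qed
  have pos: "q \<ge> 1 \<Longrightarrow> Q * q \<ge> Q" "q \<le> -1 \<Longrightarrow> Q * q \<le> - Q" for q
    using Q mult_left_mono[of 1 q Q] mult_left_mono[of q "-1" Q] by simp_all
  \<comment> \<open>Otherwise \<open>y\<close> moves by at least \<open>Q\<close> along
    \<open>l2\<close>, and by \<open>spread\<close>, for \<open>l2\<close> or its negative, the
    support of \<open>g\<close> would be too wide.\<close>
  have "q = 0"
  proof (rule ccontr)
    assume "q \<noteq> 0"
    then consider "q \<ge> 1" | "q \<le> -1" by linarith
    then show False
    proof cases
      case 1
      then have "l2 y > 0"
        using pos(1)[of q] Q y(3) by simp
      then obtain e1 e2 where "e1 \<in> supp g" "lev l2 e1 \<le> lev l2 ew" "e2 \<in> supp g" "lev l2 ew + l2 y \<le> lev l2 e2"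
        using up[OF l2 _ ew] by blast
      then show False
        using g_bound[of e1] g_bound[of e2] pos(1)[OF 1] y(3) by linarith
    next
      case 2
      then have "- l2 y > 0"
        using pos(2)[of q] Q y(3) by simp
      then obtain e1 e2 where "e1 \<in> supp g" "- lev l2 e1 \<le> - lev l2 ew" "e2 \<in> supp g"
        "- lev l2 ew + - l2 y \<le> - lev l2 e2"
        using up[OF level_uminus[OF l2] _ ew] unfolding lev_uminus by blast
      then show False
        using g_bound[of e1] g_bound[of e2] pos(2)[OF 2] y(3) by linarith
    qed
  qed
  then have "p \<noteq> 0"
    using y(4) by simp
  have "p \<ge> 1"
  proof (rule ccontr)
    assume "\<not> p \<ge> 1"
    then have p: "p \<le> -1"
      using \<open>p \<noteq> 0\<close> by simp
    then have ly: "- l1 y > 0"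
      using pos(2)[of p] Q y(2) by simp
    have w_bound: "lev l1 e < m1 + 2 * Q \<and> m1 \<le> lev l1 e + Q * p" if "e \<in> supp w" for e
    proof -
      obtain e1 e2 where "e1 \<in> supp g" "- lev l1 e1 \<le> - lev l1 e" "e2 \<in> supp g"
        "- lev l1 e + - l1 y \<le> - lev l1 e2"
        using up[OF level_uminus[OF l1] _ \<open>e \<in> supp w\<close>] ly unfolding lev_uminus by blast
      then show ?thesis
        using g_bound[of e1] g_bound[of e2] y(2) by linarith
    qed
    have "p = -1"
    proof (rule ccontr)
      assume "p \<noteq> -1"
      then have "Q * p \<le> Q * (-2)"
        using p Q by (intro mult_left_mono) auto
      then show False
        using w_bound[OF ew] by simp
    qed
    then have w0: "w e = 0" if "lev l1 e < m1 + Q \<or> m1 + 2 * Q \<le> lev l1 e" for e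
      using w_bound[of e] that by (force simp: supp_def)
    \<comment> \<open>For \<open>p = -1\<close> the support of \<open>w\<close> lies in the upper
      band. On the lower band the equation then reads \<open>- 2 f = y w\<close>, on the upper band
      \<open>x f = - 2 w\<close>; following \<open>e0\<close> through both makes
      \<open>4 * f e0\<close> a value of \<open>f\<close>, against maximality.\<close>
    define e1 where "e1 = translate (inv y) e0"
    have e1: "e1 \<in> edges" "lev l1 e1 = lev l1 e0 + Q"
      using e0_edge y(1) lev_y[OF e0_edge] \<open>p = -1\<close> by (simp_all add: e1_def)
    have "w e1 = - 2 * f e0"
    proof -
      have "f (translate (inv x) e0) = 0"
        using f0 lev_x(1)[OF e0_edge] bound1[OF e0(1)] by simp
      moreover have "w e0 = 0"
        using w0 bound1[OF e0(1)] by simp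
      ultimately show ?thesis
        using g1[OF e0_edge] g2[OF e0_edge] by (simp add: e1_def)
    qed
    moreover have "f (translate (inv x) e1) = - 2 * w e1"
    proof -
      have "f e1 = 0"
        using f0 e1(2) bound1[OF e0(1)] by simp
      moreover have "w (translate (inv y) e1) = 0"
        using w0 lev_y[OF e1(1)] e1(2) bound1[OF e0(1)] \<open>p = -1\<close> by simp
      ultimately show ?thesis
        using g1[OF e1(1)] g2[OF e1(1)] by simp
    qed
    ultimately show False
      using e0_max[of "translate (inv x) e1"] e0_nz by simp
  qed
  then have "l1 y > 0"
    using pos(1)[of p] Q y(2) by simp
  have w_bound: "m1 \<le> lev l1 e \<and> lev l1 e + Q * p < m1 + 2 * Q" if "e \<in> supp w" for e
  proof -
    obtain e1 e2 where "e1 \<in> supp g" "lev l1 e1 \<le> lev l1 e" "e2 \<in> supp g" "lev l1 e + l1 y \<le> lev l1 e2"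
      using up[OF l1 _ \<open>e \<in> supp w\<close>] \<open>l1 y > 0\<close> by blast
    then show ?thesis
      using g_bound[of e1] g_bound[of e2] y(2) by linarith
  qed
  have "p = 1"
  proof (rule ccontr)
    assume "p \<noteq> 1"
    then have "Q * 2 \<le> Q * p"
      using \<open>p \<ge> 1\<close> Q by (intro mult_left_mono) auto
    then show False
      using w_bound[OF ew] by simp
  qed
  then have w0: "w e = 0" if "lev l1 e < m1 \<or> m1 + Q \<le> lev l1 e" for e
    using w_bound[of e] that by (force simp: supp_def)
  \<comment> \<open>With \<open>p = 1\<close> both supports lie in the lower band, where the shifted
    terms vanish and the equation reads \<open>- 2 f = - 2 w\<close>.\<close>
  show wf: "w = f"
  proof
    fix e
    consider "e \<notin> edges" | "e \<in> edges" "lev l1 e < m1 + Q" | "m1 + Q \<le> lev l1 e"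
      by linarith
    then show "w e = f e"
    proof cases
      case 1
      then have "e \<notin> supp f" "e \<notin> supp w"
        using f_edges w_edges by blast+
      then show ?thesis
        by (simp add: supp_def)
    next
      case 2
      then have "f (translate (inv x) e) = 0" "w (translate (inv y) e) = 0"
        using f0 w0 lev_x(1) lev_y \<open>p = 1\<close> by simp_all
      then show ?thesis
        using g1[OF 2(1)] g2[OF 2(1)] by simp
    next
      case 3
      then show ?thesis
        using f0 w0 by simp
    qed
  qed
  have "shift x f = shift y f"
    using eq[unfolded wf] by (metis diff_add_cancel)
  then have "shift (inv x) (shift y f) = shift (inv x) (shift x f)"
    by simp
  then have "shift (inv x \<otimes> y) f = f"
    using x(1) y(1) f_edges by (simp add: shift_mult shift_one)
  then show "inv x \<otimes> y \<in> K"
    using shift_fixed_imp_K[OF _ f] x(1) y(1) by simp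
qed

end

section \<open>Fox calculus\<close>

context comm_group
begin

text \<open>Extends \<open>\<kappa>\<close> linearly from edges to finite chains; this recovers a
  class in an abelian quotient from a Fox derivative.\<close>

definition chain_prod :: "('e \<Rightarrow> 'a) \<Rightarrow> ('e \<Rightarrow> int) \<Rightarrow> 'a" where
  "chain_prod \<kappa> f = finprod G (\<lambda>e. \<kappa> e [^] f e) {e. f e \<noteq> 0}"

lemma chain_prod_superset:
  assumes "\<kappa> \<in> A \<rightarrow> carrier G" "finite J" "{e. f e \<noteq> 0} \<subseteq> J" "J \<subseteq> A"
  shows "chain_prod \<kappa> f = finprod G (\<lambda>e. \<kappa> e [^] f e) J"
  unfolding chain_prod_def
  by (rule finprod_mono_neutral_cong_left) (use assms in \<open>auto simp: Pi_iff int_pow_0\<close>)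

lemma chain_prod_add:
  assumes \<kappa>: "\<kappa> \<in> A \<rightarrow> carrier G" and f: "finite {e. f e \<noteq> 0}" "{e. f e \<noteq> 0} \<subseteq> A"
    and h: "finite {e. h e \<noteq> 0}" "{e. h e \<noteq> 0} \<subseteq> A"
  shows "chain_prod \<kappa> (f + h) = chain_prod \<kappa> f \<otimes> chain_prod \<kappa> h"
proof -
  define J where "J = {e. f e \<noteq> 0} \<union> {e. h e \<noteq> 0}"
  have J: "finite J" "J \<subseteq> A"
    using f h by (auto simp: J_def)
  have pow: "\<And>e n. e \<in> J \<Longrightarrow> \<kappa> e [^] (n::int) \<in> carrier G" and car: "\<And>e. e \<in> J \<Longrightarrow> \<kappa> e \<in> carrier G"
    using \<kappa> J by auto
  have "chain_prod \<kappa> (f + h) = finprod G (\<lambda>e. \<kappa> e [^] (f + h) e) J"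
    by (rule chain_prod_superset[OF \<kappa> J(1) _ J(2)]) (auto simp: J_def)
  also have "\<dots> = finprod G (\<lambda>e. \<kappa> e [^] f e \<otimes> \<kappa> e [^] h e) J"
    by (rule finprod_cong') (auto simp: int_pow_mult pow car)
  also have "\<dots> = finprod G (\<lambda>e. \<kappa> e [^] f e) J \<otimes> finprod G (\<lambda>e. \<kappa> e [^] h e) J"
    by (rule finprod_multf) (auto simp: pow)
  also have "finprod G (\<lambda>e. \<kappa> e [^] f e) J = chain_prod \<kappa> f"
    by (rule chain_prod_superset[OF \<kappa> J(1) _ J(2), symmetric]) (auto simp: J_def)
  also have "finprod G (\<lambda>e. \<kappa> e [^] h e) J = chain_prod \<kappa> h"
    by (rule chain_prod_superset[OF \<kappa> J(1) _ J(2), symmetric]) (auto simp: J_def)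
  finally show ?thesis .
qed

end

definition unit_chain :: "'e \<Rightarrow> 'e \<Rightarrow> int" where
  "unit_chain e0 = (\<lambda>e. if e = e0 then 1 else 0)"

lemma (in comm_group) chain_prod_unit:
  assumes "\<kappa> e \<in> carrier G"
  shows "chain_prod \<kappa> (unit_chain e) = \<kappa> e" "chain_prod \<kappa> (- unit_chain e) = inv (\<kappa> e)"
proof -
  have *: "{e'. unit_chain e e' \<noteq> 0} = {e}" "{e'. (- unit_chain e) e' \<noteq> 0} = {e}"
    by (auto simp: unit_chain_def)
  show "chain_prod \<kappa> (unit_chain e) = \<kappa> e" "chain_prod \<kappa> (- unit_chain e) = inv (\<kappa> e)"
    unfolding chain_prod_def * using assms by (simp_all add: unit_chain_def int_pow_neg int_pow_1)
qed

definition expo :: "nat \<Rightarrow> letter list \<Rightarrow> int" where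
  "expo i w = (\<Sum>x\<leftarrow>w. if fst x = i then (if snd x then -1 else 1) else 0)"

lemma expo_simps [simp]:
  "expo i [] = 0"
  "expo i (x # w) = (if fst x = i then (if snd x then -1 else 1) else 0) + expo i w"
  by (simp_all add: expo_def)

lemma expo_mult:
  assumes "u \<in> carrier (free_group r)" "v \<in> carrier (free_group r)"
  shows "expo i (u \<otimes>\<^bsub>free_group r\<^esub> v) = expo i u + expo i v"
proof -
  have *: "\<forall>x \<in> set (u @ v). fst x < r"
    using assms by (auto simp: carrier_free_group)
  have "expo i (reduce (u @ v)) = expo i (u @ v)"
    by (rule reduce_invariant(1)[where \<phi> = "\<lambda>x n. (if fst x = i then (if snd x then -1 else 1) else 0) + n", OF _ _ *])
      (auto simp: inverse_letters_def)
  then show ?thesis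
    by (simp add: mult_free_group expo_def)
qed

section \<open>Fox derivatives\<close>

locale fox_calculus = coset_module K "free_group r" for K r
begin

abbreviation F where "F \<equiv> free_group r"

text \<open>The value at an inverse letter is forced by the cocycle rule for
  \<open>x^-1 x = 1\<close>.\<close>

definition fox_letter :: "letter \<Rightarrow> letter list set \<times> nat \<Rightarrow> int" where
  "fox_letter x = (if snd x then - shift (inv\<^bsub>F\<^esub> free_gen (fst x)) (unit_chain (K, fst x)) else unit_chain (K, fst x))"

text \<open>The Fox derivatives of \<open>w\<close>, with coefficients in the group ring of the quotient by \<open>K\<close>:
  the value at the edge \<open>(x <# K, i)\<close> counts how often the path \<open>w\<close> in the Cayley graph runs
  through it.\<close>

primrec fox :: "letter list \<Rightarrow> letter list set \<times> nat \<Rightarrow> int" where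
  "fox [] = 0"
| "fox (x # w) = fox_letter x + shift (letter_val F free_gen x) (fox w)"

lemma unit_chain_fin [simp]: "e \<in> edges \<Longrightarrow> unit_chain e \<in> fin_chains"
proof -
  have "supp (unit_chain e) = {e}"
    by (auto simp: supp_def unit_chain_def)
  then show "e \<in> edges \<Longrightarrow> unit_chain e \<in> fin_chains"
    by (simp add: fin_chains_def)
qed

lemma shift_unit_chain:
  assumes "g \<in> carrier F" "e \<in> edges" shows "shift g (unit_chain e) = unit_chain (translate g e)"
proof
  fix e'
  show "shift g (unit_chain e) e' = unit_chain (translate g e) e'"
  proof (cases "e' \<in> edges")
    case True
    then show ?thesis
      using assms by (auto simp: shift_apply unit_chain_def)
  next
    case False
    then have "e' \<noteq> translate g e"
      using assms by auto
    then show ?thesis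
      using False by (simp add: shift_def unit_chain_def)
  qed
qed

lemma gen_carrier: "fst x < r \<Longrightarrow> letter_val F free_gen x \<in> carrier F"
  by (rule letter_val_closed) (simp add: free_gen_carrier)

lemma fox_letter_fin: "fst x < r \<Longrightarrow> fox_letter x \<in> fin_chains"
  by (simp add: fox_letter_def free_gen_carrier)

lemma fox_fin: "\<forall>x \<in> set w. fst x < r \<Longrightarrow> fox w \<in> fin_chains"
  by (induction w) (simp_all add: fox_letter_fin gen_carrier)

lemma fox_fin_carrier: "w \<in> carrier F \<Longrightarrow> fox w \<in> fin_chains"
  by (rule fox_fin) (simp add: carrier_free_group)

lemma fox_reduce:
  assumes "\<forall>x \<in> set w. fst x < r" shows "fox (reduce w) = fox w"
proof (rule reduce_invariant(1)[where \<phi> = "\<lambda>x f. fox_letter x + shift (letter_val F free_gen x) f", OF _ _ assms])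
  fix x y and w :: "letter list"
  assume *: "inverse_letters x y" "fst x < r" "\<forall>z \<in> set w. fst z < r"
  let ?g = "letter_val F free_gen"
  have car: "?g x \<in> carrier F" "?g y \<in> carrier F" and inv: "?g x \<otimes>\<^bsub>F\<^esub> ?g y = \<one>\<^bsub>F\<^esub>"
    using * free_gen_carrier[of "fst x" r] by (auto simp: letter_val_def inverse_letters_def)
  have edges: "supp (unit_chain (K, i)) \<subseteq> edges" for i
    using fin_chains_edges unit_chain_fin edges_base by blast
  have "fox_letter x + shift (?g x) (fox_letter y) = 0"
    using * free_gen_carrier[of "fst x" r] edges
    by (auto simp: fox_letter_def letter_val_def inverse_letters_def shift_uminus shift_mult shift_one)
  moreover have "shift (?g x) (shift (?g y) (fox w)) = fox w"
    using car inv fin_chains_edges[OF fox_fin[OF *(3)]] by (simp add: shift_mult shift_one)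
  ultimately show "fox_letter x + shift (?g x) (fox_letter y + shift (?g y) (fox w)) = fox w"
    by (simp only: shift_add add_0 flip: add.assoc)
qed (rule fox.simps)

lemma fox_append:
  assumes "u \<in> carrier F" "\<forall>x \<in> set v. fst x < r" shows "fox (u @ v) = fox u + shift u (fox v)"
  using assms(1)
proof (induction u)
  case Nil
  then show ?case
    using fin_chains_edges[OF fox_fin[OF assms(2)]] shift_one by (simp add: one_free_group)
next
  case (Cons x u)
  note c = Cons_free_group[OF Cons.prems]
  have "shift (x # u) (fox v) = shift (letter_val F free_gen x) (shift u (fox v))"
    using c by (simp add: shift_mult gen_carrier)
  then show ?case
    using Cons.IH[OF c(1)] by (simp only: append_Cons fox.simps shift_add add.assoc)
qed

lemma fox_mult:
  assumes "u \<in> carrier F" "v \<in> carrier F" shows "fox (u \<otimes>\<^bsub>F\<^esub> v) = fox u + shift u (fox v)"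
proof -
  have "\<forall>x \<in> set (u @ v). fst x < r" "\<forall>x \<in> set v. fst x < r"
    using assms by (auto simp: carrier_free_group)
  then show ?thesis
    using fox_append[OF assms(1)] by (simp add: mult_free_group fox_reduce)
qed

lemma cocycle_fox: "H \<subseteq> carrier F \<Longrightarrow> cocycle H fox"
  using fin_chains_edges[OF fox_fin_carrier] fox_mult by (auto simp: cocycle_def subset_iff)

text \<open>The augmentation of the group ring, applied to the \<open>i\<close>-th Fox derivative.
  It kills \<open>(b - 1) m\<close> for finite \<open>m\<close>, while \<open>aug_fox\<close> shows
  that on Fox chains it is the exponent sum.\<close>

definition aug :: "nat \<Rightarrow> (letter list set \<times> nat \<Rightarrow> int) \<Rightarrow> int" where
  "aug i f = (\<Sum>e \<in> {e \<in> supp f. snd e = i}. f e)"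

lemma aug_superset:
  assumes "finite J" "supp f \<subseteq> J" shows "aug i f = (\<Sum>e \<in> {e \<in> J. snd e = i}. f e)"
proof -
  have "finite {e \<in> J. snd e = i}" "{e \<in> supp f. snd e = i} \<subseteq> {e \<in> J. snd e = i}"
    using assms by auto
  moreover have "\<forall>e \<in> {e \<in> J. snd e = i} - {e \<in> supp f. snd e = i}. f e = 0"
    by (auto simp: supp_def)
  ultimately show ?thesis
    unfolding aug_def by (rule sum.mono_neutral_left)
qed

lemma aug_add:
  assumes "f \<in> fin_chains" "h \<in> fin_chains" shows "aug i (f + h) = aug i f + aug i h"
proof -
  let ?J = "supp f \<union> supp h"
  have J: "finite ?J" "supp (f + h) \<subseteq> ?J"
    using assms supp_add by (auto simp: fin_chains_def)
  show ?thesis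
    using aug_superset[OF J(1), of f i] aug_superset[OF J(1), of h i] aug_superset[OF J, of i]
    by (simp add: sum.distrib)
qed

lemma aug_uminus: "aug i (- f) = - aug i f"
  by (simp add: aug_def sum_negf)

lemma aug_shift:
  assumes "g \<in> carrier F" "f \<in> fin_chains" shows "aug i (shift g f) = aug i f"
proof -
  have edges: "supp f \<subseteq> edges"
    using assms(2) by (rule fin_chains_edges)
  have "{e \<in> supp (shift g f). snd e = i} = translate g ` {e \<in> supp f. snd e = i}"
    using supp_shift[OF assms(1) edges] by (auto simp: translate_def)
  moreover have "inj_on (translate g) {e \<in> supp f. snd e = i}"
    using edges assms(1) by (intro inj_on_inverseI[of _ "translate (inv\<^bsub>F\<^esub> g)"]) auto
  moreover have "shift g f (translate g e) = f e" if "e \<in> supp f" for e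
    using that edges assms(1) by (subst shift_apply) auto
  ultimately show ?thesis
    by (simp add: aug_def sum.reindex)
qed

lemma aug_unit_chain: "aug i (unit_chain (v, j)) = (if i = j then 1 else 0)"
proof -
  have "{e \<in> supp (unit_chain (v, j)). snd e = i} = (if i = j then {(v, j)} else {})"
    by (auto simp: supp_def unit_chain_def)
  then show ?thesis
    by (simp add: aug_def unit_chain_def)
qed

lemma aug_fox:
  assumes "\<forall>x \<in> set w. fst x < r" shows "aug i (fox w) = expo i w"
  using assms
proof (induction w)
  case Nil
  then show ?case by (simp add: aug_def)
next
  case (Cons x w)
  have "aug i (fox_letter x) = (if fst x = i then (if snd x then -1 else 1) else 0)"
    using Cons.prems by (simp add: fox_letter_def aug_uminus aug_shift aug_unit_chain free_gen_carrier)
  moreover have "aug i (fox (x # w)) = aug i (fox_letter x) + aug i (fox w)"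
    unfolding fox.simps using Cons.prems
    by (simp add: aug_add aug_shift fox_letter_fin fox_fin gen_carrier)
  ultimately show ?case
    using Cons by (simp del: fox.simps)
qed

text \<open>On \<open>K\<close> the cocycle rule loses its shift, so \<open>fox\<close> is a
  homomorphism into an abelian group there and kills commutators.\<close>

lemma fox_derived:
  assumes "w \<in> derived F K" shows "w \<in> K" "fox w = 0"
proof -
  have sub: "subgroup K F"
    using is_subgroup .
  show *: "w \<in> K"
    using assms derived_incl[OF subset_refl sub] by blast
  have add: "fox (u \<otimes>\<^bsub>F\<^esub> v) = fox u + fox v" if "u \<in> K" "v \<in> K" for u v
    using that fox_mult[of u v] shift_K fin_chains_edges[OF fox_fin_carrier] by (simp add: mem_carrier)
  have "subgroup {w \<in> K. fox w = 0} F"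
  proof (unfold_locales, goal_cases)
    case 3
    show ?case
      using subgroup.one_closed[OF is_subgroup] by (simp add: one_free_group)
  next
    case (4 x)
    then have "fox (x \<otimes>\<^bsub>F\<^esub> inv\<^bsub>F\<^esub> x) = fox x + fox (inv\<^bsub>F\<^esub> x)"
      by (intro add) auto
    then show ?case
      using 4 by (simp add: mem_carrier one_free_group)
  qed (auto simp: add mem_carrier)
  moreover have "derived_set F K \<subseteq> {w \<in> K. fox w = 0}"
  proof clarify
    fix a b
    assume ab: "a \<in> K" "b \<in> K"
    have inv: "fox (inv\<^bsub>F\<^esub> c) = - fox c" if "c \<in> K" for c
      using add[OF that m_inv_closed[OF that]] that by (simp add: mem_carrier one_free_group eq_neg_iff_add_eq_0 add.commute)
    show "a \<otimes>\<^bsub>F\<^esub> b \<otimes>\<^bsub>F\<^esub> inv\<^bsub>F\<^esub> a \<otimes>\<^bsub>F\<^esub> inv\<^bsub>F\<^esub> b \<in> K \<and> fox (a \<otimes>\<^bsub>F\<^esub> b \<otimes>\<^bsub>F\<^esub> inv\<^bsub>F\<^esub> a \<otimes>\<^bsub>F\<^esub> inv\<^bsub>F\<^esub> b) = 0"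
      using ab by (simp add: add inv)
  qed
  ultimately have "derived F K \<subseteq> {w \<in> K. fox w = 0}"
    unfolding derived_def using generate_subgroup_incl by blast
  then show "fox w = 0"
    using assms by blast
qed

section \<open>Loops through a transversal and the kernel of the Fox derivatives\<close>

definition rep :: "letter list set \<Rightarrow> letter list" where
  "rep v = (SOME x. x \<in> v)"

lemma rep_coset:
  assumes "x \<in> carrier F" obtains k where "k \<in> K" "rep (x <#\<^bsub>F\<^esub> K) = x \<otimes>\<^bsub>F\<^esub> k"
proof -
  have "x \<in> x <#\<^bsub>F\<^esub> K"
    using assms one_closed by (auto simp: l_coset_def intro!: bexI[of _ "\<one>\<^bsub>F\<^esub>"])
  then have "rep (x <#\<^bsub>F\<^esub> K) \<in> x <#\<^bsub>F\<^esub> K"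
    unfolding rep_def by (rule someI)
  then show ?thesis
    using that by (auto simp: l_coset_def)
qed

lemma rep_carrier [simp]: "x \<in> carrier F \<Longrightarrow> rep (x <#\<^bsub>F\<^esub> K) \<in> carrier F"
  by (metis rep_coset mem_carrier m_closed)

text \<open>The path that leaves \<open>y <# K\<close> along \<open>w\<close>, closed up through the
  transversal \<open>rep\<close>; when \<open>w\<close> is a generator these are Schreier generators
  of \<open>K\<close>.\<close>

definition path_loop :: "letter list \<Rightarrow> letter list \<Rightarrow> letter list" where
  "path_loop y w = rep (y <#\<^bsub>F\<^esub> K) \<otimes>\<^bsub>F\<^esub> w \<otimes>\<^bsub>F\<^esub> inv\<^bsub>F\<^esub> rep ((y \<otimes>\<^bsub>F\<^esub> w) <#\<^bsub>F\<^esub> K)"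

lemma path_loop_K:
  assumes "y \<in> carrier F" "w \<in> carrier F" shows "path_loop y w \<in> K"
proof -
  obtain k1 where k1: "k1 \<in> K" "rep (y <#\<^bsub>F\<^esub> K) = y \<otimes>\<^bsub>F\<^esub> k1"
    using assms by (elim rep_coset)
  obtain k2 where k2: "k2 \<in> K" "rep ((y \<otimes>\<^bsub>F\<^esub> w) <#\<^bsub>F\<^esub> K) = y \<otimes>\<^bsub>F\<^esub> w \<otimes>\<^bsub>F\<^esub> k2"
    using rep_coset[OF group.is_monoid[OF group_free_group, THEN monoid.m_closed, OF assms]] by blast
  note car = assms k1(1)[THEN mem_carrier] k2(1)[THEN mem_carrier]
  have "path_loop y w = y \<otimes>\<^bsub>F\<^esub> k1 \<otimes>\<^bsub>F\<^esub> inv\<^bsub>F\<^esub> y \<otimes>\<^bsub>F\<^esub> ((y \<otimes>\<^bsub>F\<^esub> w) \<otimes>\<^bsub>F\<^esub> inv\<^bsub>F\<^esub> k2 \<otimes>\<^bsub>F\<^esub> inv\<^bsub>F\<^esub> (y \<otimes>\<^bsub>F\<^esub> w))"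
  proof -
    have "inv\<^bsub>F\<^esub> y \<otimes>\<^bsub>F\<^esub> (y \<otimes>\<^bsub>F\<^esub> t) = t" if "t \<in> carrier F" for t
      using assms(1) that by (simp flip: m_assoc)
    then show ?thesis
      using car by (simp add: path_loop_def k1 k2 inv_mult_group m_assoc)
  qed
  moreover have "y \<otimes>\<^bsub>F\<^esub> k1 \<otimes>\<^bsub>F\<^esub> inv\<^bsub>F\<^esub> y \<in> K"
    using inv_op_closed2[OF assms(1) k1(1)] .
  moreover have "(y \<otimes>\<^bsub>F\<^esub> w) \<otimes>\<^bsub>F\<^esub> inv\<^bsub>F\<^esub> k2 \<otimes>\<^bsub>F\<^esub> inv\<^bsub>F\<^esub> (y \<otimes>\<^bsub>F\<^esub> w) \<in> K"
    using inv_op_closed2[OF m_closed[OF assms] m_inv_closed[OF k2(1)]] .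
  ultimately show ?thesis
    by simp
qed

lemma path_loop_mult:
  assumes "y \<in> carrier F" "u \<in> carrier F" "v \<in> carrier F"
  shows "path_loop y (u \<otimes>\<^bsub>F\<^esub> v) = path_loop y u \<otimes>\<^bsub>F\<^esub> path_loop (y \<otimes>\<^bsub>F\<^esub> u) v"
proof -
  define s where "s = rep ((y \<otimes>\<^bsub>F\<^esub> u) <#\<^bsub>F\<^esub> K)"
  have s: "s \<in> carrier F"
    using assms by (simp add: s_def)
  have "inv\<^bsub>F\<^esub> s \<otimes>\<^bsub>F\<^esub> (s \<otimes>\<^bsub>F\<^esub> t) = t" if "t \<in> carrier F" for t
    using s that by (simp flip: m_assoc)
  then show ?thesis
    using assms s by (simp add: path_loop_def m_assoc flip: s_def)
qed

lemma path_loop_coset: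
  "x <#\<^bsub>F\<^esub> K = y <#\<^bsub>F\<^esub> K \<Longrightarrow> x \<in> carrier F \<Longrightarrow> y \<in> carrier F \<Longrightarrow> w \<in> carrier F \<Longrightarrow>
    path_loop x w = path_loop y w"
proof -
  assume *: "x <#\<^bsub>F\<^esub> K = y <#\<^bsub>F\<^esub> K" and car: "x \<in> carrier F" "y \<in> carrier F" "w \<in> carrier F"
  have "inv\<^bsub>F\<^esub> w \<otimes>\<^bsub>F\<^esub> (inv\<^bsub>F\<^esub> x \<otimes>\<^bsub>F\<^esub> y) \<otimes>\<^bsub>F\<^esub> w \<in> K"
    using * car l_coset_eq_iff inv_op_closed1 by simp
  then have "(x \<otimes>\<^bsub>F\<^esub> w) <#\<^bsub>F\<^esub> K = (y \<otimes>\<^bsub>F\<^esub> w) <#\<^bsub>F\<^esub> K"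
    using car l_coset_eq_iff[of "x \<otimes>\<^bsub>F\<^esub> w" "y \<otimes>\<^bsub>F\<^esub> w"] by (simp add: inv_mult_group m_assoc)
  then show ?thesis
    using * by (simp add: path_loop_def)
qed

text \<open>Modulo \<open>[K, K]\<close> a closed path is the product of the loops of its edges (via a transversal),
  and by commutativity this product only depends on the net flow through each edge.\<close>

lemma fox_eq_zero_imp_derived:
  assumes w: "w \<in> K" "fox w = 0" shows "w \<in> derived F K"
proof -
  define D where "D = derived F K"
  define Q where "Q = F \<lparr>carrier := K\<rparr> Mod D"
  interpret Q: comm_group Q
    unfolding Q_def D_def by (rule derived_quot_of_subgroup_is_comm_group[OF is_subgroup])
  have D_normal: "D \<lhd> F \<lparr>carrier := K\<rparr>"
    unfolding D_def by (rule derived_subgroup_is_normal[OF is_subgroup])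
  interpret FK: group "F \<lparr>carrier := K\<rparr>"
    by (rule subgroup_imp_group[OF is_subgroup])
  define q where "q k = D #>\<^bsub>F \<lparr>carrier := K\<rparr>\<^esub> k" for k
  have q_hom: "q \<in> hom (F \<lparr>carrier := K\<rparr>) Q"
    unfolding q_def[abs_def] Q_def by (rule normal.r_coset_hom_Mod[OF D_normal])
  have q_car: "q k \<in> carrier Q" if "k \<in> K" for k
    using q_hom that by (auto simp: hom_def)
  have q_mult: "q (u \<otimes>\<^bsub>F\<^esub> v) = q u \<otimes>\<^bsub>Q\<^esub> q v" if "u \<in> K" "v \<in> K" for u v
    using q_hom that by (auto simp: hom_def)
  interpret qh: group_hom "F \<lparr>carrier := K\<rparr>" Q q
    by unfold_locales (rule q_hom)
  \<comment> \<open>The class in \<open>K / D\<close> of the loop that belongs to the edge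
    \<open>e\<close>. It goes through \<open>rep (fst e)\<close> because an edge only knows its
    coset.\<close>
  define \<kappa> where "\<kappa> e = q (path_loop (rep (fst e)) (free_gen (snd e)))" for e
  define A where "A = {e \<in> edges. snd e < r}"
  have rep_rep: "rep (y <#\<^bsub>F\<^esub> K) <#\<^bsub>F\<^esub> K = y <#\<^bsub>F\<^esub> K" if y: "y \<in> carrier F" for y
  proof -
    obtain k where k: "k \<in> K" "rep (y <#\<^bsub>F\<^esub> K) = y \<otimes>\<^bsub>F\<^esub> k"
      using y by (elim rep_coset)
    have "inv\<^bsub>F\<^esub> y \<otimes>\<^bsub>F\<^esub> (y \<otimes>\<^bsub>F\<^esub> k) = k"
      using y k by (simp add: mem_carrier flip: m_assoc)
    then show ?thesis
      using k y l_coset_eq_iff[of y "y \<otimes>\<^bsub>F\<^esub> k"] by (simp add: mem_carrier)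
  qed
  have \<kappa>_coset: "\<kappa> (y <#\<^bsub>F\<^esub> K, i) = q (path_loop y (free_gen i))" if "y \<in> carrier F" "i < r" for y i
    using path_loop_coset[OF rep_rep[OF that(1)] _ that(1) free_gen_carrier[OF that(2)]] that(1)
    by (simp add: \<kappa>_def)
  have \<kappa>: "\<kappa> \<in> A \<rightarrow> carrier Q"
    using q_car path_loop_K \<kappa>_coset by (auto simp: A_def elim!: edgesE simp: free_gen_carrier)
  have shift_A: "supp (shift g f) \<subseteq> A" if "supp f \<subseteq> A" "g \<in> carrier F" for g f
  proof -
    have "supp f \<subseteq> edges"
      using that(1) by (auto simp: A_def)
    then have *: "supp (shift g f) = translate g ` supp f"
      using supp_shift that(2) by blast
    show ?thesis
      unfolding *
    proof (rule image_subsetI)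
      fix e
      assume "e \<in> supp f"
      then have "e \<in> edges" "snd e < r"
        using that(1) by (auto simp: A_def)
      moreover have "snd (translate g e) = snd e"
        by (simp add: translate_def)
      ultimately show "translate g e \<in> A"
        using that(2) by (simp add: A_def)
    qed
  qed
  have fox_A: "supp (shift y (fox w)) \<subseteq> A" if "y \<in> carrier F" "\<forall>x \<in> set w. fst x < r" for y w
  proof -
    have "supp (fox w) \<subseteq> A" if "\<forall>x \<in> set w. fst x < r" for w
      using that
    proof (induction w)
      case (Cons x w)
      have *: "supp (unit_chain (K, fst x)) \<subseteq> A"
        using Cons.prems by (auto simp: A_def supp_def unit_chain_def split: if_splits)
      have "supp (fox_letter x) \<subseteq> A"
        using shift_A[OF *, of "inv\<^bsub>F\<^esub> free_gen (fst x)"] * free_gen_carrier[of "fst x" r] Cons.prems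
        by (simp add: fox_letter_def)
      moreover have "supp (shift (letter_val F free_gen x) (fox w)) \<subseteq> A"
        using Cons by (intro shift_A gen_carrier) simp_all
      ultimately show ?case
        using supp_add[of "fox_letter x" "shift (letter_val F free_gen x) (fox w)"]
        unfolding fox.simps by blast
    qed simp
    then show ?thesis
      using that by (intro shift_A)
  qed
  have prod_zero: "Q.chain_prod \<kappa> 0 = \<one>\<^bsub>Q\<^esub>"
    by (simp add: Q.chain_prod_def)
  \<comment> \<open>Stated for paths from any vertex, closed or not, so that letters can be split
    off one at a time.\<close>
  have main: "q (path_loop y w) = Q.chain_prod \<kappa> (shift y (fox w))" if "y \<in> carrier F" "w \<in> carrier F" for y w
    using that
  proof (induction w arbitrary: y)
    case Nil
    have loop: "path_loop y [] = \<one>\<^bsub>F\<^esub>"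
      using Nil by (simp add: path_loop_def flip: one_free_group[of r])
    show ?case
      unfolding fox.simps shift_zero loop prod_zero using qh.hom_one by simp
  next
    case (Cons x w)
    define g where "g = letter_val F free_gen x"
    note c = Cons_free_group[OF Cons.prems(2), folded g_def]
    have g: "g \<in> carrier F"
      using gen_carrier[OF c(2)] by (simp add: g_def)
    have step: "q (path_loop y g) = Q.chain_prod \<kappa> (shift y (fox_letter x))"
    proof (cases "snd x")
      case False
      have "shift y (fox_letter x) = unit_chain (y <#\<^bsub>F\<^esub> K, fst x)"
        using False Cons.prems(1) translate_coset[of y "\<one>\<^bsub>F\<^esub>" "fst x"]
        by (simp add: fox_letter_def shift_unit_chain l_coset_one_K)
      then show ?thesis
        using False Cons.prems(1) c(2) Q.chain_prod_unit(1)[of \<kappa> "(y <#\<^bsub>F\<^esub> K, fst x)"]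
          \<kappa>_coset[of y "fst x"] q_car path_loop_K
        by (simp add: g_def letter_val_def free_gen_carrier)
    next
      case True
      define t where "t = free_gen (fst x)"
      have t: "t \<in> carrier F" "g = inv\<^bsub>F\<^esub> t"
        using free_gen_carrier[OF c(2)] True by (simp_all add: t_def g_def letter_val_def)
      \<comment> \<open>An inverse letter runs backwards through the edge leaving
        \<open>z = y t^-1\<close>. Its loop is the inverse of the loop of that edge, because the
        loop of \<open>t t^-1\<close> is trivial.\<close>
      define z where "z = y \<otimes>\<^bsub>F\<^esub> inv\<^bsub>F\<^esub> t"
      have z: "z \<in> carrier F" "z \<otimes>\<^bsub>F\<^esub> t = y"
        using t Cons.prems(1) by (simp_all add: z_def m_assoc)
      have "shift y (fox_letter x) = - unit_chain (z <#\<^bsub>F\<^esub> K, fst x)"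
        using True Cons.prems(1) t translate_coset[of z "\<one>\<^bsub>F\<^esub>" "fst x"] z
        by (simp add: fox_letter_def shift_unit_chain l_coset_one_K shift_uminus translate_mult flip: t_def z_def)
      moreover have "path_loop z (t \<otimes>\<^bsub>F\<^esub> g) = path_loop z t \<otimes>\<^bsub>F\<^esub> path_loop y g"
        using path_loop_mult[of z t g] z t g by simp
      moreover have "path_loop z (t \<otimes>\<^bsub>F\<^esub> g) = \<one>\<^bsub>F\<^esub>"
        using z t by (simp add: path_loop_def)
      ultimately have "q (path_loop z t) \<otimes>\<^bsub>Q\<^esub> q (path_loop y g) = \<one>\<^bsub>Q\<^esub>"
        and eq: "shift y (fox_letter x) = - unit_chain (z <#\<^bsub>F\<^esub> K, fst x)"
        using q_mult[of "path_loop z t" "path_loop y g"] path_loop_K z t g Cons.prems(1) qh.hom_one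
        by simp_all
      then have "q (path_loop y g) = inv\<^bsub>Q\<^esub> q (path_loop z t)"
        using q_car path_loop_K z t g Cons.prems(1) Q.inv_equality Q.m_comm by metis
      then show ?thesis
        using eq Q.chain_prod_unit(2)[of \<kappa> "(z <#\<^bsub>F\<^esub> K, fst x)"] \<kappa>_coset[OF z(1) c(2)] q_car path_loop_K z t
        by (simp add: t_def)
    qed
    have "q (path_loop y (x # w)) = q (path_loop y g) \<otimes>\<^bsub>Q\<^esub> q (path_loop (y \<otimes>\<^bsub>F\<^esub> g) w)"
      using c g Cons.prems(1) path_loop_mult q_mult path_loop_K by simp
    also have "\<dots> = Q.chain_prod \<kappa> (shift y (fox_letter x)) \<otimes>\<^bsub>Q\<^esub> Q.chain_prod \<kappa> (shift (y \<otimes>\<^bsub>F\<^esub> g) (fox w))"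
      using step Cons.IH[OF _ c(1)] g Cons.prems(1) by simp
    also have "\<dots> = Q.chain_prod \<kappa> (shift y (fox_letter x) + shift (y \<otimes>\<^bsub>F\<^esub> g) (fox w))"
    proof (rule Q.chain_prod_add[OF \<kappa>, symmetric])
      have r: "\<forall>x \<in> set w. fst x < r" "\<forall>z \<in> set [x]. fst z < r"
        using c by (auto simp: carrier_free_group)
      have yg: "y \<otimes>\<^bsub>F\<^esub> g \<in> carrier F"
        using g Cons.prems(1) by simp
      have fx: "fox [x] = fox_letter x"
        by simp
      show "finite {e. shift y (fox_letter x) e \<noteq> 0}" "finite {e. shift (y \<otimes>\<^bsub>F\<^esub> g) (fox w) e \<noteq> 0}"
        using fox_letter_fin[OF c(2)] fox_fin[OF r(1)] yg Cons.prems(1) fin_chains_closed(5)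
        by (auto simp: fin_chains_def supp_def)
      show "{e. shift y (fox_letter x) e \<noteq> 0} \<subseteq> A" "{e. shift (y \<otimes>\<^bsub>F\<^esub> g) (fox w) e \<noteq> 0} \<subseteq> A"
        using fox_A[OF Cons.prems(1) r(2)] fox_A[OF yg r(1)] unfolding fx supp_def by blast+
    qed
    also have "shift y (fox_letter x) + shift (y \<otimes>\<^bsub>F\<^esub> g) (fox w) = shift y (fox (x # w))"
      using g Cons.prems(1) by (simp add: shift_add shift_mult flip: g_def)
    finally show ?case .
  qed
  have F_one: "\<one>\<^bsub>F\<^esub> \<in> carrier F"
    by simp
  have w_car: "w \<in> carrier F"
    using w(1) by (rule mem_carrier)
  have "q (path_loop \<one>\<^bsub>F\<^esub> w) = \<one>\<^bsub>Q\<^esub>"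
    using main[OF F_one w_car] unfolding w(2) shift_zero prod_zero .
  then have loop_D: "path_loop \<one>\<^bsub>F\<^esub> w \<in> D"
    using FK.coset_join1[of D "path_loop \<one>\<^bsub>F\<^esub> w"] path_loop_K[OF _ w_car] D_normal[THEN normal_imp_subgroup]
    by (simp add: q_def Q_def subgroup.subset)
  \<comment> \<open>The representative of the coset \<open>K\<close> may differ from the unit, so
    the loop of \<open>w\<close> is a conjugate of \<open>w\<close>; normality of \<open>D\<close>
    in \<open>F\<close> undoes the conjugation.\<close>
  define t where "t = rep K"
  have t: "t \<in> carrier F"
    using rep_carrier[of "\<one>\<^bsub>F\<^esub>"] l_coset_one_K by (simp add: t_def)
  have "w <#\<^bsub>F\<^esub> K = K"
    using w(1) w_car l_coset_eq_iff[of "\<one>\<^bsub>F\<^esub>" w] l_coset_one_K by simp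
  then have "path_loop \<one>\<^bsub>F\<^esub> w = t \<otimes>\<^bsub>F\<^esub> w \<otimes>\<^bsub>F\<^esub> inv\<^bsub>F\<^esub> t"
    using w_car by (simp add: path_loop_def l_coset_one_K t_def)
  with loop_D have conj_D: "t \<otimes>\<^bsub>F\<^esub> w \<otimes>\<^bsub>F\<^esub> inv\<^bsub>F\<^esub> t \<in> D"
    by simp
  interpret DF: normal D F
    unfolding D_def by (rule derived_is_normal) (rule normal_axioms)
  have "inv\<^bsub>F\<^esub> t \<otimes>\<^bsub>F\<^esub> (t \<otimes>\<^bsub>F\<^esub> w \<otimes>\<^bsub>F\<^esub> inv\<^bsub>F\<^esub> t) \<otimes>\<^bsub>F\<^esub> t \<in> D"
    using t conj_D by (rule DF.inv_op_closed1)
  also have "inv\<^bsub>F\<^esub> t \<otimes>\<^bsub>F\<^esub> (t \<otimes>\<^bsub>F\<^esub> w \<otimes>\<^bsub>F\<^esub> inv\<^bsub>F\<^esub> t) \<otimes>\<^bsub>F\<^esub> t = (inv\<^bsub>F\<^esub> t \<otimes>\<^bsub>F\<^esub> t) \<otimes>\<^bsub>F\<^esub> w \<otimes>\<^bsub>F\<^esub> (inv\<^bsub>F\<^esub> t \<otimes>\<^bsub>F\<^esub> t)"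
    using t w_car by (simp only: m_assoc m_closed inv_closed)
  finally show ?thesis
    using t w_car by (simp add: D_def)
qed

end

section \<open>Congruences modulo normal subgroups\<close>

context normal
begin

lemma rcos_eq_iff:
  assumes "x \<in> carrier G" "y \<in> carrier G" shows "H #> x = H #> y \<longleftrightarrow> x \<otimes> inv y \<in> H"
proof
  assume "H #> x = H #> y"
  then have "x \<in> H #> y"
    using rcos_self[OF assms(1) is_subgroup] by simp
  then show "x \<otimes> inv y \<in> H"
    using rcos_module_imp[OF is_group assms(2)] by simp
next
  assume "x \<otimes> inv y \<in> H"
  then have "x \<in> H #> y"
    using rcos_module_rev[OF is_group assms(2,1)] by simp
  then show "H #> x = H #> y"
    using repr_independence[OF _ assms(2) is_subgroup] by simp
qed

lemma rcos_eq_one_iff: "x \<in> carrier G \<Longrightarrow> H #> x = H #> \<one> \<longleftrightarrow> x \<in> H"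
  using rcos_eq_iff[of x \<one>] by simp

lemma rcos_mult_cong:
  assumes "H #> x = H #> x'" "H #> y = H #> y'" "x \<in> carrier G" "x' \<in> carrier G" "y \<in> carrier G" "y' \<in> carrier G"
  shows "H #> (x \<otimes> y) = H #> (x' \<otimes> y')"
  using assms rcos_sum by metis

lemma rcos_inv_cong:
  assumes "H #> x = H #> x'" "x \<in> carrier G" "x' \<in> carrier G" shows "H #> inv x = H #> inv x'"
  using assms rcos_inv by metis

lemma rcos_eq_generate:
  assumes f: "f \<in> hom G G" "\<And>s. s \<in> S \<Longrightarrow> H #> f s = H #> s" "S \<subseteq> carrier G" "h \<in> generate G S"
  shows "H #> f h = H #> h"
proof -
  interpret f: group_hom G G f
    using f(1) by unfold_locales
  show ?thesis
    using f(4)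
  proof (induction rule: generate.induct)
    case one
    then show ?case by simp
  next
    case (incl h)
    then show ?case using f(2) by simp
  next
    case (inv h)
    then have "h \<in> carrier G"
      using f(3) by blast
    then show ?case
      using rcos_inv_cong[OF f(2)[OF inv]] by simp
  next
    case (eng h1 h2)
    then have "h1 \<in> carrier G" "h2 \<in> carrier G"
      using generate_in_carrier[OF f(3)] by auto
    then show ?case
      using rcos_mult_cong[OF eng.IH] by simp
  qed
qed

end

context group
begin

lemma hom_comm:
  assumes "f \<in> hom G G" "x \<in> carrier G" "y \<in> carrier G" shows "f (comm x y) = comm (f x) (f y)"
proof -
  interpret f: group_hom G G f
    using assms(1) by unfold_locales
  show ?thesis
    using assms(2,3) by (simp add: comm_def)
qed

lemma hom_iter_comm:
  assumes "f \<in> hom G G" "a \<in> carrier G" "b \<in> carrier G" shows "f (iter_comm a b n) = iter_comm (f a) (f b) n"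
proof -
  interpret f: group_hom G G f
    using assms(1) by unfold_locales
  show ?thesis
    using assms(2,3) by (induction n) (simp_all add: hom_comm[OF assms(1)])
qed

end

section \<open>Fox calculus over a torsion-free quotient\<close>

locale torsion_free_fox = fox_calculus K r + torsion_free_coset_module K "free_group r" for K r
begin

lemma derived_normal: "derived F K \<lhd> F"
  by (rule derived_is_normal) (rule normal_axioms)

lemma fox_mult_K: "u \<in> K \<Longrightarrow> v \<in> carrier F \<Longrightarrow> fox (u \<otimes>\<^bsub>F\<^esub> v) = fox u + fox v"
  using fox_mult[of u v] shift_K fin_chains_edges[OF fox_fin_carrier] by (simp add: mem_carrier)

lemma fox_inv_K: "u \<in> K \<Longrightarrow> fox (inv\<^bsub>F\<^esub> u) = - fox u"
  using cocycle_inv[OF cocycle_fox subgroup_self] m_inv_closed[of u] shift_K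
    fin_chains_edges[OF fox_fin_carrier] by (simp add: mem_carrier)

lemma fox_conj_K: "g \<in> carrier F \<Longrightarrow> u \<in> K \<Longrightarrow> fox (g \<otimes>\<^bsub>F\<^esub> u \<otimes>\<^bsub>F\<^esub> inv\<^bsub>F\<^esub> g) = shift g (fox u)"
  using cocycle_conj_K[OF cocycle_fox subgroup_self] by (simp add: mem_carrier)

text \<open>The Magnus embedding on \<open>K / [K, K]\<close>: it lets elements of \<open>K\<close>
  be compared modulo \<open>derived F K\<close> as chains.\<close>

lemma derived_iff_fox: "u \<in> K \<Longrightarrow> u \<in> derived F K \<longleftrightarrow> fox u = 0"
  using fox_derived(2) fox_eq_zero_imp_derived by blast

lemma rcos_derived_iff_fox:
  assumes "u \<in> K" "v \<in> K" shows "derived F K #>\<^bsub>F\<^esub> u = derived F K #>\<^bsub>F\<^esub> v \<longleftrightarrow> fox u = fox v"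
proof -
  have "derived F K #>\<^bsub>F\<^esub> u = derived F K #>\<^bsub>F\<^esub> v \<longleftrightarrow> u \<otimes>\<^bsub>F\<^esub> inv\<^bsub>F\<^esub> v \<in> derived F K"
    using assms normal.rcos_eq_iff[OF derived_normal] by (simp add: mem_carrier)
  also have "\<dots> \<longleftrightarrow> fox (u \<otimes>\<^bsub>F\<^esub> inv\<^bsub>F\<^esub> v) = 0"
    using assms by (intro derived_iff_fox) simp
  also have "fox (u \<otimes>\<^bsub>F\<^esub> inv\<^bsub>F\<^esub> v) = fox u - fox v"
    using assms by (simp add: fox_mult_K fox_inv_K mem_carrier)
  finally show ?thesis
    by (simp only: right_minus_eq)
qed

text \<open>Subtracting the coboundary of \<open>m\<close> makes \<open>fox\<close> vanish at
  \<open>b\<close>, and \<open>iter_comm_cocycle_nonzero\<close> applies if the value at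
  \<open>a\<close> is nonzero. Were it zero, \<open>m\<close> would be finite by
  \<open>coboundary_fin_chain\<close>; but then \<open>(b - 1) m = fox b\<close> would have
  augmentation 0, whereas \<open>expo i b\<close> is not 0.\<close>

lemma iter_comm_notin_derived:
  assumes l: "level l" and a: "a \<in> carrier F" "l a = 0" "a \<notin> K"
    and b: "b \<in> carrier F" "l b = 1" "expo i b \<noteq> 0"
    and notin: "\<And>j. j < n \<Longrightarrow> iter_comm a b j \<notin> K"
  shows "iter_comm a b n \<notin> derived F K"
proof
  assume z: "iter_comm a b n \<in> derived F K"
  obtain m where m: "m \<in> bounded_chains l" "shift b m - m = fox b"
    using solve_coboundary[OF l b(1,2) fox_fin_carrier[OF b(1)]] .
  have m_edges: "supp m \<subseteq> edges"
    using m(1) by (rule bounded_chains_edges)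
  define D where "D h = fox h - (shift h m - m)" for h
  have D: "cocycle (carrier F) D"
    unfolding D_def using cocycle_fox m_edges by (intro cocycle_minus_coboundary) auto
  have "D b = 0"
    by (simp only: D_def m(2) diff_self)
  have "D a \<noteq> 0"
  proof
    assume "D a = 0"
    then have "shift a m - m = fox a"
      by (simp only: D_def right_minus_eq)
    then have "shift a m - m \<in> fin_chains"
      using fox_fin_carrier[OF a(1)] by simp
    then have "m \<in> fin_chains"
      by (rule coboundary_fin_chain[OF l m(1) a])
    then have "aug i (shift b m + (- m)) = 0"
      using b(1) by (subst aug_add) (simp_all add: aug_shift aug_uminus)
    then have "aug i (fox b) = 0"
      unfolding m(2)[symmetric] by simp
    then show False
      using aug_fox[of b i] b by (simp add: carrier_free_group)
  qed
  have "D a \<in> bounded_chains l"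
    unfolding D_def
    by (intro bounded_chains_diff fin_chains_bounded[OF fox_fin_carrier[OF a(1)]] bounded_chains_shift[OF l] a(1) m(1))
  then have "D (iter_comm a b n) \<noteq> 0"
    using iter_comm_cocycle_nonzero[OF D subgroup_self l a(1,2) _ \<open>D a \<noteq> 0\<close> b(1,2) \<open>D b = 0\<close> notin] by blast
  moreover have "D (iter_comm a b n) = 0"
    using fox_derived[OF z] shift_K[OF _ m_edges] by (simp add: D_def)
  ultimately show False
    by blast
qed

text \<open>The defect \<open>h \<mapsto> fox (\<psi> h h\<^sup>-\<^sup>1)\<close> is a cocycle. After subtracting the coboundary that
  kills its value at \<open>b\<close>, its value at a single iterated commutator decides whether it vanishes.\<close>

lemma hom_id_mod_derived:
  assumes \<psi>: "\<psi> \<in> hom F F" and S: "a \<in> carrier F" "b \<in> carrier F"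
    and id: "\<And>h. h \<in> generate F {a, b} \<Longrightarrow> K #>\<^bsub>F\<^esub> \<psi> h = K #>\<^bsub>F\<^esub> h"
    and l: "level l" "l a = 0" "l b = 1"
    and notin: "\<And>j. j < n \<Longrightarrow> iter_comm a b j \<notin> K" and z: "iter_comm a b n \<in> K"
      "derived F K #>\<^bsub>F\<^esub> \<psi> (iter_comm a b n) = derived F K #>\<^bsub>F\<^esub> iter_comm a b n"
    and h: "h \<in> generate F {a, b}" "h \<in> K"
  shows "derived F K #>\<^bsub>F\<^esub> \<psi> h = derived F K #>\<^bsub>F\<^esub> h"
proof -
  interpret \<psi>: group_hom F F \<psi>
    using \<psi> by unfold_locales
  define L where "L = generate F {a, b}"
  have L: "subgroup L F"
    unfolding L_def using S by (intro generate_is_subgroup) simp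
  have L_car: "g \<in> carrier F" if "g \<in> L" for g
    using that subgroup.mem_carrier[OF L] by blast
  have ab: "a \<in> L" "b \<in> L"
    unfolding L_def by (auto intro: generate.incl)
  define \<delta> where "\<delta> g = \<psi> g \<otimes>\<^bsub>F\<^esub> inv\<^bsub>F\<^esub> g" for g
  have \<delta>_K: "\<delta> g \<in> K" if "g \<in> L" for g
    using id[of g] that L_car[OF that] rcos_eq_iff by (simp add: \<delta>_def L_def)
  have \<delta>_mult: "\<delta> (g \<otimes>\<^bsub>F\<^esub> g') = \<delta> g \<otimes>\<^bsub>F\<^esub> (g \<otimes>\<^bsub>F\<^esub> \<delta> g' \<otimes>\<^bsub>F\<^esub> inv\<^bsub>F\<^esub> g)" if "g \<in> L" "g' \<in> L" for g g'
  proof -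
    have car: "g \<in> carrier F" "g' \<in> carrier F"
      using that L_car by auto
    have "inv\<^bsub>F\<^esub> g \<otimes>\<^bsub>F\<^esub> (g \<otimes>\<^bsub>F\<^esub> t) = t" if "t \<in> carrier F" for t
      using car that by (simp flip: m_assoc)
    then show ?thesis
      using car by (simp add: \<delta>_def m_assoc inv_mult_group)
  qed
  define d where "d g = fox (\<delta> g)" for g
  have d: "cocycle L d"
    unfolding cocycle_def
  proof (intro conjI ballI)
    fix g g'
    assume g: "g \<in> L" "g' \<in> L"
    then have "g \<otimes>\<^bsub>F\<^esub> \<delta> g' \<otimes>\<^bsub>F\<^esub> inv\<^bsub>F\<^esub> g \<in> carrier F"
      using L_car \<delta>_K[THEN mem_carrier] by simp
    then show "d (g \<otimes>\<^bsub>F\<^esub> g') = d g + shift g (d g')"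
      using g unfolding d_def \<delta>_mult[OF g] by (subst fox_mult_K) (simp_all add: \<delta>_K fox_conj_K L_car)
  next
    fix g
    assume "g \<in> L"
    then show "supp (d g) \<subseteq> edges"
      unfolding d_def by (intro fin_chains_edges fox_fin_carrier) (simp add: \<delta>_K[THEN mem_carrier])
  qed
  have d_fin: "d g \<in> fin_chains" if "g \<in> L" for g
    unfolding d_def using that by (intro fox_fin_carrier) (simp add: \<delta>_K[THEN mem_carrier])
  obtain m where m: "m \<in> bounded_chains l" "shift b m - m = d b"
    using solve_coboundary[OF l(1) S(2) l(3) d_fin[OF ab(2)]] .
  have m_edges: "supp m \<subseteq> edges"
    using m(1) by (rule bounded_chains_edges)
  define D where "D g = d g - (shift g m - m)" for g
  have D: "cocycle L D"
    unfolding D_def using d m_edges subgroup.subset[OF L] by (intro cocycle_minus_coboundary)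
  \<comment> \<open>A coboundary vanishes on \<open>K\<close>, so the correction leaves the values
    at the iterated commutator and at \<open>h\<close> untouched.\<close>
  have D_K: "D g = d g" if "g \<in> K" for g
    unfolding D_def using shift_K[OF that m_edges] by simp
  have d_eq: "d g = 0 \<longleftrightarrow> derived F K #>\<^bsub>F\<^esub> \<psi> g = derived F K #>\<^bsub>F\<^esub> g" if "g \<in> L" for g
    unfolding d_def using derived_iff_fox[OF \<delta>_K[OF that]] normal.rcos_eq_iff[OF derived_normal, of "\<psi> g" g]
      L_car[OF that] by (simp add: \<delta>_def)
  have Db: "D b = 0"
    by (simp only: D_def m(2) diff_self)
  have zL: "iter_comm a b n \<in> L"
    using iter_comm_in_subgroup[OF L ab] .
  have Dz: "D (iter_comm a b n) = 0"
    using D_K[OF z(1)] d_eq[OF zL] z(2) by (simp only:)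
  have "D a \<in> bounded_chains l"
    unfolding D_def
    by (intro bounded_chains_diff fin_chains_bounded[OF d_fin[OF ab(1)]] bounded_chains_shift[OF l(1)] S(1) m(1))
  then have Da: "D a = 0"
    using iter_comm_cocycle_nonzero[OF D L l(1) ab(1) l(2) _ _ ab(2) l(3) Db notin] Dz by blast
  have "D h = 0"
    using D Da Db S h(1) unfolding L_def
    by (intro cocycle_eq_zero_on_generate[of "{a, b}" D h]) auto
  then show ?thesis
    using D_K[OF h(2)] d_eq[of h] h(1) unfolding L_def by simp
qed

text \<open>With \<open>u = g h^-1\<close> in \<open>K\<close>, the difference \<open>e n\<close> is
  \<open>(1 + h + ... + h^(n-1)) (fox u)\<close>. Since \<open>e q = 0\<close>, multiplying by
  \<open>1 - h\<close> gives \<open>(1 - h^q) (fox u) = 0\<close>. If \<open>fox u\<close> were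
  nonzero, then \<open>h\<close> would lie in \<open>K\<close> and act trivially, so that
  \<open>e q = q * fox u\<close>, a contradiction.\<close>

lemma root_mod_derived:
  assumes g: "g \<in> carrier F" and h: "h \<in> carrier F" and q: "q > 0"
    and gh: "K #>\<^bsub>F\<^esub> g = K #>\<^bsub>F\<^esub> h"
    and pow: "derived F K #>\<^bsub>F\<^esub> (g [^]\<^bsub>F\<^esub> (q::nat)) = derived F K #>\<^bsub>F\<^esub> (h [^]\<^bsub>F\<^esub> q)"
  shows "derived F K #>\<^bsub>F\<^esub> g = derived F K #>\<^bsub>F\<^esub> h"
proof -
  define u where "u = g \<otimes>\<^bsub>F\<^esub> inv\<^bsub>F\<^esub> h"
  have u: "u \<in> K" "g = u \<otimes>\<^bsub>F\<^esub> h"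
    using gh g h rcos_eq_iff by (simp_all add: u_def m_assoc)
  have edges: "supp (fox v) \<subseteq> edges" if "v \<in> carrier F" for v
    using that by (intro fin_chains_edges fox_fin_carrier)
  define e where "e n = fox (g [^]\<^bsub>F\<^esub> n) - fox (h [^]\<^bsub>F\<^esub> n)" for n :: nat
  have e0: "e 0 = 0"
    by (simp add: e_def)
  have fg: "fox g = fox u + fox h"
    using u h fox_mult_K by simp
  have eSuc: "e (Suc n) = fox u + shift h (e n)" for n
  proof -
    have "g [^]\<^bsub>F\<^esub> Suc n = u \<otimes>\<^bsub>F\<^esub> (h \<otimes>\<^bsub>F\<^esub> g [^]\<^bsub>F\<^esub> n)"
      using nat_pow_Suc2[OF g, of n] u g h by (simp add: m_assoc mem_carrier)
    then have "fox (g [^]\<^bsub>F\<^esub> Suc n) = fox u + (fox h + shift h (fox (g [^]\<^bsub>F\<^esub> n)))"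
      using u(1) g h by (simp only: fox_mult_K fox_mult m_closed nat_pow_closed)
    moreover have "fox (h [^]\<^bsub>F\<^esub> Suc n) = fox h + shift h (fox (h [^]\<^bsub>F\<^esub> n))"
      using nat_pow_Suc2[OF h, of n] h by (simp only: fox_mult nat_pow_closed)
    ultimately show ?thesis
      unfolding e_def by (simp only: shift_diff) (simp add: fun_eq_iff)
  qed
  have "e n \<in> fin_chains" for n
    unfolding e_def using g h by (intro fin_chains_closed fox_fin_carrier) auto
  have "fox (g [^]\<^bsub>F\<^esub> q) = fox (h [^]\<^bsub>F\<^esub> q)"
  proof -
    define v where "v = g [^]\<^bsub>F\<^esub> q \<otimes>\<^bsub>F\<^esub> inv\<^bsub>F\<^esub> (h [^]\<^bsub>F\<^esub> q)"
    have "v \<in> derived F K" "g [^]\<^bsub>F\<^esub> q = v \<otimes>\<^bsub>F\<^esub> h [^]\<^bsub>F\<^esub> q"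
      using pow g h normal.rcos_eq_iff[OF derived_normal] by (simp_all add: v_def m_assoc)
    then show ?thesis
      using fox_derived[of v] fox_mult_K[of v "h [^]\<^bsub>F\<^esub> q"] h by simp
  qed
  then have eq0: "e q = 0"
    by (simp add: e_def)
  have tele: "e n - shift h (e n) = fox u - shift (h [^]\<^bsub>F\<^esub> n) (fox u)" for n
  proof (induction n)
    case 0
    then show ?case
      unfolding e0 shift_zero nat_pow_0 shift_one[OF edges[OF mem_carrier[OF u(1)]]] by simp
  next
    case (Suc n)
    have "shift h (e n - shift h (e n)) = shift h (fox u) - shift (h [^]\<^bsub>F\<^esub> Suc n) (fox u)"
      unfolding Suc shift_diff nat_pow_Suc2[OF h] shift_mult[OF h nat_pow_closed[OF h]] ..
    then have "shift h (e n) - shift h (shift h (e n)) = shift h (fox u) - shift (h [^]\<^bsub>F\<^esub> Suc n) (fox u)"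
      by (simp only: shift_diff)
    then show ?case
      unfolding eSuc shift_add by (simp only: algebra_simps)
  qed
  have "fox u = 0"
  proof (rule ccontr)
    assume nz: "fox u \<noteq> 0"
    have "shift (h [^]\<^bsub>F\<^esub> q) (fox u) = fox u"
      using tele[of q] unfolding eq0 by simp
    then have "h [^]\<^bsub>F\<^esub> q \<in> K"
      using shift_fixed_imp_K[OF _ fox_fin_carrier[OF mem_carrier[OF u(1)]] nz] h by simp
    then have hK: "h \<in> K"
      using torsion_free h q by blast
    have e_shift: "shift h (e n) = e n" for n
      using shift_K[OF hK fin_chains_edges] \<open>\<And>n. e n \<in> fin_chains\<close> by blast
    have "e n x = int n * fox u x" for n x
      by (induction n) (simp_all add: e0 eSuc e_shift algebra_simps)
    then have "int q * fox u x = 0" for x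
      using fun_cong[OF eq0, of x] by simp
    then have "fox u x = 0" for x
      using q by simp
    then have "fox u = 0"
      by (intro ext) simp
    then show False
      using nz by blast
  qed
  then have "u \<in> derived F K"
    using fox_eq_zero_imp_derived[OF u(1)] by blast
  then show ?thesis
    using normal.rcos_eq_iff[OF derived_normal, of g h] g h by (simp add: u_def)
qed

definition minus_two :: "letter list \<Rightarrow> letter list \<Rightarrow> letter list" where
  "minus_two x v = x \<otimes>\<^bsub>F\<^esub> v \<otimes>\<^bsub>F\<^esub> inv\<^bsub>F\<^esub> x \<otimes>\<^bsub>F\<^esub> inv\<^bsub>F\<^esub> (v \<otimes>\<^bsub>F\<^esub> v)"

lemma minus_two_K: "x \<in> carrier F \<Longrightarrow> v \<in> K \<Longrightarrow> minus_two x v \<in> K"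
  using inv_op_closed2 by (simp add: minus_two_def)

lemma fox_minus_two:
  assumes "x \<in> carrier F" "v \<in> K" shows "fox (minus_two x v) = shift x (fox v) - (fox v + fox v)"
proof -
  have "x \<otimes>\<^bsub>F\<^esub> v \<otimes>\<^bsub>F\<^esub> inv\<^bsub>F\<^esub> x \<in> K"
    using assms inv_op_closed2 by blast
  then have "fox (minus_two x v) = fox (x \<otimes>\<^bsub>F\<^esub> v \<otimes>\<^bsub>F\<^esub> inv\<^bsub>F\<^esub> x) + fox (inv\<^bsub>F\<^esub> (v \<otimes>\<^bsub>F\<^esub> v))"
    unfolding minus_two_def using assms by (intro fox_mult_K) (auto simp: mem_carrier)
  moreover have "fox (inv\<^bsub>F\<^esub> (v \<otimes>\<^bsub>F\<^esub> v)) = - (fox v + fox v)"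
    using assms by (simp add: fox_inv_K fox_mult_K mem_carrier)
  ultimately show ?thesis
    using fox_conj_K[OF assms] by simp
qed

lemma hom_minus_two:
  assumes "\<psi> \<in> hom F F" "x \<in> carrier F" "v \<in> carrier F"
  shows "\<psi> (minus_two x v) = minus_two (\<psi> x) (\<psi> v)"
proof -
  interpret \<psi>: group_hom F F \<psi>
    using assms(1) by unfold_locales
  show ?thesis
    using assms(2,3) by (simp add: minus_two_def)
qed

text \<open>Peels one factor \<open>a^q - 2\<close> off a test element. The condition on the two
  levels of \<open>\<psi> a\<close> excludes the degenerate endomorphisms, for which
  \<open>shift_minus_two_unique\<close> has nothing to compare.\<close>

lemma minus_two_step:
  assumes l: "level l1" "level l2" and a: "a \<in> carrier F" "l1 a = 1" "l2 a = 0"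
    and v: "v \<in> K" "fox v \<noteq> 0"
  obtains q :: nat where "q > 0" "fox (minus_two (a [^]\<^bsub>F\<^esub> q) v) \<noteq> 0"
    "\<And>\<psi>. \<psi> \<in> hom F F \<Longrightarrow> \<psi> v \<in> K \<Longrightarrow> l1 (\<psi> a) \<noteq> 0 \<or> l2 (\<psi> a) \<noteq> 0 \<Longrightarrow>
      derived F K #>\<^bsub>F\<^esub> \<psi> (minus_two (a [^]\<^bsub>F\<^esub> q) v) = derived F K #>\<^bsub>F\<^esub> minus_two (a [^]\<^bsub>F\<^esub> q) v \<Longrightarrow>
      derived F K #>\<^bsub>F\<^esub> \<psi> v = derived F K #>\<^bsub>F\<^esub> v \<and> K #>\<^bsub>F\<^esub> (\<psi> a [^]\<^bsub>F\<^esub> q) = K #>\<^bsub>F\<^esub> (a [^]\<^bsub>F\<^esub> q)"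
proof -
  have fin: "fox v \<in> fin_chains"
    using v(1) by (intro fox_fin_carrier) (rule mem_carrier)
  obtain m1 n1 where w1: "\<And>e. e \<in> supp (fox v) \<Longrightarrow> m1 \<le> lev l1 e \<and> lev l1 e < m1 + int n1"
    using fin_chains_window[OF fin] by blast
  obtain m2 n2 where w2: "\<And>e. e \<in> supp (fox v) \<Longrightarrow> m2 \<le> lev l2 e \<and> lev l2 e < m2 + int n2"
    using fin_chains_window[OF fin] by blast
  \<comment> \<open>Larger than the width of the support of \<open>fox v\<close> along either level,
    so that \<open>a^q\<close> moves the support off itself.\<close>
  define q where "q = Suc (n1 + n2)"
  define x where "x = a [^]\<^bsub>F\<^esub> q"
  have x: "x \<in> carrier F" "l1 x = int q" "l2 x = 0"
    using a l by (simp_all add: x_def level_pow)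
  have bound1: "\<And>e. e \<in> supp (fox v) \<Longrightarrow> m1 \<le> lev l1 e \<and> lev l1 e < m1 + int q"
    and bound2: "\<And>e. e \<in> supp (fox v) \<Longrightarrow> m2 \<le> lev l2 e \<and> lev l2 e < m2 + int q"
    using w1 w2 by (fastforce simp: q_def)+
  note unique = shift_minus_two_unique[OF l fin v(2) _ x _ _ _ _ _ bound1 bound2]
  show ?thesis
  proof
    show "q > 0"
      by (simp add: q_def)
    show "fox (minus_two (a [^]\<^bsub>F\<^esub> q) v) \<noteq> 0"
    proof
      assume "fox (minus_two (a [^]\<^bsub>F\<^esub> q) v) = 0"
      \<comment> \<open>The factorization is compared with the trivial one,
        \<open>(x - 2) 0\<close>.\<close>
      then have "shift x (fox v) - (fox v + fox v) = shift x 0 - (0 + 0)"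
        using fox_minus_two[OF x(1) v(1)] unfolding x_def by simp
      then have "0 = fox v"
        using unique(1)[of 0 x 1 0] x by (simp add: q_def)
      then show False
        using v(2) by simp
    qed
    fix \<psi>
    assume \<psi>: "\<psi> \<in> hom F F" "\<psi> v \<in> K" "l1 (\<psi> a) \<noteq> 0 \<or> l2 (\<psi> a) \<noteq> 0"
      and eq: "derived F K #>\<^bsub>F\<^esub> \<psi> (minus_two (a [^]\<^bsub>F\<^esub> q) v) = derived F K #>\<^bsub>F\<^esub> minus_two (a [^]\<^bsub>F\<^esub> q) v"
    interpret \<psi>: group_hom F F \<psi>
      using \<psi>(1) by unfold_locales
    define y where "y = \<psi> x"
    have y: "y \<in> carrier F" "y = \<psi> a [^]\<^bsub>F\<^esub> q" "l1 y = int q * l1 (\<psi> a)" "l2 y = int q * l2 (\<psi> a)"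
      using x a l by (simp_all add: y_def x_def \<psi>.hom_nat_pow level_pow)
    have "fox (minus_two y (\<psi> v)) = fox (minus_two x v)"
      using eq[folded x_def] hom_minus_two[OF \<psi>(1) x(1) mem_carrier[OF v(1)]]
        rcos_derived_iff_fox[OF minus_two_K[OF y(1) \<psi>(2)] minus_two_K[OF x(1) v(1)]]
      by (simp add: y_def)
    then have eq': "shift x (fox v) - (fox v + fox v) = shift y (fox (\<psi> v)) - (fox (\<psi> v) + fox (\<psi> v))"
      using fox_minus_two[OF x(1) v(1)] fox_minus_two[OF y(1) \<psi>(2)] by simp
    have fin': "fox (\<psi> v) \<in> fin_chains"
      using \<psi>(2) by (intro fox_fin_carrier) (rule mem_carrier)
    have pos: "int q > 0"
      by (simp add: q_def)
    have "fox (\<psi> v) = fox v" "inv\<^bsub>F\<^esub> x \<otimes>\<^bsub>F\<^esub> y \<in> K"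
      using unique[OF fin' y(1,3,4) \<psi>(3) pos _ _ eq'] by auto
    moreover have "x \<otimes>\<^bsub>F\<^esub> (inv\<^bsub>F\<^esub> x \<otimes>\<^bsub>F\<^esub> y) \<otimes>\<^bsub>F\<^esub> inv\<^bsub>F\<^esub> x = y \<otimes>\<^bsub>F\<^esub> inv\<^bsub>F\<^esub> x"
      using x(1) y(1) by (simp flip: m_assoc)
    ultimately have "fox (\<psi> v) = fox v" "y \<otimes>\<^bsub>F\<^esub> inv\<^bsub>F\<^esub> x \<in> K"
      using inv_op_closed2[OF x(1), of "inv\<^bsub>F\<^esub> x \<otimes>\<^bsub>F\<^esub> y"] by simp_all
    then show "derived F K #>\<^bsub>F\<^esub> \<psi> v = derived F K #>\<^bsub>F\<^esub> v \<and> K #>\<^bsub>F\<^esub> (\<psi> a [^]\<^bsub>F\<^esub> q) = K #>\<^bsub>F\<^esub> (a [^]\<^bsub>F\<^esub> q)"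
      using rcos_derived_iff_fox[OF \<psi>(2) v(1)] rcos_eq_iff[OF y(1) x(1)] y(2) x_def by simp
  qed
qed

end

section \<open>The derived series of a free group\<close>

locale derived_tower =
  fixes r :: nat
begin

abbreviation F where "F \<equiv> free_group r"

sublocale F: group "free_group r"
  by (rule group_free_group)

definition K :: "nat \<Rightarrow> letter list set" where
  "K k = (derived F ^^ k) (carrier F)"

lemma K_0: "K 0 = carrier F"
  by (simp add: K_def)

lemma K_Suc: "K (Suc k) = derived F (K k)"
  by (simp add: K_def)

lemma K_normal: "K k \<lhd> F"
  by (induction k) (simp_all add: K_0 K_Suc F.normal_self F.derived_is_normal)

lemma K_subgroup: "subgroup (K k) F"
  using K_normal by (rule normal_imp_subgroup)

lemma K_carrier: "x \<in> K k \<Longrightarrow> x \<in> carrier F"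
  using subgroup.mem_carrier[OF K_subgroup] .

lemma K_Suc_subset: "K (Suc k) \<subseteq> K k"
  unfolding K_Suc by (rule F.derived_incl[OF subset_refl K_subgroup])

lemma K_mono: "k \<le> l \<Longrightarrow> K l \<subseteq> K k"
  using lift_Suc_antimono_le[of K k l] K_Suc_subset by blast

lemma K_conj: "g \<in> carrier F \<Longrightarrow> x \<in> K k \<Longrightarrow> g \<otimes>\<^bsub>F\<^esub> x \<otimes>\<^bsub>F\<^esub> inv\<^bsub>F\<^esub> g \<in> K k"
  by (rule normal.inv_op_closed2[OF K_normal])

lemma fox_calculus_K: "fox_calculus (K k) r"
  by (intro fox_calculus.intro coset_module.intro K_normal)

text \<open>By induction \<open>g\<close> already lies in \<open>K k\<close>, and then
  \<open>g^n\<close> in \<open>K (Suc k)\<close> means \<open>n * fox g = 0\<close>, where chains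
  take integer values.\<close>

lemma torsion_free_fox_K: "torsion_free_fox (K k) r"
proof (induction k)
  case 0
  show ?case
    by (intro torsion_free_fox.intro fox_calculus_K torsion_free_coset_module.intro coset_module.intro
        torsion_free_coset_module_axioms.intro K_normal) (simp add: K_0)
next
  case (Suc k)
  interpret M: torsion_free_fox "K k" r
    by (rule Suc)
  have "g \<in> K (Suc k)" if g: "g \<in> carrier F" "n > 0" "g [^]\<^bsub>F\<^esub> (n::nat) \<in> K (Suc k)" for g n
  proof -
    have gK: "g \<in> K k"
      using M.torsion_free g K_Suc_subset by blast
    have pow: "M.fox (g [^]\<^bsub>F\<^esub> m) e = int m * M.fox g e" for m :: nat and e
    proof (induction m)
      case 0
      then show ?case by (simp add: one_free_group)
    next
      case (Suc m)
      have "M.fox (g [^]\<^bsub>F\<^esub> Suc m) = M.fox g + M.fox (g [^]\<^bsub>F\<^esub> m)"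
        unfolding F.nat_pow_Suc2[OF g(1)] using gK g(1) by (intro M.fox_mult_K) simp_all
      then show ?case
        using Suc by (simp add: algebra_simps del: F.nat_pow_Suc)
    qed
    have zero: "M.fox (g [^]\<^bsub>F\<^esub> n) = 0"
      using g(3) M.fox_derived(2) unfolding K_Suc by blast
    have "int n * M.fox g e = 0" for e
      unfolding pow[of n e, symmetric] zero by simp
    then have "M.fox g e = 0" for e
      using g(2) by simp
    then have "M.fox g = 0"
      by (intro ext) simp
    then show ?thesis
      using M.fox_eq_zero_imp_derived[OF gK] by (simp add: K_Suc)
  qed
  then show ?case
    by (intro torsion_free_fox.intro fox_calculus_K torsion_free_coset_module.intro coset_module.intro
        torsion_free_coset_module_axioms.intro K_normal)
qed

lemma expo_int_pow:
  assumes "x \<in> carrier F" shows "expo i (x [^]\<^bsub>F\<^esub> (n::int)) = n * expo i x"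
proof -
  interpret E: group_hom F integer_group "expo i"
    by (intro group_hom.intro group_hom_axioms.intro group_integer_group F.is_group)
      (auto simp: hom_def expo_mult)
  show ?thesis
    using E.hom_int_pow[OF assms, of n] by simp
qed

lemma expo_inv: "x \<in> carrier F \<Longrightarrow> expo i (inv\<^bsub>F\<^esub> x) = - expo i x"
  using expo_mult[of x r "inv\<^bsub>F\<^esub> x" i] by (simp add: one_free_group)

text \<open>Modulo \<open>K 0\<close> the Cayley graph has a single vertex, so a Fox chain is
  determined by its augmentations, the exponent sums.\<close>

lemma K_1_iff_expo: "w \<in> K 1 \<longleftrightarrow> w \<in> carrier F \<and> (\<forall>i. expo i w = 0)"
proof -
  interpret M: torsion_free_fox "K 0" r
    by (rule torsion_free_fox_K)
  have "w \<in> K 1 \<longleftrightarrow> M.fox w = 0" if w: "w \<in> carrier F"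
    using M.derived_iff_fox[of w] w by (simp add: K_0 K_Suc)
  moreover have "M.fox w = 0 \<longleftrightarrow> (\<forall>i. expo i w = 0)" if w: "w \<in> carrier F"
  proof -
    have aug: "M.aug i (M.fox w) = expo i w" for i
      using w by (intro M.aug_fox) (simp add: carrier_free_group)
    have edge: "e = (K 0, snd e)" if e: "e \<in> M.edges" for e
    proof -
      obtain x i where x: "x \<in> carrier F" "e = (x <#\<^bsub>F\<^esub> K 0, i)"
        using e by (rule M.edgesE)
      have "x <#\<^bsub>F\<^esub> K 0 = \<one>\<^bsub>F\<^esub> <#\<^bsub>F\<^esub> K 0"
        using x(1) M.l_coset_eq_iff[of x "\<one>\<^bsub>F\<^esub>"] by (simp add: K_0)
      then show ?thesis
        using x M.l_coset_one_K by simp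
    qed
    have "M.aug i f = f (K 0, i)" if f: "f \<in> M.fin_chains" for f i
    proof -
      have "M.supp f \<subseteq> M.edges"
        using f by (rule M.fin_chains_edges)
      then have "e = (K 0, i)" if "e \<in> {e \<in> M.supp f. snd e = i}" for e
        using that edge[of e] by auto
      then have "{e \<in> M.supp f. snd e = i} \<subseteq> {(K 0, i)}"
        by blast
      moreover have "f (K 0, i) = 0" if "(K 0, i) \<notin> M.supp f"
        using that by (simp add: M.supp_def)
      ultimately have "M.aug i f = (\<Sum>e \<in> {(K 0, i)}. f e)"
        unfolding M.aug_def by (intro sum.mono_neutral_left) auto
      then show ?thesis
        by simp
    qed
    then have "expo i w = M.fox w (K 0, i)" for i
      using aug[of i] M.fox_fin_carrier[OF w] by simp
    moreover have "M.fox w e = M.fox w (K 0, snd e)" if "e \<in> M.edges" for e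
      by (rule arg_cong[OF edge[OF that]])
    moreover have "M.fox w e = 0" if "e \<notin> M.edges" for e
      using that M.fin_chains_edges[OF M.fox_fin_carrier[OF w]] by (auto simp: M.supp_def)
    ultimately have *: "M.fox w e = (if e \<in> M.edges then expo (snd e) w else 0)" for e
      by (cases "e \<in> M.edges") (simp_all only: if_True if_False simp_thms)
    show ?thesis
    proof
      assume "M.fox w = 0"
      then show "\<forall>i. expo i w = 0"
        using \<open>\<And>i. expo i w = M.fox w (K 0, i)\<close> by simp
    next
      assume "\<forall>i. expo i w = 0"
      then show "M.fox w = 0"
        using * by (intro ext) simp
    qed
  qed
  ultimately show ?thesis
    using K_carrier by blast
qed

section \<open>Linear functionals on the abelianization as levels\<close>

definition lin :: "(nat \<Rightarrow> int) \<Rightarrow> letter list \<Rightarrow> int" where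
  "lin c w = (\<Sum>i<r. c i * expo i w)"

lemma lin_mult: "u \<in> carrier F \<Longrightarrow> v \<in> carrier F \<Longrightarrow> lin c (u \<otimes>\<^bsub>F\<^esub> v) = lin c u + lin c v"
  by (simp add: lin_def expo_mult distrib_left sum.distrib)

lemma lin_K: "k \<ge> 1 \<Longrightarrow> w \<in> K k \<Longrightarrow> lin c w = 0"
  using K_mono[of 1 k] K_1_iff_expo by (auto simp: lin_def)

lemma lin_int_pow: "x \<in> carrier F \<Longrightarrow> lin c (x [^]\<^bsub>F\<^esub> (n::int)) = n * lin c x"
  by (simp add: lin_def expo_int_pow sum_distrib_left algebra_simps)

lemma lin_nonzero: "lin c w \<noteq> 0 \<Longrightarrow> \<exists>i. expo i w \<noteq> 0"
  by (auto simp: lin_def intro: ccontr)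

lemma lin_diff: "lin (\<lambda>i. c i - x * c' i) w = lin c w - x * lin c' w"
  by (simp add: lin_def algebra_simps sum_subtractf sum_distrib_left)

lemma level_lin: "k \<ge> 1 \<Longrightarrow> coset_module.level (K k) F (lin c)"
  using coset_module.level_def[of "K k" F] coset_module.intro[OF K_normal] lin_mult lin_K by auto

text \<open>Strong induction is needed because \<open>iter_comm_notin_derived\<close> wants every
  earlier iterated commutator outside \<open>K n\<close>; the hypothesis puts the
  \<open>j\<close>-th one outside \<open>K (Suc j)\<close>, which contains
  \<open>K n\<close>.\<close>

lemma iter_comm_notin_K:
  assumes a: "a \<in> carrier F" "lin c a = 0" "a \<notin> K 1" and b: "b \<in> carrier F" "lin c b = 1"
  shows "F.iter_comm a b n \<notin> K (Suc n)"
proof (induction n rule: less_induct)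
  case (less n)
  show ?case
  proof (cases n)
    case 0
    then show ?thesis using a(3) by simp
  next
    case (Suc m)
    interpret M: torsion_free_fox "K n" r
      by (rule torsion_free_fox_K)
    obtain i where "expo i b \<noteq> 0"
      using lin_nonzero[of c b] b(2) by auto
    moreover have "a \<notin> K n"
      using a(3) K_mono[of 1 n] Suc by auto
    moreover have "F.iter_comm a b j \<notin> K n" if "j < n" for j
      using less.IH[OF that] K_mono[of "Suc j" n] that by auto
    ultimately show ?thesis
      unfolding K_Suc using a b level_lin[of n c] Suc by (intro M.iter_comm_notin_derived[of "lin c" a b i n]) auto
  qed
qed

lemma iter_comm_in_K:
  assumes "a \<in> K m" "b \<in> carrier F" shows "F.iter_comm a b n \<in> K (m + n)"
proof (induction n)
  case 0
  then show ?case using assms by simp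
next
  case (Suc n)
  then show ?case
    using K_conj[OF assms(2) Suc] by (simp add: K_Suc F.comm_in_derived)
qed

section \<open>Action of endomorphisms on the derived series and on exponent sums\<close>

lemma hom_derived:
  assumes "\<psi> \<in> hom F F" "S \<subseteq> carrier F" "\<psi> ` S \<subseteq> L" "x \<in> (derived F ^^ k) S"
  shows "\<psi> x \<in> (derived F ^^ k) L"
proof -
  interpret \<psi>: group_hom F F \<psi>
    using assms(1) by unfold_locales
  show ?thesis
    using \<psi>.exp_of_derived_img[OF assms(2), of k] F.mono_exp_of_derived[OF assms(3), of k] assms(4) by blast
qed

lemma hom_K: "\<psi> \<in> hom F F \<Longrightarrow> x \<in> K k \<Longrightarrow> \<psi> x \<in> K k"
  unfolding K_def by (rule hom_derived[of \<psi> "carrier F"]) (auto simp: hom_def)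

lemma expo_hom:
  assumes "\<psi> \<in> hom F F" "w \<in> carrier F"
  shows "expo j (\<psi> w) = (\<Sum>i<r. expo i w * expo j (\<psi> (free_gen i)))"
  using assms(2)
proof (induction w)
  case Nil
  interpret \<psi>: group_hom F F \<psi>
    using assms(1) by unfold_locales
  show ?case
    using \<psi>.hom_one by (simp add: one_free_group)
next
  case (Cons x w)
  interpret \<psi>: group_hom F F \<psi>
    using assms(1) by unfold_locales
  note c = Cons_free_group[OF Cons.prems]
  have gen: "free_gen (fst x) \<in> carrier F"
    using c(2) by (rule free_gen_carrier)
  have letter: "letter_val F free_gen x \<in> carrier F"
    using gen by (rule F.letter_val_closed)
  define s where "s = (if snd x then -1 else 1 :: int)"
  have "expo j (\<psi> (x # w)) = expo j (\<psi> (letter_val F free_gen x)) + expo j (\<psi> w)"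
    using c(1,3) letter by (simp add: expo_mult)
  also have "expo j (\<psi> (letter_val F free_gen x)) = s * expo j (\<psi> (free_gen (fst x)))"
    using gen by (simp add: letter_val_def s_def expo_inv)
  also have "\<dots> = (\<Sum>i<r. (if fst x = i then s else 0) * expo j (\<psi> (free_gen i)))"
    using c(2) by (simp add: if_distrib[of "\<lambda>a. a * _"] sum.delta cong: if_cong)
  finally show ?case
    using Cons.IH[OF c(1)] by (cases "snd x") (simp_all add: s_def distrib_right sum.distrib cong: if_cong)
qed

lemma rcos_expo:
  assumes "k \<ge> 1" "K k #>\<^bsub>F\<^esub> x = K k #>\<^bsub>F\<^esub> y" "x \<in> carrier F" "y \<in> carrier F"
  shows "expo i x = expo i y"
proof -
  have "x \<otimes>\<^bsub>F\<^esub> inv\<^bsub>F\<^esub> y \<in> K 1"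
    using normal.rcos_eq_iff[OF K_normal assms(3,4), of k] assms(2) K_mono[OF assms(1)] by blast
  then have "expo i (x \<otimes>\<^bsub>F\<^esub> inv\<^bsub>F\<^esub> y) = 0"
    using K_1_iff_expo by blast
  then show ?thesis
    using assms(3,4) by (simp add: expo_mult expo_inv)
qed

lemma rcos_mono:
  assumes "k \<le> l" "K l #>\<^bsub>F\<^esub> x = K l #>\<^bsub>F\<^esub> y" "x \<in> carrier F" "y \<in> carrier F"
  shows "K k #>\<^bsub>F\<^esub> x = K k #>\<^bsub>F\<^esub> y"
  using normal.rcos_eq_iff[OF K_normal assms(3,4)] assms(2) K_mono[OF assms(1)] by blast

text \<open>\<open>fixes_each d L\<close> is verbal closedness of the image of \<open>L\<close> in \<open>F / K d\<close>, lifted to \<open>F\<close>.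
  The conclusion \<open>retractable d L\<close> makes \<open>\<psi>\<close> an automorphism of that image.\<close>

definition fixes_each :: "nat \<Rightarrow> letter list set \<Rightarrow> bool" where
  "fixes_each d L \<longleftrightarrow> (\<forall>v \<in> L. \<exists>\<psi> \<in> hom F F. \<psi> ` carrier F \<subseteq> L \<and> K d #>\<^bsub>F\<^esub> \<psi> v = K d #>\<^bsub>F\<^esub> v)"

definition retractable :: "nat \<Rightarrow> letter list set \<Rightarrow> bool" where
  "retractable d L \<longleftrightarrow> (\<exists>\<psi> \<in> hom F F. \<psi> ` carrier F \<subseteq> L \<and>
     (\<forall>h \<in> L. K (d - 1) #>\<^bsub>F\<^esub> \<psi> h = K (d - 1) #>\<^bsub>F\<^esub> h) \<and>
     (\<forall>h \<in> L \<inter> K (d - 1). K d #>\<^bsub>F\<^esub> \<psi> h = K d #>\<^bsub>F\<^esub> h))"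

lemma fixes_eachD:
  assumes "fixes_each d L" "v \<in> L"
  obtains \<psi> where "\<psi> \<in> hom F F" "\<And>x. x \<in> carrier F \<Longrightarrow> \<psi> x \<in> L" "K d #>\<^bsub>F\<^esub> \<psi> v = K d #>\<^bsub>F\<^esub> v"
  using assms unfolding fixes_each_def by blast

lemma retractableI:
  assumes "\<psi> \<in> hom F F" "\<And>x. x \<in> carrier F \<Longrightarrow> \<psi> x \<in> L" "L \<subseteq> carrier F"
    and "\<And>h. h \<in> L \<Longrightarrow> K d #>\<^bsub>F\<^esub> \<psi> h = K d #>\<^bsub>F\<^esub> h"
  shows "retractable d L"
proof -
  have "K (d - 1) #>\<^bsub>F\<^esub> \<psi> h = K (d - 1) #>\<^bsub>F\<^esub> h" if "h \<in> L" for h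
    by (rule rcos_mono[OF _ assms(4)[OF that]]) (use assms that in auto)
  then show ?thesis
    unfolding retractable_def using assms by (intro bexI[of _ \<psi>]) auto
qed

section \<open>Independent generators, derived length at least two\<close>

lemma rank_two_solvable:
  assumes A: "A \<in> carrier F" and B: "B \<in> carrier F" and L: "L = generate F {A, B}"
    and l: "lin c1 A = 1" "lin c1 B = 0" "lin c2 A = 0" "lin c2 B = 1"
    and expo_L: "\<And>h i. h \<in> L \<Longrightarrow> expo i h = lin c1 h * expo i A + lin c2 h * expo i B"
    and fixed: "fixes_each (Suc (Suc n)) L"
  shows "retractable (Suc (Suc n)) L"
proof -
  let ?K = "K (Suc n)" and ?K2 = "K (Suc (Suc n))"
  let ?D = "derived F ?K"
  interpret M: torsion_free_fox "?K" r
    by (rule torsion_free_fox_K)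
  note lev = level_lin[of "Suc n", simplified]
  have L_sub: "subgroup L F"
    unfolding L using A B by (intro F.generate_is_subgroup) simp
  have L_car: "x \<in> carrier F" if "x \<in> L" for x
    using that subgroup.mem_carrier[OF L_sub] by blast
  have AL: "A \<in> L" and BL: "B \<in> L"
    unfolding L by (auto intro: generate.incl)
  have A1: "A \<notin> K 1" and B1: "B \<notin> K 1"
    using l lin_K[of 1] by force+
  \<comment> \<open>\<open>u\<close> takes one step fewer than \<open>z\<close>: it has to stay
    outside \<open>?K\<close> in order to act nontrivially on the layer, while \<open>z\<close> has
    to lie in the layer. The commutator \<open>v0\<close> is \<open>(u - 1) z\<close> in module
    notation.\<close>
  define u where "u = F.iter_comm B A n"
  define z where "z = F.iter_comm A B (Suc n)"
  define v0 where "v0 = F.comm u z"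
  have uL: "u \<in> L" and zL: "z \<in> L"
    unfolding u_def z_def using F.iter_comm_in_subgroup[OF L_sub] AL BL by blast+
  then have v0L: "v0 \<in> L"
    unfolding v0_def by (intro F.comm_in_subgroup[OF L_sub])
  have uK: "u \<notin> ?K"
    unfolding u_def using A B l B1 by (intro iter_comm_notin_K[where c = c1]) auto
  have zK: "z \<in> ?K"
    unfolding z_def using iter_comm_in_K[of A 0 B "Suc n"] A B by (simp add: K_0)
  have z_fox: "M.fox z \<noteq> 0"
    using iter_comm_notin_K[of A c2 B "Suc n"] A B l A1 M.derived_iff_fox[OF zK] by (simp add: z_def K_Suc)
  have u_car: "u \<in> carrier F" and z_car: "z \<in> carrier F"
    using uL zL L_car by auto
  have fox_comm: "M.fox (F.comm x y) = M.shift x (M.fox y) - M.fox y" if "x \<in> carrier F" "y \<in> ?K" for x y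
  proof -
    have "x \<otimes>\<^bsub>F\<^esub> y \<otimes>\<^bsub>F\<^esub> inv\<^bsub>F\<^esub> x \<in> ?K"
      using that K_conj by blast
    then have "M.fox (F.comm x y) = M.fox (x \<otimes>\<^bsub>F\<^esub> y \<otimes>\<^bsub>F\<^esub> inv\<^bsub>F\<^esub> x) + M.fox (inv\<^bsub>F\<^esub> y)"
      unfolding F.comm_def using that K_carrier by (intro M.fox_mult_K) auto
    then show ?thesis
      using that M.fox_conj_K[OF that] M.fox_inv_K[OF that(2)] by simp
  qed
  have comm_K: "F.comm x y \<in> ?K" if "x \<in> carrier F" "y \<in> ?K" for x y
    unfolding F.comm_def
    using that K_conj[OF that] subgroup.m_closed[OF K_subgroup] subgroup.m_inv_closed[OF K_subgroup] by blast
  have v0K: "v0 \<in> ?K"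
    unfolding v0_def using comm_K[OF u_car zK] .
  have v0_fox: "M.fox v0 \<noteq> 0"
  proof
    assume "M.fox v0 = 0"
    then have "M.shift u (M.fox z) = M.fox z"
      using fox_comm[OF u_car zK] unfolding v0_def by (metis right_minus_eq)
    then show False
      using M.shift_fixed_imp_K[OF u_car M.fox_fin_carrier[OF z_car] z_fox] uK by blast
  qed
  \<comment> \<open>For the factor of \<open>B\<close> the two levels trade places, since
    \<open>c2\<close> is the functional with value 1 at \<open>B\<close>.\<close>
  obtain q1 :: nat where q1: "q1 > 0" and v1_fox: "M.fox (M.minus_two (B [^]\<^bsub>F\<^esub> q1) v0) \<noteq> 0"
    and v1: "\<And>\<psi>. \<psi> \<in> hom F F \<Longrightarrow> \<psi> v0 \<in> ?K \<Longrightarrow> lin c2 (\<psi> B) \<noteq> 0 \<or> lin c1 (\<psi> B) \<noteq> 0 \<Longrightarrow>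
      ?D #>\<^bsub>F\<^esub> \<psi> (M.minus_two (B [^]\<^bsub>F\<^esub> q1) v0) = ?D #>\<^bsub>F\<^esub> M.minus_two (B [^]\<^bsub>F\<^esub> q1) v0 \<Longrightarrow>
      ?D #>\<^bsub>F\<^esub> \<psi> v0 = ?D #>\<^bsub>F\<^esub> v0 \<and>
      ?K #>\<^bsub>F\<^esub> (\<psi> B [^]\<^bsub>F\<^esub> q1) = ?K #>\<^bsub>F\<^esub> (B [^]\<^bsub>F\<^esub> q1)"
    using M.minus_two_step[OF lev lev B l(4,2) v0K v0_fox] by blast
  define w1 where "w1 = M.minus_two (B [^]\<^bsub>F\<^esub> q1) v0"
  have w1K: "w1 \<in> ?K"
    unfolding w1_def using B v0K by (intro M.minus_two_K) auto
  obtain q2 :: nat where q2: "q2 > 0" and v2_fox: "M.fox (M.minus_two (A [^]\<^bsub>F\<^esub> q2) w1) \<noteq> 0"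
    and v2: "\<And>\<psi>. \<psi> \<in> hom F F \<Longrightarrow> \<psi> w1 \<in> ?K \<Longrightarrow> lin c1 (\<psi> A) \<noteq> 0 \<or> lin c2 (\<psi> A) \<noteq> 0 \<Longrightarrow>
      ?D #>\<^bsub>F\<^esub> \<psi> (M.minus_two (A [^]\<^bsub>F\<^esub> q2) w1) = ?D #>\<^bsub>F\<^esub> M.minus_two (A [^]\<^bsub>F\<^esub> q2) w1 \<Longrightarrow>
      ?D #>\<^bsub>F\<^esub> \<psi> w1 = ?D #>\<^bsub>F\<^esub> w1 \<and>
      ?K #>\<^bsub>F\<^esub> (\<psi> A [^]\<^bsub>F\<^esub> q2) = ?K #>\<^bsub>F\<^esub> (A [^]\<^bsub>F\<^esub> q2)"
    using M.minus_two_step[OF lev lev A l(1,3) w1K v1_fox[folded w1_def]] by blast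
  define w2 where "w2 = M.minus_two (A [^]\<^bsub>F\<^esub> q2) w1"
  have minus_two_in: "M.minus_two x y \<in> L'" if "subgroup L' F" "y \<in> L'" "x \<otimes>\<^bsub>F\<^esub> y \<otimes>\<^bsub>F\<^esub> inv\<^bsub>F\<^esub> x \<in> L'" for L' x y
    unfolding M.minus_two_def using that
    by (intro subgroup.m_closed[OF that(1) that(3)] subgroup.m_inv_closed subgroup.m_closed)
  have pow_L: "x [^]\<^bsub>F\<^esub> (q::nat) \<in> L" if "x \<in> L" for x q
    using that by (induction q) (simp_all add: subgroup.one_closed[OF L_sub] subgroup.m_closed[OF L_sub])
  have w1L: "w1 \<in> L"
    unfolding w1_def by (intro minus_two_in[OF L_sub] F.conj_in_subgroup[OF L_sub] v0L pow_L BL)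
  have w2L: "w2 \<in> L"
    unfolding w2_def by (intro minus_two_in[OF L_sub] F.conj_in_subgroup[OF L_sub] w1L pow_L AL)
  obtain \<psi> where \<psi>: "\<psi> \<in> hom F F" "\<And>x. x \<in> carrier F \<Longrightarrow> \<psi> x \<in> L"
    and \<psi>_w2: "?K2 #>\<^bsub>F\<^esub> \<psi> w2 = ?K2 #>\<^bsub>F\<^esub> w2"
    using fixes_eachD[OF fixed w2L] by blast
  interpret \<psi>: group_hom F F \<psi>
    using \<psi>(1) by unfold_locales
  have w2K: "w2 \<in> ?K"
    unfolding w2_def using A w1K by (intro M.minus_two_K) auto
  \<comment> \<open>Both factors \<open>x - 2\<close> preserve \<open>?K2\<close>, so otherwise
    \<open>\<psi> w2\<close>, and with it \<open>w2\<close>, would lie in \<open>?K2\<close>,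
    against \<open>v2_fox\<close>.\<close>
  have \<psi>_v0: "\<psi> v0 \<notin> ?K2"
  proof
    assume *: "\<psi> v0 \<in> ?K2"
    have closed: "M.minus_two x y \<in> ?K2" if "x \<in> carrier F" "y \<in> ?K2" for x y
      using that K_conj by (intro minus_two_in[OF K_subgroup])
    have "\<psi> w1 = M.minus_two (\<psi> (B [^]\<^bsub>F\<^esub> q1)) (\<psi> v0)"
      unfolding w1_def using B v0L L_car by (intro M.hom_minus_two[OF \<psi>(1)]) auto
    then have "\<psi> w1 \<in> ?K2"
      using closed[OF _ *] B by simp
    moreover have "\<psi> w2 = M.minus_two (\<psi> (A [^]\<^bsub>F\<^esub> q2)) (\<psi> w1)"
      unfolding w2_def using A w1L L_car by (intro M.hom_minus_two[OF \<psi>(1)]) auto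
    ultimately have "\<psi> w2 \<in> ?K2"
      using closed A by simp
    then have "w2 \<in> ?K2"
      using \<psi>_w2 normal.rcos_eq_one_iff[OF K_normal] L_car[OF w2L] K_carrier by metis
    then show False
      using v2_fox M.derived_iff_fox[OF w2K] by (simp add: w2_def K_Suc)
  qed
  have \<psi>_A1: "\<psi> A \<notin> K 1"
  proof
    assume "\<psi> A \<in> K 1"
    then have "F.iter_comm (\<psi> A) (\<psi> B) (Suc n) \<in> K (1 + Suc n)"
      using B by (intro iter_comm_in_K) auto
    then have "\<psi> z \<in> ?K2"
      unfolding z_def F.hom_iter_comm[OF \<psi>(1) A B] by (simp only: plus_1_eq_Suc)
    moreover have "\<psi> v0 = \<psi> u \<otimes>\<^bsub>F\<^esub> \<psi> z \<otimes>\<^bsub>F\<^esub> inv\<^bsub>F\<^esub> \<psi> u \<otimes>\<^bsub>F\<^esub> inv\<^bsub>F\<^esub> \<psi> z"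
      using u_car z_car by (simp add: v0_def F.comm_def)
    ultimately have "\<psi> v0 \<in> ?K2"
      using K_conj[of "\<psi> u"] u_car subgroup.m_closed[OF K_subgroup] subgroup.m_inv_closed[OF K_subgroup] by simp
    then show False
      using \<psi>_v0 by blast
  qed
  have \<psi>_B1: "\<psi> B \<notin> K 1"
  proof
    assume "\<psi> B \<in> K 1"
    then have "\<psi> u \<in> ?K"
      using iter_comm_in_K[of "\<psi> B" 1 "\<psi> A" n] A B F.hom_iter_comm[OF \<psi>(1) B A] by (simp add: u_def)
    then have "\<psi> v0 \<in> ?K2"
      unfolding v0_def F.hom_comm[OF \<psi>(1) u_car z_car] K_Suc[of "Suc n"]
      using hom_K[OF \<psi>(1) zK] by (intro F.comm_in_derived)
    then show False
      using \<psi>_v0 by blast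
  qed
  have nondeg: "lin c1 x \<noteq> 0 \<or> lin c2 x \<noteq> 0" if "x \<in> L" "x \<notin> K 1" for x
    using that expo_L[of x] L_car[of x] K_1_iff_expo[of x] by auto
  have s2: "?D #>\<^bsub>F\<^esub> \<psi> w1 = ?D #>\<^bsub>F\<^esub> w1 \<and>
      ?K #>\<^bsub>F\<^esub> (\<psi> A [^]\<^bsub>F\<^esub> q2) = ?K #>\<^bsub>F\<^esub> (A [^]\<^bsub>F\<^esub> q2)"
    by (rule v2[OF \<psi>(1) hom_K[OF \<psi>(1) w1K] nondeg[OF \<psi>(2)[OF A] \<psi>_A1]])
      (rule \<psi>_w2[unfolded w2_def K_Suc[of "Suc n"]])
  have s1: "?D #>\<^bsub>F\<^esub> \<psi> v0 = ?D #>\<^bsub>F\<^esub> v0 \<and>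
      ?K #>\<^bsub>F\<^esub> (\<psi> B [^]\<^bsub>F\<^esub> q1) = ?K #>\<^bsub>F\<^esub> (B [^]\<^bsub>F\<^esub> q1)"
    by (rule v1[OF \<psi>(1) hom_K[OF \<psi>(1) v0K]]) (use nondeg[OF \<psi>(2)[OF B] \<psi>_B1] s2 in \<open>auto simp: w1_def\<close>)
  \<comment> \<open>Only powers of \<open>\<psi> A\<close> and \<open>\<psi> B\<close> are known so
    far; the exponents are removed one derived term at a time.\<close>
  have root: "K m #>\<^bsub>F\<^esub> g = K m #>\<^bsub>F\<^esub> h"
    if "g \<in> carrier F" "h \<in> carrier F" "q > 0" "K m #>\<^bsub>F\<^esub> (g [^]\<^bsub>F\<^esub> q) = K m #>\<^bsub>F\<^esub> (h [^]\<^bsub>F\<^esub> q)"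
    for g h m and q :: nat
    using that(4)
  proof (induction m)
    case 0
    then show ?case
      using that normal.rcos_eq_iff[OF K_normal, of g h 0] by (simp add: K_0)
  next
    case (Suc m)
    interpret N: torsion_free_fox "K m" r
      by (rule torsion_free_fox_K)
    have "K m #>\<^bsub>F\<^esub> g = K m #>\<^bsub>F\<^esub> h"
      using that by (intro Suc.IH rcos_mono[OF _ Suc.prems]) auto
    then show ?case
      using N.root_mod_derived[OF that(1-3)] Suc.prems by (simp add: K_Suc)
  qed
  have id: "?K #>\<^bsub>F\<^esub> \<psi> h = ?K #>\<^bsub>F\<^esub> h" if "h \<in> L" for h
  proof (rule normal.rcos_eq_generate[OF K_normal \<psi>(1)])
    show "h \<in> generate F {A, B}"
      using that L by simp
    show "?K #>\<^bsub>F\<^esub> \<psi> s = ?K #>\<^bsub>F\<^esub> s" if "s \<in> {A, B}" for s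
      using that root[OF \<psi>.hom_closed[OF A] A q2 conjunct2[OF s2]]
        root[OF \<psi>.hom_closed[OF B] B q1 conjunct2[OF s1]] by blast
  qed (use A B in simp)
  \<comment> \<open>By \<open>id\<close>, \<open>\<psi> u\<close> and \<open>u\<close> act alike on
    chains, so the equation for \<open>v0\<close> becomes \<open>(u - 1) (\<psi> z - z) = 0\<close>,
    where \<open>u - 1\<close> can be cancelled.\<close>
  have z_id: "?D #>\<^bsub>F\<^esub> \<psi> z = ?D #>\<^bsub>F\<^esub> z"
  proof -
    have \<psi>zK: "\<psi> z \<in> ?K"
      using hom_K[OF \<psi>(1) zK] .
    define f where "f = M.fox (\<psi> z) - M.fox z"
    have f: "f \<in> M.fin_chains"
      unfolding f_def using z_car by (intro M.fin_chains_closed M.fox_fin_carrier) auto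
    have "M.fox (\<psi> v0) = M.fox v0"
      using s1 M.rcos_derived_iff_fox[OF hom_K[OF \<psi>(1) v0K] v0K] by blast
    then have "M.shift (\<psi> u) (M.fox (\<psi> z)) - M.fox (\<psi> z) = M.shift u (M.fox z) - M.fox z"
      using fox_comm[OF u_car zK] fox_comm[OF \<psi>.hom_closed[OF u_car] \<psi>zK] F.hom_comm[OF \<psi>(1) u_car z_car]
      by (simp only: v0_def)
    moreover have "M.shift (\<psi> u) (M.fox (\<psi> z)) = M.shift u (M.fox (\<psi> z))"
    proof (rule M.shift_cong_K)
      have "\<psi> u \<otimes>\<^bsub>F\<^esub> inv\<^bsub>F\<^esub> u \<in> ?K"
        using id[OF uL] normal.rcos_eq_iff[OF K_normal] u_car by simp
      then have "inv\<^bsub>F\<^esub> u \<otimes>\<^bsub>F\<^esub> (\<psi> u \<otimes>\<^bsub>F\<^esub> inv\<^bsub>F\<^esub> u) \<otimes>\<^bsub>F\<^esub> u \<in> ?K"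
        using normal.inv_op_closed1[OF K_normal u_car] by blast
      then show "inv\<^bsub>F\<^esub> u \<otimes>\<^bsub>F\<^esub> \<psi> u \<in> ?K"
        using u_car by (simp add: F.m_assoc)
      show "M.supp (M.fox (\<psi> z)) \<subseteq> M.edges"
        using z_car by (intro M.fin_chains_edges M.fox_fin_carrier) simp
    qed (use u_car in auto)
    ultimately have "M.shift u f = f"
      unfolding f_def M.shift_diff by (simp add: algebra_simps)
    then have "f = 0"
      using M.shift_fixed_imp_K[OF u_car f] uK by blast
    then have "M.fox (\<psi> z) = M.fox z"
      unfolding f_def by (rule iffD1[OF right_minus_eq])
    then show ?thesis
      using M.rcos_derived_iff_fox[OF \<psi>zK zK] by blast
  qed
  have notin: "F.iter_comm A B j \<notin> ?K" if "j < Suc n" for j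
    using iter_comm_notin_K[of A c2 B j] A B l A1 K_mono[of "Suc j" "Suc n"] that by auto
  have "?K2 #>\<^bsub>F\<^esub> \<psi> h = ?K2 #>\<^bsub>F\<^esub> h" if "h \<in> L \<inter> ?K" for h
    unfolding K_Suc[of "Suc n"]
    using that id L
    by (intro M.hom_id_mod_derived[OF \<psi>(1) A B _ lev l(3,4) notin zK[unfolded z_def] z_id[unfolded z_def]]) auto
  then show ?thesis
    unfolding retractable_def using \<psi> id by (intro bexI[of _ \<psi>]) auto
qed

text \<open>If \<open>L\<close> is cyclic modulo commutators, then each layer \<open>U\<close> of \<open>L \<inter> K 1\<close> satisfies
  \<open>U = (C - 1) U\<close> and vanishes by descent on the width of supports.\<close>

lemma cyclic_layer_trivial:
  assumes L: "subgroup L F" and C: "C \<in> L" and fixed: "fixes_each d L"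
    and cyc: "\<And>h. h \<in> L \<Longrightarrow> \<exists>(i::int) n. n \<in> L \<inter> K 1 \<and> h = C [^]\<^bsub>F\<^esub> i \<otimes>\<^bsub>F\<^esub> n"
    and C1: "lin c C = 1 \<or> C = \<one>\<^bsub>F\<^esub>"
    and k: "1 \<le> k" "k < d" "L \<inter> K 1 \<subseteq> K k"
  shows "L \<inter> K 1 \<subseteq> K (Suc k)"
proof -
  interpret M: torsion_free_fox "K k" r
    by (rule torsion_free_fox_K)
  have L_car: "x \<in> carrier F" if "x \<in> L" for x
    using that subgroup.mem_carrier[OF L] by blast
  define N where "N = L \<inter> K 1"
  have N_sub: "subgroup N F"
    unfolding N_def using L K_subgroup by (rule F.subgroups_Inter_pair)
  have N_K: "n \<in> K k" if "n \<in> N" for n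
    using that k(3) by (auto simp: N_def)
  have N_car: "n \<in> carrier F" if "n \<in> N" for n
    using that L_car by (auto simp: N_def)
  have N_conj: "g \<otimes>\<^bsub>F\<^esub> n \<otimes>\<^bsub>F\<^esub> inv\<^bsub>F\<^esub> g \<in> N" if "g \<in> L" "n \<in> N" for g n
    using that K_conj[of g n 1] L_car F.conj_in_subgroup[OF L] by (simp add: N_def)
  define U where "U = M.fox ` N"
  define W where "W = (\<lambda>f. M.shift C f - f) ` U"
  have U_fin: "U \<subseteq> M.fin_chains"
    using N_car by (auto simp: U_def M.fox_fin_carrier)
  have U_shift: "M.shift g f \<in> U" if g: "g \<in> L" and f: "f \<in> U" for g f
  proof -
    obtain n where n: "n \<in> N" "f = M.fox n"
      using f by (auto simp: U_def)
    then have "M.shift g f = M.fox (g \<otimes>\<^bsub>F\<^esub> n \<otimes>\<^bsub>F\<^esub> inv\<^bsub>F\<^esub> g)"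
      using M.fox_conj_K[OF L_car[OF g] N_K[OF n(1)]] by simp
    then show ?thesis
      using N_conj[OF g n(1)] by (auto simp: U_def)
  qed
  have U_add: "f + f' \<in> U" if f: "f \<in> U" "f' \<in> U" for f f'
  proof -
    obtain n n' where n: "n \<in> N" "f = M.fox n" "n' \<in> N" "f' = M.fox n'"
      using f by (auto simp: U_def)
    have "f + f' = M.fox (n \<otimes>\<^bsub>F\<^esub> n')"
      unfolding n by (rule M.fox_mult_K[OF N_K[OF n(1)] N_car[OF n(3)], symmetric])
    then show ?thesis
      using subgroup.m_closed[OF N_sub n(1,3)] by (auto simp: U_def)
  qed
  have U_uminus: "- f \<in> U" if f: "f \<in> U" for f
  proof -
    obtain n where n: "n \<in> N" "f = M.fox n"
      using f by (auto simp: U_def)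
    have "- f = M.fox (inv\<^bsub>F\<^esub> n)"
      unfolding n by (rule M.fox_inv_K[OF N_K[OF n(1)], symmetric])
    then show ?thesis
      using subgroup.m_inv_closed[OF N_sub n(1)] by (auto simp: U_def)
  qed
  have WI: "M.shift C f - f \<in> W" if "f \<in> U" for f
    using that by (auto simp: W_def)
  have W_add: "f + f' \<in> W" if f: "f \<in> W" "f' \<in> W" for f f'
  proof -
    obtain e e' where e: "e \<in> U" "f = M.shift C e - e" "e' \<in> U" "f' = M.shift C e' - e'"
      using f by (auto simp: W_def)
    have "f + f' = M.shift C (e + e') - (e + e')"
      unfolding e M.shift_add by (simp only: algebra_simps)
    then show ?thesis
      using WI[OF U_add[OF e(1,3)]] by (simp only:)
  qed
  have W_uminus: "- f \<in> W" if f: "f \<in> W" for f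
  proof -
    obtain e where e: "e \<in> U" "f = M.shift C e - e"
      using f by (auto simp: W_def)
    have "- f = M.shift C (- e) - (- e)"
      unfolding e M.shift_uminus by (simp only: minus_diff_minus)
    then show ?thesis
      using WI[OF U_uminus[OF e(1)]] by (simp only:)
  qed
  have zero_W: "0 \<in> W"
  proof -
    have "M.fox \<one>\<^bsub>F\<^esub> \<in> U"
      using subgroup.one_closed[OF N_sub] by (auto simp: U_def)
    then have "M.shift C (M.fox \<one>\<^bsub>F\<^esub>) - M.fox \<one>\<^bsub>F\<^esub> \<in> W"
      by (rule WI)
    moreover have "M.fox \<one>\<^bsub>F\<^esub> = 0"
      by (simp add: one_free_group)
    ultimately show ?thesis
      by (simp only: M.shift_zero diff_self)
  qed
  \<comment> \<open>The elements acting trivially on \<open>U / W\<close>. They form a subgroup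
    containing \<open>C\<close>, hence all powers of \<open>C\<close>, negative ones
    included.\<close>
  define T where "T = {g \<in> L. \<forall>f \<in> U. M.shift g f - f \<in> W}"
  have U_edges: "M.supp f \<subseteq> M.edges" if "f \<in> U" for f
    using that U_fin M.fin_chains_edges by blast
  have T_sub: "subgroup T F"
  proof (rule F.subgroupI)
    show "T \<subseteq> carrier F"
      using L_car by (auto simp: T_def)
    have "\<one>\<^bsub>F\<^esub> \<in> T"
      unfolding T_def using zero_W subgroup.one_closed[OF L] by (auto simp: M.shift_one[OF U_edges])
    then show "T \<noteq> {}"
      by blast
    fix a
    assume a: "a \<in> T"
    then have aL: "a \<in> L" "inv\<^bsub>F\<^esub> a \<in> L"
      using subgroup.m_inv_closed[OF L] by (auto simp: T_def)
    have "M.shift (inv\<^bsub>F\<^esub> a) f - f \<in> W" if f: "f \<in> U" for f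
    proof -
      define e where "e = M.shift (inv\<^bsub>F\<^esub> a) f"
      have e: "e \<in> U"
        unfolding e_def using U_shift[OF aL(2) f] .
      have "M.shift a e = f"
        unfolding e_def using L_car[OF aL(1)] by (simp add: M.shift_mult M.shift_one[OF U_edges[OF f]])
      then have "e - f = - (M.shift a e - e)"
        by (simp only: minus_diff_eq)
      moreover have "M.shift a e - e \<in> W"
        using a e by (auto simp: T_def)
      ultimately show ?thesis
        using W_uminus unfolding e_def by (simp only:)
    qed
    then show "inv\<^bsub>F\<^esub> a \<in> T"
      using aL by (simp add: T_def)
    fix b
    assume b: "b \<in> T"
    then have bL: "b \<in> L"
      by (simp add: T_def)
    have "M.shift (a \<otimes>\<^bsub>F\<^esub> b) f - f \<in> W" if f: "f \<in> U" for f
    proof -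
      have "M.shift (a \<otimes>\<^bsub>F\<^esub> b) f - f = (M.shift a (M.shift b f) - M.shift b f) + (M.shift b f - f)"
        using L_car[OF aL(1)] L_car[OF bL] by (simp add: M.shift_mult)
      moreover have "M.shift a (M.shift b f) - M.shift b f \<in> W" "M.shift b f - f \<in> W"
        using a b f U_shift[OF bL f] by (auto simp: T_def)
      ultimately show ?thesis
        using W_add by (simp only:)
    qed
    then show "a \<otimes>\<^bsub>F\<^esub> b \<in> T"
      using aL bL subgroup.m_closed[OF L] by (simp add: T_def)
  qed
  have CT: "C \<in> T"
    using C WI by (simp add: T_def)
  have pow_T: "C [^]\<^bsub>F\<^esub> (i::int) \<in> T" for i
    using F.subgroup_int_pow_closed[OF T_sub CT] .
  have pow_L: "C [^]\<^bsub>F\<^esub> (i::int) \<in> L" for i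
    using pow_T by (simp add: T_def)
  have C_car: "C \<in> carrier F"
    using C by (rule L_car)
  have W_shift: "M.shift (C [^]\<^bsub>F\<^esub> (i::int)) f \<in> W" if f: "f \<in> W" for i f
  proof -
    obtain e where e: "e \<in> U" "f = M.shift C e - e"
      using f by (auto simp: W_def)
    have "C [^]\<^bsub>F\<^esub> i \<otimes>\<^bsub>F\<^esub> C = C \<otimes>\<^bsub>F\<^esub> C [^]\<^bsub>F\<^esub> i"
      using C_car F.int_pow_mult[of C i 1] F.int_pow_mult[of C 1 i] by (simp add: F.int_pow_1 add.commute)
    then have "M.shift (C [^]\<^bsub>F\<^esub> i) f = M.shift C (M.shift (C [^]\<^bsub>F\<^esub> i) e) - M.shift (C [^]\<^bsub>F\<^esub> i) e"
      using C_car unfolding e M.shift_diff by (simp add: M.shift_mult)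
    then show ?thesis
      using WI[OF U_shift[OF pow_L e(1)]] by (simp only:)
  qed
  have comm_fox: "F.comm g g' \<in> N \<and> M.fox (F.comm g g') \<in> W" if g: "g \<in> L" "g' \<in> L" for g g'
  proof -
    obtain i :: int and n where n: "n \<in> N" "g = C [^]\<^bsub>F\<^esub> i \<otimes>\<^bsub>F\<^esub> n"
      using cyc[OF g(1)] by (auto simp: N_def)
    obtain j :: int and m where m: "m \<in> N" "g' = C [^]\<^bsub>F\<^esub> j \<otimes>\<^bsub>F\<^esub> m"
      using cyc[OF g(2)] by (auto simp: N_def)
    define x where "x = C [^]\<^bsub>F\<^esub> i"
    define y where "y = C [^]\<^bsub>F\<^esub> j"
    have xy: "x \<in> carrier F" "y \<in> carrier F" "x \<otimes>\<^bsub>F\<^esub> y = y \<otimes>\<^bsub>F\<^esub> x"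
      using C_car F.int_pow_mult[of C i j] F.int_pow_mult[of C j i] by (simp_all add: x_def y_def add.commute)
    have xyL: "x \<in> L" "y \<in> L" "inv\<^bsub>F\<^esub> x \<in> L" "inv\<^bsub>F\<^esub> y \<in> L"
      using pow_L subgroup.m_inv_closed[OF L] by (simp_all add: x_def y_def)
    have nm: "n \<in> carrier F" "m \<in> carrier F"
      using n m N_car by auto
    \<comment> \<open>Moving the powers of \<open>C\<close> to the front writes both
      \<open>g g'\<close> and \<open>g' g\<close> as \<open>x y\<close> times an element of
      \<open>N\<close>. So \<open>[g, g']\<close> is the conjugate of \<open>t\<close> by a power of
      \<open>C\<close>, and the chain of \<open>t\<close> is
      \<open>(y^-1 - 1) (fox n) - (x^-1 - 1) (fox m)\<close>.\<close>
    define n' where "n' = inv\<^bsub>F\<^esub> y \<otimes>\<^bsub>F\<^esub> n \<otimes>\<^bsub>F\<^esub> y"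
    define m' where "m' = inv\<^bsub>F\<^esub> x \<otimes>\<^bsub>F\<^esub> m \<otimes>\<^bsub>F\<^esub> x"
    have n'N: "n' \<in> N" and m'N: "m' \<in> N"
      using N_conj[OF xyL(4) n(1)] N_conj[OF xyL(3) m(1)] xy by (simp_all add: n'_def m'_def)
    have fox_n': "M.fox n' = M.shift (inv\<^bsub>F\<^esub> y) (M.fox n)" and fox_m': "M.fox m' = M.shift (inv\<^bsub>F\<^esub> x) (M.fox m)"
      using M.fox_conj_K[of "inv\<^bsub>F\<^esub> y" n] M.fox_conj_K[of "inv\<^bsub>F\<^esub> x" m] N_K[OF n(1)] N_K[OF m(1)] xy
      by (simp_all add: n'_def m'_def)
    define t where "t = (n' \<otimes>\<^bsub>F\<^esub> m) \<otimes>\<^bsub>F\<^esub> inv\<^bsub>F\<^esub> (m' \<otimes>\<^bsub>F\<^esub> n)"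
    have t: "t \<in> N"
      unfolding t_def by (intro subgroup.m_closed[OF N_sub] subgroup.m_inv_closed[OF N_sub] n'N m'N n m)
    have cancel: "y \<otimes>\<^bsub>F\<^esub> (inv\<^bsub>F\<^esub> y \<otimes>\<^bsub>F\<^esub> s) = s" "x \<otimes>\<^bsub>F\<^esub> (inv\<^bsub>F\<^esub> x \<otimes>\<^bsub>F\<^esub> s) = s" if "s \<in> carrier F" for s
      using xy that by (simp_all flip: F.m_assoc)
    have gg': "g \<otimes>\<^bsub>F\<^esub> g' = (x \<otimes>\<^bsub>F\<^esub> y) \<otimes>\<^bsub>F\<^esub> (n' \<otimes>\<^bsub>F\<^esub> m)"
      unfolding n(2) m(2) x_def[symmetric] y_def[symmetric] n'_def
      using xy(1,2) nm by (simp add: F.m_assoc cancel)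
    have g'g: "g' \<otimes>\<^bsub>F\<^esub> g = (x \<otimes>\<^bsub>F\<^esub> y) \<otimes>\<^bsub>F\<^esub> (m' \<otimes>\<^bsub>F\<^esub> n)"
      unfolding n(2) m(2) x_def[symmetric] y_def[symmetric] m'_def xy(3)
      using xy(1,2) nm by (simp add: F.m_assoc cancel)
    have car: "g \<in> carrier F" "g' \<in> carrier F" "n' \<in> carrier F" "m' \<in> carrier F"
      using g L_car n'N m'N N_car by auto
    have "F.comm g g' = (g \<otimes>\<^bsub>F\<^esub> g') \<otimes>\<^bsub>F\<^esub> inv\<^bsub>F\<^esub> (g' \<otimes>\<^bsub>F\<^esub> g)"
      using car by (simp add: F.comm_def F.inv_mult_group F.m_assoc)
    also have "\<dots> = (x \<otimes>\<^bsub>F\<^esub> y) \<otimes>\<^bsub>F\<^esub> t \<otimes>\<^bsub>F\<^esub> inv\<^bsub>F\<^esub> (x \<otimes>\<^bsub>F\<^esub> y)"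
      unfolding gg' g'g t_def using xy(1,2) car nm by (simp add: F.inv_mult_group F.m_assoc)
    finally have comm: "F.comm g g' = (x \<otimes>\<^bsub>F\<^esub> y) \<otimes>\<^bsub>F\<^esub> t \<otimes>\<^bsub>F\<^esub> inv\<^bsub>F\<^esub> (x \<otimes>\<^bsub>F\<^esub> y)" .
    have xy_pow: "x \<otimes>\<^bsub>F\<^esub> y = C [^]\<^bsub>F\<^esub> (i + j)"
      using C_car by (simp add: x_def y_def F.int_pow_mult)
    have "M.fox t = (M.fox n' + M.fox m) - (M.fox m' + M.fox n)"
    proof -
      have "M.fox t = M.fox (n' \<otimes>\<^bsub>F\<^esub> m) + M.fox (inv\<^bsub>F\<^esub> (m' \<otimes>\<^bsub>F\<^esub> n))"
        unfolding t_def using n'N m'N n(1) m(1) subgroup.m_closed[OF N_sub] car nm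
        by (intro M.fox_mult_K N_K) auto
      moreover have "M.fox (n' \<otimes>\<^bsub>F\<^esub> m) = M.fox n' + M.fox m" "M.fox (m' \<otimes>\<^bsub>F\<^esub> n) = M.fox m' + M.fox n"
        using n'N m'N nm N_K by (simp_all add: M.fox_mult_K)
      moreover have "M.fox (inv\<^bsub>F\<^esub> (m' \<otimes>\<^bsub>F\<^esub> n)) = - M.fox (m' \<otimes>\<^bsub>F\<^esub> n)"
        using subgroup.m_closed[OF N_sub m'N n(1)] by (intro M.fox_inv_K N_K)
      ultimately show ?thesis
        by (simp only: add_uminus_conv_diff)
    qed
    also have "\<dots> = (M.shift (inv\<^bsub>F\<^esub> y) (M.fox n) - M.fox n) + - (M.shift (inv\<^bsub>F\<^esub> x) (M.fox m) - M.fox m)"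
      unfolding fox_n' fox_m' by (rule ext) simp
    also have "\<dots> \<in> W"
    proof (intro W_add W_uminus)
      have "inv\<^bsub>F\<^esub> x \<in> T" "inv\<^bsub>F\<^esub> y \<in> T"
        using pow_T subgroup.m_inv_closed[OF T_sub] by (simp_all add: x_def y_def)
      then show "M.shift (inv\<^bsub>F\<^esub> y) (M.fox n) - M.fox n \<in> W" "M.shift (inv\<^bsub>F\<^esub> x) (M.fox m) - M.fox m \<in> W"
        using n m by (auto simp: T_def U_def)
    qed
    finally have "M.shift (C [^]\<^bsub>F\<^esub> (i + j)) (M.fox t) \<in> W"
      by (rule W_shift)
    moreover have "M.fox (F.comm g g') = M.shift (C [^]\<^bsub>F\<^esub> (i + j)) (M.fox t)"
      unfolding comm xy_pow using C_car N_K[OF t] by (intro M.fox_conj_K) auto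
    moreover have "F.comm g g' \<in> N"
      unfolding comm using N_conj[OF _ t] pow_L xy_pow by simp
    ultimately show ?thesis
      by simp
  qed
  have derived_fox: "M.fox w \<in> W" if w: "w \<in> derived F L" for w
  proof -
    have "subgroup {w \<in> N. M.fox w \<in> W} F"
    proof (rule F.subgroupI)
      show "{w \<in> N. M.fox w \<in> W} \<subseteq> carrier F"
        using N_car by blast
      have "\<one>\<^bsub>F\<^esub> \<in> {w \<in> N. M.fox w \<in> W}"
        using subgroup.one_closed[OF N_sub] zero_W by (simp add: one_free_group)
      then show "{w \<in> N. M.fox w \<in> W} \<noteq> {}"
        by blast
      fix a
      assume a: "a \<in> {w \<in> N. M.fox w \<in> W}"
      then show "inv\<^bsub>F\<^esub> a \<in> {w \<in> N. M.fox w \<in> W}"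
        using M.fox_inv_K[OF N_K] W_uminus subgroup.m_inv_closed[OF N_sub] by auto
      fix b
      assume "b \<in> {w \<in> N. M.fox w \<in> W}"
      then show "a \<otimes>\<^bsub>F\<^esub> b \<in> {w \<in> N. M.fox w \<in> W}"
        using a M.fox_mult_K[OF N_K N_car] W_add subgroup.m_closed[OF N_sub] by auto
    qed
    moreover have "derived_set F L \<subseteq> {w \<in> N. M.fox w \<in> W}"
      using comm_fox by (auto simp: F.comm_def)
    ultimately have "derived F L \<subseteq> {w \<in> N. M.fox w \<in> W}"
      unfolding derived_def using F.generate_subgroup_incl by blast
    then show ?thesis
      using w by blast
  qed
  \<comment> \<open>\<open>w\<close> lies in \<open>F'\<close>, so \<open>\<psi> w\<close> lies in
    \<open>derived F L\<close>, whose chains are in \<open>W\<close>; and since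
    \<open>k < d\<close>, \<open>\<psi> w\<close> has the same chain as \<open>w\<close>.\<close>
  have U_W: "f \<in> W" if f: "f \<in> U" for f
  proof -
    obtain w where w: "w \<in> N" "f = M.fox w"
      using f by (auto simp: U_def)
    obtain \<psi> where \<psi>: "\<psi> \<in> hom F F" "\<And>x. x \<in> carrier F \<Longrightarrow> \<psi> x \<in> L" "K d #>\<^bsub>F\<^esub> \<psi> w = K d #>\<^bsub>F\<^esub> w"
      using fixes_eachD[OF fixed, of w] w by (auto simp: N_def)
    have "\<psi> w \<in> (derived F ^^ 1) L"
      using \<psi>(2) w(1) by (intro hom_derived[OF \<psi>(1), of "carrier F"]) (auto simp: N_def K_def)
    then have "M.fox (\<psi> w) \<in> W"
      using derived_fox by simp
    moreover have "M.fox (\<psi> w) = M.fox w"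
    proof -
      have "K (Suc k) #>\<^bsub>F\<^esub> \<psi> w = K (Suc k) #>\<^bsub>F\<^esub> w"
        using k(2) \<psi>(3) L_car[OF \<psi>(2)[OF N_car[OF w(1)]]] N_car[OF w(1)] by (intro rcos_mono[of "Suc k" d]) auto
      then show ?thesis
        using M.rcos_derived_iff_fox[OF hom_K[OF \<psi>(1) N_K[OF w(1)]] N_K[OF w(1)]] by (simp add: K_Suc)
    qed
    ultimately show ?thesis
      using w(2) by simp
  qed
  have U_zero: "f = 0" if f: "f \<in> U" for f
    using C1
  proof
    assume "lin c C = 1"
    then show ?thesis
      using U_W by (intro M.divisible_imp_zero[OF level_lin[OF k(1)] C_car _ U_fin _ f]) (auto simp: W_def)
  next
    assume one: "C = \<one>\<^bsub>F\<^esub>"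
    obtain e where "e \<in> U" "f = M.shift C e - e"
      using U_W[OF f] by (auto simp: W_def)
    then show ?thesis
      unfolding one using M.shift_one[OF U_edges] by (simp only: diff_self)
  qed
  show ?thesis
  proof
    fix w
    assume "w \<in> L \<inter> K 1"
    then have w: "w \<in> N"
      by (simp add: N_def)
    have "M.fox w = 0"
      by (rule U_zero) (use w in \<open>simp add: U_def\<close>)
    then show "w \<in> K (Suc k)"
      using M.derived_iff_fox[OF N_K[OF w]] by (simp add: K_Suc)
  qed
qed

text \<open>Once \<open>L \<inter> K 1\<close> vanishes modulo \<open>K d\<close>, the image of
  \<open>L\<close> is generated by that of \<open>C\<close>, and
  \<open>w \<mapsto> C^(lin c w)\<close> is the retraction. The case \<open>C = \<one>\<close> is
  that of a trivial image.\<close>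

lemma rank_one:
  assumes L: "subgroup L F" and C: "C \<in> L" and fixed: "fixes_each d L" and d: "d \<ge> 1"
    and cyc: "\<And>h. h \<in> L \<Longrightarrow> \<exists>(i::int) n. n \<in> L \<inter> K 1 \<and> h = C [^]\<^bsub>F\<^esub> i \<otimes>\<^bsub>F\<^esub> n"
    and C1: "lin c C = 1 \<or> C = \<one>\<^bsub>F\<^esub>"
  shows "retractable d L"
proof -
  have "L \<inter> K 1 \<subseteq> K k" if "1 \<le> k" "k \<le> d" for k
    using that
  proof (induction k rule: dec_induct)
    case base
    show ?case by blast
  next
    case (step k)
    have "L \<inter> K 1 \<subseteq> K k"
      using step.IH step.prems by simp
    then show ?case
      using step.hyps step.prems by (intro cyclic_layer_trivial[OF L C fixed cyc C1]) simp_all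
  qed
  then have L1: "L \<inter> K 1 \<subseteq> K d"
    using d by simp
  have C_car: "C \<in> carrier F"
    using C subgroup.mem_carrier[OF L] by blast
  define \<psi> where "\<psi> w = C [^]\<^bsub>F\<^esub> lin c w" for w
  have "\<psi> \<in> hom F F"
    using C_car by (intro homI) (simp_all add: \<psi>_def lin_mult F.int_pow_mult)
  moreover have "\<psi> x \<in> L" for x
    unfolding \<psi>_def using F.subgroup_int_pow_closed[OF L C] .
  moreover have "K d #>\<^bsub>F\<^esub> \<psi> h = K d #>\<^bsub>F\<^esub> h" if h: "h \<in> L" for h
  proof -
    obtain i :: int and n where n: "n \<in> L \<inter> K 1" "h = C [^]\<^bsub>F\<^esub> i \<otimes>\<^bsub>F\<^esub> n"
      using cyc[OF h] by blast
    have n_car: "n \<in> carrier F"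
      using n(1) K_carrier by blast
    have "lin c h = i * lin c C"
      using n C_car n_car lin_K[of 1 n c] by (simp add: lin_mult lin_int_pow)
    then have \<psi>h: "\<psi> h = C [^]\<^bsub>F\<^esub> i"
      using C1 by (auto simp: \<psi>_def F.int_pow_one)
    then have "\<psi> h \<otimes>\<^bsub>F\<^esub> inv\<^bsub>F\<^esub> h = C [^]\<^bsub>F\<^esub> i \<otimes>\<^bsub>F\<^esub> inv\<^bsub>F\<^esub> n \<otimes>\<^bsub>F\<^esub> inv\<^bsub>F\<^esub> (C [^]\<^bsub>F\<^esub> i)"
      using n C_car n_car by (simp add: F.inv_mult_group F.m_assoc)
    also have "\<dots> \<in> K d"
      using n(1) L1 C_car subgroup.m_inv_closed[OF K_subgroup] by (intro K_conj) auto
    finally show ?thesis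
      using normal.rcos_eq_iff[OF K_normal] n C_car n_car \<psi>h by simp
  qed
  ultimately show ?thesis
    using subgroup.subset[OF L] by (intro retractableI[of \<psi>])
qed

text \<open>\<open>c1\<close> and \<open>c2\<close> are the coordinates of a projection of the
  abelianization onto the image of \<open>L\<close>, and \<open>\<psi>\<close> lifts this projection
  to \<open>F\<close>.\<close>

lemma rank_two_abelian:
  assumes A: "A \<in> carrier F" and B: "B \<in> carrier F" and L: "subgroup L F" "A \<in> L" "B \<in> L"
    and expo_L: "\<And>h i. h \<in> L \<Longrightarrow> expo i h = lin c1 h * expo i A + lin c2 h * expo i B"
  shows "retractable 1 L"
proof -
  define \<psi> where "\<psi> = word_eval F (\<lambda>i. A [^]\<^bsub>F\<^esub> c1 i \<otimes>\<^bsub>F\<^esub> B [^]\<^bsub>F\<^esub> c2 i)"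
  have gen_L: "A [^]\<^bsub>F\<^esub> (i::int) \<otimes>\<^bsub>F\<^esub> B [^]\<^bsub>F\<^esub> (j::int) \<in> L" for i j
    using L F.subgroup_int_pow_closed[OF L(1)] subgroup.m_closed[OF L(1)] by blast
  have \<psi>: "\<psi> \<in> hom F F"
    unfolding \<psi>_def using A B by (intro F.word_eval_hom) simp
  have "\<psi> x \<in> L" if "x \<in> carrier F" for x
    unfolding \<psi>_def using that gen_L
    by (intro F.word_eval_in_subgroup[OF L(1), of r]) (auto simp: carrier_free_group)
  moreover have "K 1 #>\<^bsub>F\<^esub> \<psi> h = K 1 #>\<^bsub>F\<^esub> h" if h: "h \<in> L" for h
  proof -
    have h_car: "h \<in> carrier F"
      using h subgroup.mem_carrier[OF L(1)] by blast
    have \<psi>h: "\<psi> h \<in> carrier F"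
      using \<psi> h_car by (auto simp: hom_def)
    have "expo j (\<psi> h) = expo j h" for j
    proof -
      have "expo j (\<psi> (free_gen i)) = c1 i * expo j A + c2 i * expo j B" if "i < r" for i
      proof -
        have "\<psi> (free_gen i) = A [^]\<^bsub>F\<^esub> c1 i \<otimes>\<^bsub>F\<^esub> B [^]\<^bsub>F\<^esub> c2 i"
          using A B by (simp add: \<psi>_def free_gen_def letter_val_def)
        then show ?thesis
          using A B by (simp add: expo_mult expo_int_pow)
      qed
      then have "expo j (\<psi> h) = lin c1 h * expo j A + lin c2 h * expo j B"
        unfolding expo_hom[OF \<psi> h_car]
        by (simp add: lin_def sum_distrib_left sum.distrib algebra_simps)
      then show ?thesis
        using expo_L[OF h] by simp
    qed
    then have "\<psi> h \<otimes>\<^bsub>F\<^esub> inv\<^bsub>F\<^esub> h \<in> K 1"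
      unfolding K_1_iff_expo using h_car \<psi>h by (simp add: expo_mult expo_inv)
    then show ?thesis
      using normal.rcos_eq_iff[OF K_normal] h_car \<psi>h by blast
  qed
  ultimately show ?thesis
    using \<psi> subgroup.subset[OF L(1)] by (intro retractableI[of \<psi>])
qed

section \<open>Generators adapted to the abelianization\<close>

lemma expo_generate:
  assumes "A \<in> carrier F" "B \<in> carrier F" "h \<in> generate F {A, B}"
  shows "\<exists>p q. \<forall>i. expo i h = p * expo i A + q * expo i B"
  using assms(3)
proof (induction rule: generate.induct)
  case one
  show ?case
    by (intro exI[of _ 0]) (simp add: one_free_group)
next
  case (incl h)
  then consider "h = A" | "h = B" by blast
  then show ?case
  proof cases
    case 1
    then show ?thesis by (intro exI[of _ 1] exI[of _ 0]) simp
  next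
    case 2
    then show ?thesis by (intro exI[of _ 0] exI[of _ 1]) simp
  qed
next
  case (inv h)
  then consider "h = A" | "h = B" by blast
  then show ?case
  proof cases
    case 1
    then show ?thesis using assms by (intro exI[of _ "-1"] exI[of _ 0]) (simp add: expo_inv)
  next
    case 2
    then show ?thesis using assms by (intro exI[of _ 0] exI[of _ "-1"]) (simp add: expo_inv)
  qed
next
  case (eng h1 h2)
  obtain p1 q1 where 1: "expo i h1 = p1 * expo i A + q1 * expo i B" for i
    using eng.IH(1) by blast
  obtain p2 q2 where 2: "expo i h2 = p2 * expo i A + q2 * expo i B" for i
    using eng.IH(2) by blast
  have car: "h1 \<in> carrier F" "h2 \<in> carrier F"
    using eng.hyps F.generate_in_carrier[of "{A, B}"] assms(1,2) by auto
  have "\<forall>i. expo i (h1 \<otimes>\<^bsub>F\<^esub> h2) = (p1 + p2) * expo i A + (q1 + q2) * expo i B"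
    using car by (simp add: expo_mult 1 2 algebra_simps)
  then show ?case by blast
qed

text \<open>Abelianizing \<open>\<psi> V = V\<close> expresses \<open>V\<close> through the generators of \<open>L\<close> with coefficients that are
  linear functionals evaluated at \<open>V\<close>; this replaces purity of the image of \<open>L\<close>.\<close>

lemma fixes_each_lin:
  assumes A: "A \<in> carrier F" and B: "B \<in> carrier F" and fixed: "fixes_each d (generate F {A, B})"
    and d: "d \<ge> 1" and V: "V \<in> generate F {A, B}"
  obtains P Q where "\<And>j. expo j V = lin P V * expo j A + lin Q V * expo j B"
proof -
  obtain \<psi> where \<psi>: "\<psi> \<in> hom F F" "\<And>x. x \<in> carrier F \<Longrightarrow> \<psi> x \<in> generate F {A, B}"
    "K d #>\<^bsub>F\<^esub> \<psi> V = K d #>\<^bsub>F\<^esub> V"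
    using fixes_eachD[OF fixed V] by blast
  have V_car: "V \<in> carrier F"
    using V F.generate_in_carrier[of "{A, B}"] A B by auto
  have "\<psi> V \<in> carrier F"
    using \<psi>(1) V_car by (auto simp: hom_def)
  have "\<forall>i. \<exists>p q. i < r \<longrightarrow> (\<forall>j. expo j (\<psi> (free_gen i)) = p * expo j A + q * expo j B)"
    using expo_generate[OF A B \<psi>(2)[OF free_gen_carrier]] by blast
  then obtain P Q where PQ: "expo j (\<psi> (free_gen i)) = P i * expo j A + Q i * expo j B" if "i < r" for i j
    by metis
  have "expo j V = lin P V * expo j A + lin Q V * expo j B" for j
  proof -
    have "expo j V = expo j (\<psi> V)"
      using rcos_expo[OF d \<psi>(3) \<open>\<psi> V \<in> carrier F\<close> V_car] by simp
    also have "\<dots> = (\<Sum>i<r. expo i V * (P i * expo j A + Q i * expo j B))"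
      unfolding expo_hom[OF \<psi>(1) V_car] using PQ by (intro sum.cong) auto
    also have "\<dots> = lin P V * expo j A + lin Q V * expo j B"
      by (simp add: lin_def sum_distrib_left sum.distrib algebra_simps)
    finally show ?thesis .
  qed
  then show ?thesis
    by (rule that)
qed

lemma retractable_dependent:
  assumes A: "A \<in> carrier F" and B: "B \<in> carrier F" and L: "L = generate F {A, B}"
    and fixed: "fixes_each d L" and d: "d \<ge> 1"
    and dep: "\<And>i. m * expo i A + n * expo i B = 0" "m \<noteq> 0 \<or> n \<noteq> 0"
  shows "retractable d L"
proof -
  have L_sub: "subgroup L F"
    unfolding L using A B by (intro F.generate_is_subgroup) simp
  have AL: "A \<in> L" and BL: "B \<in> L"
    unfolding L by (auto intro: generate.incl)
  define g where "g = gcd m n"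
  have g: "g \<noteq> 0"
    using dep(2) by (simp add: g_def)
  obtain m' n' where mn: "m = g * m'" "n = g * n'"
    unfolding g_def by (meson dvd_def gcd_dvd1 gcd_dvd2)
  obtain s t where "s * m + t * n = g"
    using bezout_int[of m n] by (auto simp: g_def)
  then have "g * (s * m' + t * n') = g * 1"
    unfolding mn by (simp add: algebra_simps)
  then have st: "s * m' + t * n' = 1"
    using g by (simp only: mult_cancel_left) simp
  have dep': "m' * expo i A = - (n' * expo i B)" for i
  proof -
    have "g * (m' * expo i A + n' * expo i B) = 0"
      using dep(1)[of i] unfolding mn by (simp add: algebra_simps)
    then show ?thesis
      using g by simp
  qed
  \<comment> \<open>Modulo \<open>F'\<close> one wants \<open>A = n' C\<close> and
    \<open>B = - m' C\<close>; with \<open>s * m' + t * n' = 1\<close> this forces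
    \<open>C = t A - s B\<close>.\<close>
  define C where "C = A [^]\<^bsub>F\<^esub> t \<otimes>\<^bsub>F\<^esub> B [^]\<^bsub>F\<^esub> (- s)"
  have C_car: "C \<in> carrier F"
    using A B by (simp add: C_def)
  have CL: "C \<in> L"
    unfolding C_def using F.subgroup_int_pow_closed[OF L_sub] AL BL subgroup.m_closed[OF L_sub] by blast
  have expo_C: "expo i C = t * expo i A - s * expo i B" for i
    using A B by (simp add: C_def expo_mult[of _ r] expo_int_pow)
  have expo_A: "expo i A = n' * expo i C" for i
  proof -
    have "n' * expo i C = (t * n') * expo i A + s * (m' * expo i A)"
      by (simp add: expo_C dep' algebra_simps)
    also have "\<dots> = (s * m' + t * n') * expo i A"
      by (simp add: algebra_simps)
    finally show ?thesis by (simp add: st)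
  qed
  have expo_B: "expo i B = - m' * expo i C" for i
  proof -
    have "- m' * expo i C = (s * m') * expo i B - t * (m' * expo i A)"
      by (simp add: expo_C algebra_simps)
    also have "\<dots> = (s * m' + t * n') * expo i B"
      unfolding dep' by (simp add: algebra_simps)
    finally show ?thesis by (simp add: st)
  qed
  have expo_L: "\<exists>k. \<forall>i. expo i h = k * expo i C" if h: "h \<in> L" for h
  proof -
    obtain p q where pq: "\<forall>i. expo i h = p * expo i A + q * expo i B"
      using expo_generate[OF A B] h L by blast
    have "expo i h = (p * n' - q * m') * expo i C" for i
      using pq expo_A[of i] expo_B[of i] by (simp add: algebra_simps)
    then show ?thesis by blast
  qed
  have cyc: "\<exists>(i::int) n. n \<in> L \<inter> K 1 \<and> h = C' [^]\<^bsub>F\<^esub> i \<otimes>\<^bsub>F\<^esub> n"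
    if h: "h \<in> L" and C': "C' \<in> L" "\<forall>i. expo i C' = expo i C" for h C'
  proof -
    obtain k where k: "\<forall>i. expo i h = k * expo i C"
      using expo_L[OF h] by blast
    have car: "h \<in> carrier F" "C' \<in> carrier F"
      using h C' subgroup.mem_carrier[OF L_sub] by auto
    define w where "w = inv\<^bsub>F\<^esub> (C' [^]\<^bsub>F\<^esub> k) \<otimes>\<^bsub>F\<^esub> h"
    have "w \<in> L"
      unfolding w_def using h F.subgroup_int_pow_closed[OF L_sub C'(1)]
      by (intro subgroup.m_closed[OF L_sub] subgroup.m_inv_closed[OF L_sub])
    moreover have "w \<in> K 1"
      unfolding K_1_iff_expo using car k C'(2) by (simp add: w_def expo_mult expo_inv expo_int_pow)
    moreover have "h = C' [^]\<^bsub>F\<^esub> k \<otimes>\<^bsub>F\<^esub> w"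
      using car by (simp add: w_def flip: F.m_assoc)
    ultimately show ?thesis by blast
  qed
  show ?thesis
  proof (cases "\<forall>i. expo i C = 0")
    case True
    \<comment> \<open>Here \<open>L\<close> lies in \<open>K 1\<close>, so the unit can serve as
      cyclic generator.\<close>
    have one: "\<one>\<^bsub>F\<^esub> \<in> L" "\<forall>i. expo i \<one>\<^bsub>F\<^esub> = expo i C"
      using subgroup.one_closed[OF L_sub] True by (simp_all add: one_free_group)
    show ?thesis
      by (rule rank_one[OF L_sub one(1) fixed d cyc[OF _ one], of "\<lambda>_. 0"]) auto
  next
    case False
    then obtain j where j: "expo j C \<noteq> 0" by blast
    obtain \<psi> where \<psi>: "\<psi> \<in> hom F F" "\<And>x. x \<in> carrier F \<Longrightarrow> \<psi> x \<in> L"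
      "K d #>\<^bsub>F\<^esub> \<psi> C = K d #>\<^bsub>F\<^esub> C"
      using fixes_eachD[OF fixed CL] by blast
    have "\<forall>i. \<exists>k. i < r \<longrightarrow> (\<forall>j. expo j (\<psi> (free_gen i)) = k * expo j C)"
      using expo_L[OF \<psi>(2)[OF free_gen_carrier]] by blast
    \<comment> \<open>\<open>c i\<close> is the coordinate of \<open>\<psi> (free_gen i)\<close>
      along \<open>C\<close>. As \<open>\<psi> C = C\<close> modulo \<open>F'\<close>, the
      functional takes the value 1 at \<open>C\<close>.\<close>
    then obtain c where c: "expo j (\<psi> (free_gen i)) = c i * expo j C" if "i < r" for i j
      by metis
    have "\<psi> C \<in> carrier F"
      using \<psi>(1) C_car by (auto simp: hom_def)
    then have "expo j C = expo j (\<psi> C)"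
      using rcos_expo[OF d \<psi>(3) _ C_car] by simp
    also have "\<dots> = (\<Sum>i<r. expo i C * (c i * expo j C))"
      unfolding expo_hom[OF \<psi>(1) C_car] using c by (intro sum.cong) auto
    also have "\<dots> = lin c C * expo j C"
      by (simp add: lin_def sum_distrib_left algebra_simps)
    finally have "lin c C = 1"
      using j by simp
    then show ?thesis
      by (intro rank_one[OF L_sub CL fixed d cyc[OF _ CL], of c]) auto
  qed
qed

text \<open>The point is to find a dual basis: functionals with values 1, 0 and 0, 1 at the two
  generators. \<open>fixes_each_lin\<close> yields a functional with value 1 at a given generator; a
  shear of \<open>B\<close> by a power of \<open>A\<close> and a correction of the second functional
  remove the mixed values.\<close>

lemma retractable_independent:
  assumes A: "A \<in> carrier F" and B: "B \<in> carrier F" and L: "L = generate F {A, B}"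
    and fixed: "fixes_each d L" and d: "d \<ge> 1"
    and indep: "\<And>m n. (\<And>i. m * expo i A + n * expo i B = 0) \<Longrightarrow> m = 0 \<and> n = 0"
  shows "retractable d L"
proof -
  have AL: "A \<in> generate F {A, B}" and BL: "B \<in> generate F {A, B}"
    by (auto intro: generate.incl)
  obtain P Q where PQ: "\<And>j. expo j A = lin P A * expo j A + lin Q A * expo j B"
    using fixes_each_lin[OF A B fixed[unfolded L] d AL] by blast
  have "lin P A - 1 = 0 \<and> lin Q A = 0"
  proof (rule indep)
    show "(lin P A - 1) * expo i A + lin Q A * expo i B = 0" for i
      using PQ[of i] by (simp add: algebra_simps)
  qed
  then have P: "lin P A = 1"
    by simp
  define k where "k = lin P B"
  define B' where "B' = B \<otimes>\<^bsub>F\<^esub> A [^]\<^bsub>F\<^esub> (- k)"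
  have B'_car: "B' \<in> carrier F"
    using A B by (simp add: B'_def)
  have expo_B': "expo i B' = expo i B - k * expo i A" for i
    using A B by (simp add: B'_def expo_mult[of _ r] expo_int_pow)
  have PB': "lin P B' = 0"
    using A B P by (simp add: B'_def lin_mult lin_int_pow k_def)
  have sub: "subgroup (generate F {A, B}) F" "subgroup (generate F {A, B'}) F"
    using A B B'_car by (auto intro!: F.generate_is_subgroup)
  have "B' \<in> generate F {A, B}"
    unfolding B'_def using F.subgroup_int_pow_closed[OF sub(1) AL] subgroup.m_closed[OF sub(1) BL] by blast
  moreover have "B \<in> generate F {A, B'}"
  proof -
    have mem: "A \<in> generate F {A, B'}" "B' \<in> generate F {A, B'}"
      by (auto intro: generate.incl)
    have "B = B' \<otimes>\<^bsub>F\<^esub> A [^]\<^bsub>F\<^esub> k"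
      using A B by (simp add: B'_def F.int_pow_neg F.m_assoc)
    then show ?thesis
      using F.subgroup_int_pow_closed[OF sub(2) mem(1), of k] subgroup.m_closed[OF sub(2) mem(2)] by simp
  qed
  ultimately have "{A, B'} \<subseteq> generate F {A, B}" "{A, B} \<subseteq> generate F {A, B'}"
    using AL by (auto intro: generate.incl)
  then have L': "L = generate F {A, B'}"
    unfolding L using F.generate_subgroup_incl[OF _ sub(1)] F.generate_subgroup_incl[OF _ sub(2)] by blast
  have BL': "B' \<in> generate F {A, B'}"
    by (auto intro: generate.incl)
  have indep': "m = 0 \<and> n = 0" if "\<And>i. m * expo i A + n * expo i B' = 0" for m n
  proof -
    have "m - n * k = 0 \<and> n = 0"
    proof (rule indep)
      show "(m - n * k) * expo i A + n * expo i B = 0" for i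
        using that[of i] by (simp add: expo_B' algebra_simps)
    qed
    then show ?thesis by simp
  qed
  \<comment> \<open>The endomorphism depends on the element that it fixes, so \<open>B'\<close>
    needs functionals of its own.\<close>
  obtain P' Q' where PQ': "\<And>j. expo j B' = lin P' B' * expo j A + lin Q' B' * expo j B'"
    using fixes_each_lin[OF A B'_car fixed[unfolded L'] d BL'] by blast
  have "lin P' B' = 0 \<and> lin Q' B' - 1 = 0"
  proof (rule indep')
    show "lin P' B' * expo i A + (lin Q' B' - 1) * expo i B' = 0" for i
      using PQ'[of i] by (simp add: algebra_simps)
  qed
  then have Q': "lin Q' B' = 1"
    by simp
  \<comment> \<open>Subtracting a multiple of \<open>P\<close> kills the value at \<open>A\<close>
    and leaves the value at \<open>B'\<close> alone, as \<open>lin P B' = 0\<close>.\<close>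
  define c where "c i = Q' i - lin Q' A * P i" for i
  have c: "lin c A = 0" "lin c B' = 1"
    unfolding c_def[abs_def] lin_diff using P PB' Q' by simp_all
  have L_sub: "subgroup L F"
    using sub(2) L' by simp
  have expo_L: "expo i h = lin P h * expo i A + lin c h * expo i B'" if h: "h \<in> L" for h i
  proof -
    obtain p q where pq: "\<forall>i. expo i h = p * expo i A + q * expo i B'"
      using expo_generate[OF A B'_car] h L' by blast
    have lin_h: "lin c h = p * lin c A + q * lin c B'" for c
      unfolding lin_def using pq by (simp add: sum_distrib_left sum.distrib algebra_simps)
    have "lin P h = p" "lin c h = q"
      using lin_h[of P] lin_h[of c] P PB' c by simp_all
    then show ?thesis
      using pq by simp
  qed
  show ?thesis
  proof (cases "d = 1")
    case True
    then show ?thesis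
      using rank_two_abelian[OF A B'_car L_sub _ _ expo_L] L' by (auto intro: generate.incl)
  next
    case False
    then have d2: "d = Suc (Suc (d - 2))"
      using d by simp
    show ?thesis
      by (subst d2, rule rank_two_solvable[OF A B'_car L' P PB' c expo_L]) (use fixed d2 in simp_all)
  qed
qed

lemma retractable_two_generated:
  assumes "A \<in> carrier F" "B \<in> carrier F" "L = generate F {A, B}" "fixes_each d L" "d \<ge> 1"
  shows "retractable d L"
proof (cases "\<exists>m n. (\<forall>i. m * expo i A + n * expo i B = 0) \<and> (m \<noteq> 0 \<or> n \<noteq> 0)")
  case True
  then show ?thesis
    using retractable_dependent[OF assms] by blast
next
  case False
  then show ?thesis
    using retractable_independent[OF assms] by blast
qed

text \<open>On \<open>L\<close> the map \<open>\<psi>\<close> is invertible modulo \<open>K d\<close> with inverse \<open>h \<mapsto> h (\<psi> h)\<^sup>-\<^sup>1 h\<close>;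
  composing it with \<open>\<psi>\<close> gives the retraction.\<close>

lemma retractable_imp_retraction:
  assumes L: "subgroup L F" and d: "d \<ge> 1" and retr: "retractable d L"
  obtains \<rho> where "\<rho> \<in> hom (F Mod K d) (F Mod K d)" "\<rho> ` carrier (F Mod K d) \<subseteq> (\<lambda>w. K d #>\<^bsub>F\<^esub> w) ` L"
    "\<And>h. h \<in> L \<Longrightarrow> \<rho> (K d #>\<^bsub>F\<^esub> h) = K d #>\<^bsub>F\<^esub> h"
proof -
  let ?G = "F Mod K d"
  obtain \<psi> where \<psi>: "\<psi> \<in> hom F F" "\<psi> ` carrier F \<subseteq> L"
    and id1: "\<And>h. h \<in> L \<Longrightarrow> K (d - 1) #>\<^bsub>F\<^esub> \<psi> h = K (d - 1) #>\<^bsub>F\<^esub> h"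
    and id2: "\<And>h. h \<in> L \<inter> K (d - 1) \<Longrightarrow> K d #>\<^bsub>F\<^esub> \<psi> h = K d #>\<^bsub>F\<^esub> h"
    using retr unfolding retractable_def by blast
  interpret \<psi>: group_hom F F \<psi>
    using \<psi>(1) by unfold_locales
  interpret N: normal "K d" F
    by (rule K_normal)
  define q where "q w = K d #>\<^bsub>F\<^esub> w" for w
  have q_hom: "q \<in> hom F ?G"
    unfolding q_def[abs_def] by (rule N.r_coset_hom_Mod)
  interpret G: group "?G"
    by (rule N.factorgroup_is_group)
  interpret q: group_hom F "?G" q
    using q_hom by unfold_locales
  have L_car: "h \<in> carrier F" if "h \<in> L" for h
    using that subgroup.mem_carrier[OF L] by blast
  have q_eq: "q x = q y \<longleftrightarrow> x \<otimes>\<^bsub>F\<^esub> inv\<^bsub>F\<^esub> y \<in> K d" if "x \<in> carrier F" "y \<in> carrier F" for x y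
    using N.rcos_eq_iff[OF that] by (simp add: q_def)
  have derived_K: "derived F (K (d - 1)) = K d"
    using d K_Suc[of "d - 1"] by simp
  have q_comm: "q (a \<otimes>\<^bsub>F\<^esub> b) = q (b \<otimes>\<^bsub>F\<^esub> a)" if "a \<in> K (d - 1)" "b \<in> K (d - 1)" for a b
  proof -
    have "F.comm a b \<in> K d"
      using F.comm_in_derived[OF that] unfolding derived_K .
    moreover have car: "a \<in> carrier F" "b \<in> carrier F"
      using that K_carrier by auto
    moreover have "F.comm a b = (a \<otimes>\<^bsub>F\<^esub> b) \<otimes>\<^bsub>F\<^esub> inv\<^bsub>F\<^esub> (b \<otimes>\<^bsub>F\<^esub> a)"
      using car by (simp add: F.comm_def F.inv_mult_group F.m_assoc)
    ultimately show ?thesis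
      using q_eq[of "a \<otimes>\<^bsub>F\<^esub> b" "b \<otimes>\<^bsub>F\<^esub> a"] by simp
  qed
  define \<theta> where "\<theta> h = h \<otimes>\<^bsub>F\<^esub> inv\<^bsub>F\<^esub> \<psi> h \<otimes>\<^bsub>F\<^esub> h" for h
  have \<psi>_L: "\<psi> x \<in> L" if "x \<in> carrier F" for x
    using that \<psi>(2) by blast
  have \<theta>_L: "\<theta> h \<in> L" if "h \<in> L" for h
    using that \<psi>_L[OF L_car[OF that]] subgroup.m_closed[OF L] subgroup.m_inv_closed[OF L] by (simp add: \<theta>_def)
  have \<delta>: "\<psi> h \<otimes>\<^bsub>F\<^esub> inv\<^bsub>F\<^esub> h \<in> K (d - 1)" if "h \<in> L" for h
    using id1[OF that] normal.rcos_eq_iff[OF K_normal] L_car[OF that] by simp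
  have \<theta>_mult: "q (\<theta> (g \<otimes>\<^bsub>F\<^esub> h)) = q (\<theta> g) \<otimes>\<^bsub>?G\<^esub> q (\<theta> h)" if "g \<in> L" "h \<in> L" for g h
  proof -
    have car: "g \<in> carrier F" "h \<in> carrier F" "\<psi> g \<in> carrier F" "\<psi> h \<in> carrier F"
      using that L_car by auto
    \<comment> \<open>\<open>\<theta> (g h) = g (a b) h\<close>, whereas
      \<open>\<theta> g \<theta> h = g (b a) h\<close>; both \<open>a\<close> and \<open>b\<close>
      lie in \<open>K (d - 1)\<close>, whose elements commute modulo \<open>K d\<close>.\<close>
    define a where "a = h \<otimes>\<^bsub>F\<^esub> inv\<^bsub>F\<^esub> \<psi> h"
    define b where "b = inv\<^bsub>F\<^esub> \<psi> g \<otimes>\<^bsub>F\<^esub> g"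
    have "a = inv\<^bsub>F\<^esub> (\<psi> h \<otimes>\<^bsub>F\<^esub> inv\<^bsub>F\<^esub> h)"
      using car by (simp add: a_def F.inv_mult_group)
    then have a: "a \<in> K (d - 1)"
      using \<delta>[OF that(2)] subgroup.m_inv_closed[OF K_subgroup] by simp
    have "b = inv\<^bsub>F\<^esub> g \<otimes>\<^bsub>F\<^esub> inv\<^bsub>F\<^esub> (\<psi> g \<otimes>\<^bsub>F\<^esub> inv\<^bsub>F\<^esub> g) \<otimes>\<^bsub>F\<^esub> g"
      using car by (simp add: b_def F.inv_mult_group F.m_assoc) (simp flip: F.m_assoc)
    then have b: "b \<in> K (d - 1)"
      using \<delta>[OF that(1)] subgroup.m_inv_closed[OF K_subgroup] normal.inv_op_closed1[OF K_normal car(1)] by simp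
    have ab: "a \<in> carrier F" "b \<in> carrier F"
      using a b K_carrier by auto
    have "\<theta> (g \<otimes>\<^bsub>F\<^esub> h) = g \<otimes>\<^bsub>F\<^esub> (a \<otimes>\<^bsub>F\<^esub> b) \<otimes>\<^bsub>F\<^esub> h"
      using car by (simp add: \<theta>_def a_def b_def F.inv_mult_group F.m_assoc)
    then have "q (\<theta> (g \<otimes>\<^bsub>F\<^esub> h)) = q g \<otimes>\<^bsub>?G\<^esub> q (a \<otimes>\<^bsub>F\<^esub> b) \<otimes>\<^bsub>?G\<^esub> q h"
      using car ab by (simp del: mult_FactGroup)
    also have "\<dots> = q g \<otimes>\<^bsub>?G\<^esub> q (b \<otimes>\<^bsub>F\<^esub> a) \<otimes>\<^bsub>?G\<^esub> q h"
      using q_comm[OF a b] by simp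
    also have "\<dots> = q (g \<otimes>\<^bsub>F\<^esub> (b \<otimes>\<^bsub>F\<^esub> a) \<otimes>\<^bsub>F\<^esub> h)"
      using car ab by (simp del: mult_FactGroup)
    also have "g \<otimes>\<^bsub>F\<^esub> (b \<otimes>\<^bsub>F\<^esub> a) \<otimes>\<^bsub>F\<^esub> h = \<theta> g \<otimes>\<^bsub>F\<^esub> \<theta> h"
      using car by (simp add: \<theta>_def a_def b_def F.m_assoc)
    finally show ?thesis
      using \<theta>_L[THEN L_car] that by (simp del: mult_FactGroup)
  qed
  define f where "f w = q (\<theta> (\<psi> w))" for w
  have f_hom: "f \<in> hom F ?G"
  proof (rule homI)
    fix x y
    assume xy: "x \<in> carrier F" "y \<in> carrier F"
    then have \<psi>xy: "\<psi> x \<in> L" "\<psi> y \<in> L"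
      using \<psi>_L by auto
    show "f x \<in> carrier ?G"
      unfolding f_def using \<theta>_L[OF \<psi>xy(1), THEN L_car] by (rule q.hom_closed)
    show "f (x \<otimes>\<^bsub>F\<^esub> y) = f x \<otimes>\<^bsub>?G\<^esub> f y"
      unfolding f_def \<psi>.hom_mult[OF xy] by (rule \<theta>_mult[OF \<psi>xy])
  qed
  interpret f: group_hom F "?G" f
    using f_hom by unfold_locales
  have f_const: "f x = f y" if xy: "x \<in> carrier F" "y \<in> carrier F" and eq: "K d #>\<^bsub>F\<^esub> x = K d #>\<^bsub>F\<^esub> y" for x y
  proof -
    define k where "k = x \<otimes>\<^bsub>F\<^esub> inv\<^bsub>F\<^esub> y"
    have k: "k \<in> K d" "x = k \<otimes>\<^bsub>F\<^esub> y" "k \<in> carrier F"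
      using N.rcos_eq_iff[OF xy] eq xy by (simp_all add: k_def F.m_assoc)
    have "\<psi> k \<in> K d" "\<psi> (\<psi> k) \<in> K d"
      using hom_K[OF \<psi>(1)] k(1) by auto
    then have "\<theta> (\<psi> k) \<in> K d"
      unfolding \<theta>_def by (intro N.m_closed N.m_inv_closed)
    then have "f k = \<one>\<^bsub>?G\<^esub>"
      using N.rcos_const[OF F.is_group] by (simp add: f_def q_def)
    then show ?thesis
      using f.hom_mult[OF k(3) xy(2)] f.hom_closed[OF xy(2)] k(2) by (simp del: mult_FactGroup one_FactGroup)
  qed
  obtain \<rho> where \<rho>: "\<rho> \<in> hom ?G ?G" "\<And>x. x \<in> carrier F \<Longrightarrow> \<rho> (K d #>\<^bsub>F\<^esub> x) = f x"
    using FactGroup_universal[OF f_hom K_normal f_const] by blast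
  show ?thesis
  proof
    show "\<rho> \<in> hom ?G ?G"
      by (rule \<rho>)
    show "\<rho> ` carrier ?G \<subseteq> (\<lambda>w. K d #>\<^bsub>F\<^esub> w) ` L"
    proof
      fix y
      assume "y \<in> \<rho> ` carrier ?G"
      then obtain x where x: "x \<in> carrier F" "y = f x"
        using \<rho>(2) by (auto simp: carrier_FactGroup)
      then have "\<theta> (\<psi> x) \<in> L"
        using \<theta>_L \<psi>_L by blast
      then show "y \<in> (\<lambda>w. K d #>\<^bsub>F\<^esub> w) ` L"
        using x(2) by (auto simp: f_def q_def)
    qed
    fix h
    assume h: "h \<in> L"
    \<comment> \<open>\<open>\<delta>'\<close> lies in \<open>L\<close> and in the last layer, so
      modulo \<open>K d\<close> it is fixed by \<open>\<psi>\<close> and hence by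
      \<open>\<theta>\<close>. As \<open>\<theta> h = \<delta>'^-1 h\<close>, this gives
      \<open>\<theta> (\<psi> h) = \<theta> \<delta>' \<theta> h = h\<close> modulo
      \<open>K d\<close>.\<close>
    define \<delta>' where "\<delta>' = \<psi> h \<otimes>\<^bsub>F\<^esub> inv\<^bsub>F\<^esub> h"
    have h_car: "h \<in> carrier F" "\<psi> h \<in> carrier F"
      using h L_car by auto
    have \<delta>'L: "\<delta>' \<in> L" "\<delta>' \<in> K (d - 1)"
      using \<delta>[OF h] h \<psi>_L[OF h_car(1)] subgroup.m_closed[OF L] subgroup.m_inv_closed[OF L]
      by (simp_all add: \<delta>'_def)
    have \<delta>'_car: "\<delta>' \<in> carrier F" "\<psi> \<delta>' \<in> carrier F"
      using \<delta>'L L_car by auto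
    have \<psi>h: "\<psi> h = \<delta>' \<otimes>\<^bsub>F\<^esub> h"
      using h_car by (simp add: \<delta>'_def F.m_assoc)
    have "q (\<psi> \<delta>') = q \<delta>'"
      using id2[of \<delta>'] \<delta>'L by (simp add: q_def)
    then have q\<theta>\<delta>: "q (\<theta> \<delta>') = q \<delta>'"
      using \<delta>'_car by (simp add: \<theta>_def G.m_assoc del: mult_FactGroup one_FactGroup)
    have \<theta>h: "\<theta> h = inv\<^bsub>F\<^esub> \<delta>' \<otimes>\<^bsub>F\<^esub> h"
      using h_car by (simp add: \<theta>_def \<delta>'_def F.inv_mult_group F.m_assoc)
    have "f h = q (\<theta> \<delta>') \<otimes>\<^bsub>?G\<^esub> q (\<theta> h)"
      unfolding f_def \<psi>h by (rule \<theta>_mult[OF \<delta>'L(1) h])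
    also have "\<dots> = q (\<delta>' \<otimes>\<^bsub>F\<^esub> (inv\<^bsub>F\<^esub> \<delta>' \<otimes>\<^bsub>F\<^esub> h))"
      unfolding q\<theta>\<delta> \<theta>h using \<delta>'_car h_car by (intro q.hom_mult[symmetric]) auto
    also have "\<delta>' \<otimes>\<^bsub>F\<^esub> (inv\<^bsub>F\<^esub> \<delta>' \<otimes>\<^bsub>F\<^esub> h) = h"
      using \<delta>'_car h_car by (simp flip: F.m_assoc)
    finally show "\<rho> (K d #>\<^bsub>F\<^esub> h) = K d #>\<^bsub>F\<^esub> h"
      using \<rho>(2)[OF h_car(1)] by (simp add: q_def)
  qed
qed

text \<open>An element \<open>v\<close> of \<open>F\<close> is itself a word. The equation with left
  side \<open>v\<close> and right side the coset of \<open>v\<close> is solved in the quotient by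
  the generators, hence also in the image of \<open>L\<close>; lifting that solution to
  \<open>L\<close> defines \<open>\<psi>\<close> on the generators.\<close>

lemma verbally_closed_imp_fixes_each:
  assumes L: "subgroup L F" and vc: "verbally_closed (F Mod K d) ((\<lambda>w. K d #>\<^bsub>F\<^esub> w) ` L)"
  shows "fixes_each d L"
  unfolding fixes_each_def
proof
  fix v
  assume v: "v \<in> L"
  define q where "q w = K d #>\<^bsub>F\<^esub> w" for w
  define G where "G = F Mod K d"
  have q_hom: "q \<in> hom F G"
    unfolding q_def[abs_def] G_def by (rule normal.r_coset_hom_Mod[OF K_normal])
  interpret G: group G
    unfolding G_def by (rule normal.factorgroup_is_group[OF K_normal])
  interpret q: group_hom F G q
    using q_hom by unfold_locales
  have L_car: "h \<in> carrier F" if "h \<in> L" for h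
    using that subgroup.mem_carrier[OF L] by blast
  have letters: "\<forall>x \<in> set v. fst x < r"
    using L_car[OF v] by (simp add: carrier_free_group)
  have comp: "q (word_eval F \<eta> v) = word_eval G (\<lambda>i. q (\<eta> i)) v" if "\<And>i. i < r \<Longrightarrow> \<eta> i \<in> carrier F" for \<eta>
    using letters that by (intro word_eval_comp[OF F.is_group G.is_group q_hom]) auto
  have cong: "word_eval G a v = word_eval G b v" if "\<And>i. i < r \<Longrightarrow> a i = b i" for a b
    using letters that
    by (induction v) (auto simp: letter_val_def)
  \<comment> \<open>\<open>verbally_closed\<close> asks for a value at every index; those from
    \<open>r\<close> on do not occur in \<open>v\<close>.\<close>
  define a where "a i = (if i < r then q (free_gen i) else \<one>\<^bsub>G\<^esub>)" for i
  have "a i \<in> carrier G" for i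
    using free_gen_carrier[of i r] by (simp add: a_def)
  moreover have "word_eval G a v = q v"
    using cong[of a "\<lambda>i. q (free_gen i)"] comp[of free_gen] word_eval_free_gen[OF L_car[OF v]]
      free_gen_carrier by (simp add: a_def)
  ultimately obtain b where b: "\<And>i. b i \<in> q ` L" "word_eval G b v = q v"
    using vc v unfolding verbally_closed_def G_def[symmetric] q_def[abs_def, symmetric] by blast
  then have "\<forall>i. \<exists>h. h \<in> L \<and> q h = b i"
    by (metis imageE)
  then obtain \<eta> where \<eta>: "\<And>i. \<eta> i \<in> L" "\<And>i. q (\<eta> i) = b i"
    by metis
  show "\<exists>\<psi> \<in> hom F F. \<psi> ` carrier F \<subseteq> L \<and> K d #>\<^bsub>F\<^esub> \<psi> v = K d #>\<^bsub>F\<^esub> v"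
  proof (intro bexI conjI)
    show "word_eval F \<eta> \<in> hom F F"
      using \<eta>(1) L_car by (intro F.word_eval_hom) auto
    show "word_eval F \<eta> ` carrier F \<subseteq> L"
    proof (rule image_subsetI)
      fix x
      assume "x \<in> carrier F"
      then show "word_eval F \<eta> x \<in> L"
        using \<eta>(1) by (intro F.word_eval_in_subgroup[OF L, of r]) (simp_all add: carrier_free_group)
    qed
    show "K d #>\<^bsub>F\<^esub> word_eval F \<eta> v = K d #>\<^bsub>F\<^esub> v"
      using comp[of \<eta>] \<eta> L_car b(2) by (simp add: q_def)
  qed
qed

end

theorem theorem3:
  fixes r d :: nat and H :: "letter list set set"
  assumes "r \<ge> 1" and "d \<ge> 1"
    and "\<exists>a b. a \<in> carrier (free_solvable r d) \<and> b \<in> carrier (free_solvable r d) \<and>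
               H = generate (free_solvable r d) {a, b}"
    and "verbally_closed (free_solvable r d) H"
  shows "is_retract (free_solvable r d) H"
proof -
  interpret derived_tower r .
  have G: "free_solvable r d = F Mod K d"
    by (simp add: free_solvable_def K_def)
  let ?G = "F Mod K d"
  define q where "q w = K d #>\<^bsub>F\<^esub> w" for w
  have q_hom: "q \<in> hom F ?G"
    unfolding q_def[abs_def] by (rule normal.r_coset_hom_Mod[OF K_normal])
  interpret G: group "?G"
    by (rule normal.factorgroup_is_group[OF K_normal])
  interpret q: group_hom F "?G" q
    using q_hom by unfold_locales
  obtain a b where ab: "a \<in> carrier ?G" "b \<in> carrier ?G" "H = generate ?G {a, b}"
    using assms(3) unfolding G by blast
  obtain A B where A: "A \<in> carrier F" "a = q A" and B: "B \<in> carrier F" "b = q B"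
    using ab(1,2) unfolding carrier_FactGroup q_def by blast
  define L where "L = generate F {A, B}"
  have L: "subgroup L F"
    unfolding L_def using A B by (intro F.generate_is_subgroup) simp
  have H: "H = q ` L"
    unfolding L_def using q.generate_img[of "{A, B}"] A B ab(3) by simp
  have "fixes_each d L"
    using verbally_closed_imp_fixes_each[OF L] assms(4) unfolding G H q_def[abs_def] .
  then have "retractable d L"
    using retractable_two_generated[OF A(1) B(1) L_def] assms(2) by blast
  then obtain \<rho> where \<rho>: "\<rho> \<in> hom ?G ?G" "\<rho> ` carrier ?G \<subseteq> q ` L"
    "\<And>h. h \<in> L \<Longrightarrow> \<rho> (q h) = q h"
    using retractable_imp_retraction[OF L assms(2)] unfolding q_def by blast
  have "subgroup H ?G"
    using assms(4) unfolding G verbally_closed_def by (rule conjunct1)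
  then show ?thesis
    unfolding is_retract_def G H using \<rho> by (intro conjI exI[of _ \<rho>] ballI) auto
qed

end
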